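(* There is a polynomial-time approximation scheme (PTAS) for the min-max $r$-gather clustering problem on a tree, and there is a PTAS for the min-max $r$-gathering problem on a tree. That is, for each fixed $\epsilon>0$ there is a polynomial-time algorithm which, given an instance $\mathcal I$ whose metric is a tree metric, outputs a feasible solution of cost at most $(1+\epsilon)\mathrm{OPT}(\mathcal I)$.
   Context: A weighted tree $T=(V(T),E(T);l)$ is a connected acyclic undirected graph with non-negative edge lengths $l:E(T)\to\mathbb R_{\ge0}$; its tree metric $d(v,w)$ is the total length of the unique $v$-$w$ path. Users and facilities are located at vertices of $T$. Min-max $r$-gathering problem: given users $\mathcal U$, facilities $\mathcal F$ and a positive integer $r$, find $\pi:\mathcal U\to\mathcal F$ with $|\pi^{-1}(f)|\in\{0\}\cup[r,\infty)$ for every $f$, minimizing $\max_{u}d(u,\pi(u))$. Min-max $r$-gather clustering problem: given users $\mathcal U$ and a positive integer $r$, partition $\mathcal U$ into clusters each of size at least $r$, minimizing the maximum cluster diameter. $\mathrm{OPT}(\mathcal I)$ denotes the optimal value. *)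

theory Defs
  imports Complex_Main "HOL-Library.Disjoint_Sets" "HOL-Computational_Algebra.Polynomial"
begin

section \<open>Weighted trees and the tree metric\<close>

record 'v wtree =
  verts :: "'v set"
  edges :: "'v set set"
  len :: "'v set \<Rightarrow> real"

definition is_path :: "'v wtree \<Rightarrow> 'v \<Rightarrow> 'v list \<Rightarrow> 'v \<Rightarrow> bool" where
  "is_path T v p w \<longleftrightarrow>
     p \<noteq> [] \<and> hd p = v \<and> last p = w \<and> distinct p \<and> set p \<subseteq> verts T \<and>
     (\<forall>i. Suc i < length p \<longrightarrow> {p ! i, p ! Suc i} \<in> edges T)"

definition is_cycle :: "'v wtree \<Rightarrow> 'v list \<Rightarrow> bool" where
  "is_cycle T p \<longleftrightarrow>
     3 \<le> length p \<and> is_path T (hd p) p (last p) \<and> {last p, hd p} \<in> edges T"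

definition weighted_tree :: "'v wtree \<Rightarrow> bool" where
  "weighted_tree T \<longleftrightarrow>
     finite (verts T) \<and> verts T \<noteq> {} \<and>
     (\<forall>e\<in>edges T. \<exists>u\<in>verts T. \<exists>v\<in>verts T. u \<noteq> v \<and> e = {u, v}) \<and>
     (\<forall>v\<in>verts T. \<forall>w\<in>verts T. \<exists>p. is_path T v p w) \<and>
     (\<nexists>p. is_cycle T p) \<and>
     (\<forall>e\<in>edges T. 0 \<le> len T e)"

definition path_len :: "'v wtree \<Rightarrow> 'v list \<Rightarrow> real" where
  "path_len T p = (\<Sum>i<length p - 1. len T {p ! i, p ! Suc i})"

definition tree_dist :: "'v wtree \<Rightarrow> 'v \<Rightarrow> 'v \<Rightarrow> real" where
  "tree_dist T v w = path_len T (THE p. is_path T v p w)"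


section \<open>Min-max r-gathering and min-max r-gather clustering\<close>

text \<open>
  The parameter \<open>d\<close> is the distance of a user from a facility, respectively of two users.
  All distances are non-negative, so inserting \<open>0\<close> below the maximum only serves to give the
  value \<open>0\<close> to an empty set of users.
\<close>

definition gathering_feasible :: "'u set \<Rightarrow> 'f set \<Rightarrow> nat \<Rightarrow> ('u \<Rightarrow> 'f) \<Rightarrow> bool" where
  "gathering_feasible U F r \<pi> \<longleftrightarrow>
     (\<forall>u\<in>U. \<pi> u \<in> F) \<and>
     (\<forall>f\<in>F. card {u\<in>U. \<pi> u = f} = 0 \<or> r \<le> card {u\<in>U. \<pi> u = f})"

definition gathering_cost :: "('u \<Rightarrow> 'f \<Rightarrow> real) \<Rightarrow> 'u set \<Rightarrow> ('u \<Rightarrow> 'f) \<Rightarrow> real" where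
  "gathering_cost d U \<pi> = Max (insert 0 ((\<lambda>u. d u (\<pi> u)) ` U))"

definition clustering_feasible :: "'u set \<Rightarrow> nat \<Rightarrow> 'u set set \<Rightarrow> bool" where
  "clustering_feasible U r P \<longleftrightarrow> partition_on U P \<and> (\<forall>C\<in>P. r \<le> card C)"

definition cluster_diam :: "('u \<Rightarrow> 'u \<Rightarrow> real) \<Rightarrow> 'u set \<Rightarrow> real" where
  "cluster_diam d C = Max ((\<lambda>(u, v). d u v) ` (C \<times> C))"

definition clustering_cost :: "('u \<Rightarrow> 'u \<Rightarrow> real) \<Rightarrow> 'u set set \<Rightarrow> real" where
  "clustering_cost d P = Max (insert 0 (cluster_diam d ` P))"


section \<open>Model of computation\<close>

text \<open>
  Since edge lengths are arbitrary reals, algorithms are programs over binary trees whose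
  leaves may carry a real number. A program is a finite list of mutually recursive first-order
  functions of one argument, evaluated call-by-value in the manner of pure Lisp; every
  evaluation step costs one unit.

  Unit cost is harmless here. Numbers can only be added, subtracted and compared, and the only
  numerical constant is \<open>1\<close> (arbitrary real constants could carry non-uniform advice). There is
  no multiplication, rounding or bit access, so in \<open>t\<close> steps on integers the bit length grows
  by at most \<open>t\<close>; on rational inputs one first clears denominators. Trees are built one node at
  a time and inspected only at the root, so values can be shared as pointers. Hence, on binary
  encoded rational inputs, polynomial time in this model is polynomial time on a Turing machine.
\<close>

datatype val = VNil | VNum real | VPair val val

fun vsize :: "val \<Rightarrow> nat" where
  "vsize VNil = 1"
| "vsize (VNum a) = 1"
| "vsize (VPair x y) = 1 + vsize x + vsize y"

text \<open>The primitive operations are total: on arguments of the wrong shape they use a default.\<close>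

fun vfst :: "val \<Rightarrow> val" where
  "vfst (VPair x y) = x"
| "vfst _ = VNil"

fun vsnd :: "val \<Rightarrow> val" where
  "vsnd (VPair x y) = y"
| "vsnd _ = VNil"

fun vnum :: "val \<Rightarrow> real" where
  "vnum (VNum a) = a"
| "vnum _ = 0"

fun is_VNum :: "val \<Rightarrow> bool" where
  "is_VNum (VNum a) = True"
| "is_VNum _ = False"

fun is_VPair :: "val \<Rightarrow> bool" where
  "is_VPair (VPair x y) = True"
| "is_VPair _ = False"

text \<open>
  Variables are de Bruijn indices into the environment: \<open>ELet a b\<close> binds the value of \<open>a\<close> as
  variable \<open>0\<close> in \<open>b\<close>, and a function body sees its argument as variable \<open>0\<close> and nothing else.
\<close>

datatype expr =
    EVar nat
  | ENil
  | EOne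
  | EPair expr expr
  | EFst expr
  | ESnd expr
  | EAdd expr expr
  | ESub expr expr
  | EIfNum expr expr expr
  | EIfPair expr expr expr
  | EIfLess expr expr expr expr
  | ELet expr expr
  | ECall nat expr

type_synonym program = "expr list"

text \<open>\<open>eval P env e v t\<close>: in program \<open>P\<close>, expression \<open>e\<close> evaluates to \<open>v\<close> in \<open>t\<close> steps.\<close>

inductive eval :: "program \<Rightarrow> val list \<Rightarrow> expr \<Rightarrow> val \<Rightarrow> nat \<Rightarrow> bool" for P where
  Var: "i < length env \<Longrightarrow> eval P env (EVar i) (env ! i) 1"
| Nil: "eval P env ENil VNil 1"
| One: "eval P env EOne (VNum 1) 1"
| Pair: "eval P env a x s \<Longrightarrow> eval P env b y t \<Longrightarrow> eval P env (EPair a b) (VPair x y) (s + t + 1)"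
| Fst: "eval P env a x s \<Longrightarrow> eval P env (EFst a) (vfst x) (s + 1)"
| Snd: "eval P env a x s \<Longrightarrow> eval P env (ESnd a) (vsnd x) (s + 1)"
| Add: "eval P env a x s \<Longrightarrow> eval P env b y t \<Longrightarrow>
    eval P env (EAdd a b) (VNum (vnum x + vnum y)) (s + t + 1)"
| Sub: "eval P env a x s \<Longrightarrow> eval P env b y t \<Longrightarrow>
    eval P env (ESub a b) (VNum (vnum x - vnum y)) (s + t + 1)"
| IfNum: "eval P env a x s \<Longrightarrow> eval P env (if is_VNum x then b else c) y t \<Longrightarrow>
    eval P env (EIfNum a b c) y (s + t + 1)"
| IfPair: "eval P env a x s \<Longrightarrow> eval P env (if is_VPair x then b else c) y t \<Longrightarrow>
    eval P env (EIfPair a b c) y (s + t + 1)"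
| IfLess: "eval P env a x s \<Longrightarrow> eval P env a' x' s' \<Longrightarrow>
    eval P env (if vnum x < vnum x' then b else c) y t \<Longrightarrow>
    eval P env (EIfLess a a' b c) y (s + s' + t + 1)"
| Let: "eval P env a x s \<Longrightarrow> eval P (x # env) b y t \<Longrightarrow> eval P env (ELet a b) y (s + t + 1)"
| Call: "eval P env a x s \<Longrightarrow> f < length P \<Longrightarrow> eval P [x] (P ! f) y t \<Longrightarrow>
    eval P env (ECall f a) y (s + t + 1)"

inductive_cases eval_VarE: "eval P env (EVar i) v t"
inductive_cases eval_NilE: "eval P env ENil v t"
inductive_cases eval_OneE: "eval P env EOne v t"
inductive_cases eval_PairE: "eval P env (EPair a b) v t"
inductive_cases eval_FstE: "eval P env (EFst a) v t"
inductive_cases eval_SndE: "eval P env (ESnd a) v t"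
inductive_cases eval_AddE: "eval P env (EAdd a b) v t"
inductive_cases eval_SubE: "eval P env (ESub a b) v t"
inductive_cases eval_IfNumE: "eval P env (EIfNum a b c) v t"
inductive_cases eval_IfPairE: "eval P env (EIfPair a b c) v t"
inductive_cases eval_IfLessE: "eval P env (EIfLess a a' b c) v t"
inductive_cases eval_LetE: "eval P env (ELet a b) v t"
inductive_cases eval_CallE: "eval P env (ECall f a) v t"

text \<open>
  Evaluation is deterministic, so the existence of a result in \<open>t\<close> steps means that the program
  halts after \<open>t\<close> steps with that result.
\<close>

lemma eval_deterministic:
  "eval P env e v t \<Longrightarrow> eval P env e v' t' \<Longrightarrow> v' = v \<and> t' = t"
proof (induction arbitrary: v' t' rule: eval.induct)
  case (Var i env) then show ?case by (auto elim: eval_VarE)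
next
  case (Nil env) then show ?case by (auto elim: eval_NilE)
next
  case (One env) then show ?case by (auto elim: eval_OneE)
next
  case Pair from Pair.prems show ?case by (rule eval_PairE) (auto dest!: Pair.IH)
next
  case Fst from Fst.prems show ?case by (rule eval_FstE) (auto dest!: Fst.IH)
next
  case Snd from Snd.prems show ?case by (rule eval_SndE) (auto dest!: Snd.IH)
next
  case Add from Add.prems show ?case by (rule eval_AddE) (auto dest!: Add.IH)
next
  case Sub from Sub.prems show ?case by (rule eval_SubE) (auto dest!: Sub.IH)
next
  case IfNum from IfNum.prems show ?case by (rule eval_IfNumE) (auto dest!: IfNum.IH)
next
  case IfPair from IfPair.prems show ?case by (rule eval_IfPairE) (auto dest!: IfPair.IH)
next
  case IfLess from IfLess.prems show ?case by (rule eval_IfLessE) (auto dest!: IfLess.IH)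
next
  case Let from Let.prems show ?case by (rule eval_LetE) (auto dest!: Let.IH)
next
  case Call from Call.prems show ?case by (rule eval_CallE) (auto dest!: Call.IH)
qed

definition runs :: "program \<Rightarrow> val \<Rightarrow> val \<Rightarrow> nat \<Rightarrow> bool" where
  "runs P x y t \<longleftrightarrow> P \<noteq> [] \<and> eval P [x] (P ! 0) y t"


section \<open>Approximation schemes\<close>

text \<open>
  A minimisation problem consists of a set of instances, a relation between instances and the
  inputs that encode them, feasible solutions, their costs, and a relation between solutions
  and the outputs that encode them. Programs have to halt in polynomial time on every instance;
  the output is unconstrained if there is no feasible solution.
\<close>

record ('i, 's) min_problem =
  instances :: "'i set"
  encodes :: "'i \<Rightarrow> val \<Rightarrow> bool"
  feasible :: "'i \<Rightarrow> 's \<Rightarrow> bool"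
  cost :: "'i \<Rightarrow> 's \<Rightarrow> real"
  sol_encodes :: "'i \<Rightarrow> 's \<Rightarrow> val \<Rightarrow> bool"

definition OPT :: "('i, 's) min_problem \<Rightarrow> 'i \<Rightarrow> real" where
  "OPT Q I = (INF s\<in>{s. feasible Q I s}. cost Q I s)"

definition has_PTAS :: "('i, 's) min_problem \<Rightarrow> bool" where
  "has_PTAS Q \<longleftrightarrow>
     (\<forall>\<epsilon>::real. \<epsilon> > 0 \<longrightarrow>
       (\<exists>(P :: program) (q :: nat poly). \<forall>I\<in>instances Q. \<forall>x. encodes Q I x \<longrightarrow>
         (\<exists>y t. runs P x y t \<and> t \<le> poly q (vsize x) \<and>
           ((\<exists>s. feasible Q I s) \<longrightarrow>
             (\<exists>s. sol_encodes Q I s y \<and> feasible Q I s \<and>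
                  cost Q I s \<le> (1 + \<epsilon>) * OPT Q I)))))"


section \<open>The two problems on trees\<close>

definition val_of_nat :: "nat \<Rightarrow> val" where
  "val_of_nat n = VNum (real n)"

definition val_of_list :: "('a \<Rightarrow> val) \<Rightarrow> 'a list \<Rightarrow> val" where
  "val_of_list f xs = foldr (\<lambda>x. VPair (f x)) xs VNil"

text \<open>
  Vertices are named by natural numbers. A tree is given by a list of its vertices and a list
  of its edges with their lengths, each in an arbitrary order without repetition.
\<close>

definition tree_encodes :: "nat wtree \<Rightarrow> val \<Rightarrow> bool" where
  "tree_encodes T x \<longleftrightarrow>
     (\<exists>vs es. distinct vs \<and> set vs = verts T \<and>
        distinct (map (\<lambda>(u, v). {u, v}) es) \<and> (\<lambda>(u, v). {u, v}) ` set es = edges T \<and>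
        x = VPair (val_of_list val_of_nat vs)
              (val_of_list
                (\<lambda>(u, v). VPair (val_of_nat u) (VPair (val_of_nat v) (VNum (len T {u, v})))) es))"

text \<open>
  An instance \<open>(T, us, r)\<close> or \<open>(T, us, fs, r)\<close> lists the locations of the users and of the
  facilities; several of them may share a vertex. User \<open>i < length us\<close> is located at \<open>us ! i\<close>
  and facility \<open>j < length fs\<close> at \<open>fs ! j\<close>. A clustering is output as a list of clusters, each a
  list of users, and an assignment as the list of the facilities of the users
  \<open>0, \<dots>, length us - 1\<close>.
\<close>

definition tree_clustering_problem :: "(nat wtree \<times> nat list \<times> nat, nat set set) min_problem" where
  "tree_clustering_problem =
     \<lparr> instances = {(T, us, r). weighted_tree T \<and> set us \<subseteq> verts T \<and> 0 < r},
       encodes = (\<lambda>(T, us, r) x. \<exists>z. tree_encodes T z \<and>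
         x = VPair z (VPair (val_of_list val_of_nat us) (val_of_nat r))),
       feasible = (\<lambda>(T, us, r). clustering_feasible {..<length us} r),
       cost = (\<lambda>(T, us, r). clustering_cost (\<lambda>u v. tree_dist T (us ! u) (us ! v))),
       sol_encodes = (\<lambda>_ C y. \<exists>css. C = set ` set css \<and>
         y = val_of_list (val_of_list val_of_nat) css) \<rparr>"

definition tree_gathering_problem ::
    "(nat wtree \<times> nat list \<times> nat list \<times> nat, nat \<Rightarrow> nat) min_problem" where
  "tree_gathering_problem =
     \<lparr> instances =
         {(T, us, fs, r). weighted_tree T \<and> set us \<subseteq> verts T \<and> set fs \<subseteq> verts T \<and> 0 < r},
       encodes = (\<lambda>(T, us, fs, r) x. \<exists>z. tree_encodes T z \<and>
         x = VPair z (VPair (val_of_list val_of_nat us)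
               (VPair (val_of_list val_of_nat fs) (val_of_nat r)))),
       feasible = (\<lambda>(T, us, fs, r). gathering_feasible {..<length us} {..<length fs} r),
       cost = (\<lambda>(T, us, fs, r).
         gathering_cost (\<lambda>u f. tree_dist T (us ! u) (fs ! f)) {..<length us}),
       sol_encodes = (\<lambda>(T, us, fs, r) \<pi> y.
         y = val_of_list val_of_nat (map \<pi> [0..<length us])) \<rparr>"

end

theory Submission
  imports Defs
begin

text \<open>Both problems reduce to a gap problem for a distance bound \<open>b\<close>: find a solution of cost at
  most \<open>(1 + \<epsilon>) b\<close> if there is one of cost at most \<open>b\<close>. The optimum has the form
  \<open>x + y - 2 z\<close> for depths \<open>x\<close>, \<open>y\<close>, \<open>z\<close> of vertices, so there are polynomially many bounds to try.

  For gathering, the tree is rooted and the depths are rounded to a net whose points are more than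
  \<open>\<epsilon>' b\<close> apart, for a small multiple \<open>\<epsilon>'\<close> of \<open>\<epsilon>\<close>. A user and a facility that meet at a vertex
  \<open>v\<close> have as distance the sum of their depths minus twice the depth of \<open>v\<close>. Hence a partial
  solution in the subtree of \<open>v\<close> matters to the rest of the tree only through the multisets of
  rounded depths of the users to be served outside and of the slots to be filled from outside.
  These depths exceed the depth of \<open>v\<close> by \<open>O(b)\<close>, so they take \<open>O(1 / \<epsilon>)\<close> values and there are
  polynomially many classes. A dynamic program keeps one representative of each.

  Clustering is gathering with half the distance bound and facilities everywhere on the tree: a
  cluster of diameter \<open>b\<close> lies within \<open>b / 2\<close> of the point at height \<open>b / 2\<close> above its deepest user.
  Above each vertex, \<open>O(1 / \<epsilon>)\<close> subdivision points approximate all these centres.\<close>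

section \<open>Polynomial-time functions\<close>

text \<open>The lower bound \<open>r\<close> needs no counting along the tree: a facility fixes its
  number of slots, zero or at least \<open>r\<close>, at its own vertex, and every slot must be
  filled in the end. Users of equal rounded depth are interchangeable, so completeness only asks for
  a configuration with the rounded depths of the given assignment, possibly with other users in it.

  The model can neither divide nor round. Hence \<open>b\<close> is not divided by \<open>M\<close>;
  depths are multiplied by \<open>M\<close> (for clustering by \<open>2 * M\<close>), the rounding
  error is \<open>b\<close> itself, and depths are rounded to a separated subset of the depths that
  occur instead of to a grid. In the unit \<open>b\<close>, the bound \<open>M\<close> gains 1 for
  the subdivision, 2 for rounding a user and a facility, and 2 more for undoing that rounding in the
  solution. This gives the factor \<open>1 + 5 / M\<close>.

  Running times are handled by an algebra of functions closed under folds whose accumulator grows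
  additively. Its members must be polynomial on every input, meaningful or not, so table sizes are
  capped explicitly, and completeness has to show that the cap never rejects a new class.\<close>

class encodable =
  fixes enc :: "'a \<Rightarrow> val"

instantiation nat :: encodable
begin
definition enc_nat :: "nat \<Rightarrow> val" where "enc_nat = val_of_nat"
instance ..
end

instantiation real :: encodable
begin
definition enc_real :: "real \<Rightarrow> val" where "enc_real = VNum"
instance ..
end

text \<open>Truth is coded as a pair, so that \<open>EIfPair\<close> serves both as the conditional
  and as the case split on lists.\<close>

instantiation bool :: encodable
begin
definition enc_bool :: "bool \<Rightarrow> val" where "enc_bool b = (if b then VPair VNil VNil else VNil)"
instance ..
end

instantiation prod :: (encodable, encodable) encodable
begin
definition enc_prod :: "'a \<times> 'b \<Rightarrow> val" where "enc_prod z = VPair (enc (fst z)) (enc (snd z))"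
instance ..
end

instantiation list :: (encodable) encodable
begin
definition enc_list :: "'a list \<Rightarrow> val" where "enc_list = val_of_list enc"
instance ..
end

abbreviation esize :: "'a::encodable \<Rightarrow> nat" where "esize x \<equiv> vsize (enc x)"

lemma enc_Nil [simp]: "enc [] = VNil"
  by (simp add: enc_list_def val_of_list_def)

lemma enc_Cons [simp]: "enc (x # xs) = VPair (enc x) (enc xs)"
  by (simp add: enc_list_def val_of_list_def)

lemma enc_Pair [simp]: "enc (x, y) = VPair (enc x) (enc y)"
  by (simp add: enc_prod_def)

lemma enc_num [simp]: "enc (n::nat) = VNum (real n)" "enc (a::real) = VNum a"
  by (simp_all add: enc_nat_def val_of_nat_def enc_real_def)

lemma enc_bool_simps [simp]: "enc True = VPair VNil VNil" "enc False = VNil"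
  by (simp_all add: enc_bool_def)

lemma esize_bool: "esize (b::bool) \<le> 3"
  by (cases b) auto

lemma esize_elem: "y \<in> set ys \<Longrightarrow> esize y < esize ys"
  by (induction ys) auto

lemma length_esize: "length ys < esize ys"
  by (induction ys) auto

lemma poly_nat_mono: "x \<le> y \<Longrightarrow> poly (p :: nat poly) x \<le> poly p y"
  by (induction p) (auto intro!: add_mono mult_mono)

text \<open>The entry index is explicit because linking moves a program into the middle of a larger
  one.\<close>

definition computes :: "program \<Rightarrow> nat \<Rightarrow> ('a::encodable \<Rightarrow> 'b::encodable) \<Rightarrow> nat poly \<Rightarrow> bool" where
  "computes P i f p \<longleftrightarrow> i < length P \<and>
     (\<forall>x. \<exists>t. eval P [enc x] (P ! i) (enc (f x)) t \<and> t \<le> poly p (esize x) \<and>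
        esize (f x) \<le> poly p (esize x))"

text \<open>The output size has to be bounded separately: sharing lets a program build values of
  exponential size.\<close>

definition polytime :: "('a::encodable \<Rightarrow> 'b::encodable) \<Rightarrow> bool" where
  "polytime f \<longleftrightarrow> (\<exists>P p. computes P 0 f p)"

lemma polytimeI:
  assumes "\<And>x. \<exists>t. eval (e # Q) [enc x] e (enc (f x)) t \<and> t \<le> poly q (esize x)"
    and "\<And>x. esize (f x) \<le> poly r (esize x)"
  shows "polytime f"
proof -
  have "computes (e # Q) 0 f (q + r)"
    unfolding computes_def
  proof (intro conjI allI)
    fix x
    obtain t where "eval (e # Q) [enc x] e (enc (f x)) t \<and> t \<le> poly q (esize x)"
      using assms(1) by blast
    then show "\<exists>t. eval (e # Q) [enc x] ((e # Q) ! 0) (enc (f x)) t \<and>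
        t \<le> poly (q + r) (esize x) \<and> esize (f x) \<le> poly (q + r) (esize x)"
      using assms(2)[of x] by (intro exI[of _ t]) auto
  qed simp
  then show ?thesis unfolding polytime_def by blast
qed

section \<open>Linking programs\<close>

primrec shift :: "nat \<Rightarrow> expr \<Rightarrow> expr" where
  "shift k (EVar i) = EVar i"
| "shift k ENil = ENil"
| "shift k EOne = EOne"
| "shift k (EPair a b) = EPair (shift k a) (shift k b)"
| "shift k (EFst a) = EFst (shift k a)"
| "shift k (ESnd a) = ESnd (shift k a)"
| "shift k (EAdd a b) = EAdd (shift k a) (shift k b)"
| "shift k (ESub a b) = ESub (shift k a) (shift k b)"
| "shift k (EIfNum a b c) = EIfNum (shift k a) (shift k b) (shift k c)"
| "shift k (EIfPair a b c) = EIfPair (shift k a) (shift k b) (shift k c)"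
| "shift k (EIfLess a a' b c) = EIfLess (shift k a) (shift k a') (shift k b) (shift k c)"
| "shift k (ELet a b) = ELet (shift k a) (shift k b)"
| "shift k (ECall f a) = ECall (k + f) (shift k a)"

lemma eval_time: "eval P env e v t \<Longrightarrow> t = t' \<Longrightarrow> eval P env e v t'"
  by simp

text \<open>Only calls refer to positions in the program, and environments hold values, not code.
  Relocating every call by the length of the prefix \<open>R\<close> therefore changes neither
  results nor costs.\<close>

lemma eval_shift:
  assumes "eval P env e v t"
  shows "eval (R @ map (shift (length R)) P @ S) env (shift (length R) e) v t"
  using assms
proof (induction rule: eval.induct)
  case (IfNum env a x s b c y t)
  then show ?case
    by (cases "is_VNum x") (auto intro!: eval_time[OF eval.IfNum])
next
  case (IfPair env a x s b c y t)
  then show ?case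
    by (cases "is_VPair x") (auto intro!: eval_time[OF eval.IfPair])
next
  case (IfLess env a x s a' x' s' b c y t)
  then show ?case
    by (cases "vnum x < vnum x'") (auto intro!: eval_time[OF eval.IfLess])
next
  case (Call env a x s f y t)
  then show ?case by (auto intro!: eval_time[OF eval.Call] simp: nth_append)
qed (auto intro: eval_time[OF eval.Var] eval_time[OF eval.Nil] eval_time[OF eval.One] eval_time[OF eval.Pair] eval_time[OF eval.Fst] eval_time[OF eval.Snd] eval_time[OF eval.Add]
    eval_time[OF eval.Sub] eval_time[OF eval.Let])

lemma computes_shift:
  assumes "computes P i f p" "poly p \<le> poly q"
  shows "computes (R @ map (shift (length R)) P @ S) (length R + i) f q"
  unfolding computes_def
proof (intro conjI allI)
  have i: "i < length P" using assms by (simp add: computes_def)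
  then show "length R + i < length (R @ map (shift (length R)) P @ S)" by simp
  fix x
  from assms(1) obtain t where
    t: "eval P [enc x] (P ! i) (enc (f x)) t" "t \<le> poly p (esize x)" "esize (f x) \<le> poly p (esize x)"
    unfolding computes_def by blast
  with eval_shift[OF t(1), of R S] i assms(2)
  show "\<exists>t. eval (R @ map (shift (length R)) P @ S) [enc x]
       ((R @ map (shift (length R)) P @ S) ! (length R + i)) (enc (f x)) t \<and>
      t \<le> poly q (esize x) \<and> esize (f x) \<le> poly q (esize x)"
    by (intro exI[of _ t]) (auto simp: nth_append le_fun_def intro: order_trans)
qed

text \<open>The main function \<open>e\<close> stays arbitrary because it calls the three functions
  through the indices obtained here, and may also call itself at index 0. Uses with fewer functions
  repeat one of them.\<close>

lemma link3:
  assumes "polytime f" "polytime g" "polytime h"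
  obtains Q i j k p where
    "\<And>e. computes (e # Q) i f p" "\<And>e. computes (e # Q) j g p" "\<And>e. computes (e # Q) k h p"
proof -
  obtain P1 p1 P2 p2 P3 p3 where
    c: "computes P1 0 f p1" "computes P2 0 g p2" "computes P3 0 h p3"
    using assms unfolding polytime_def by blast
  let ?p = "p1 + p2 + p3"
  let ?A = "map (shift 1) P1"
  let ?B = "map (shift (1 + length P1)) P2"
  let ?C = "map (shift (1 + length P1 + length P2)) P3"
  have "computes (e # ?A @ ?B @ ?C) 1 f ?p" for e
    using computes_shift[OF c(1), of ?p "[e]" "?B @ ?C"] by (simp add: le_fun_def)
  moreover have "computes (e # ?A @ ?B @ ?C) (1 + length P1) g ?p" for e
    using computes_shift[OF c(2), of ?p "e # ?A" "?C"] by (simp add: le_fun_def)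
  moreover have "computes (e # ?A @ ?B @ ?C) (1 + length P1 + length P2) h ?p" for e
    using computes_shift[OF c(3), of ?p "e # ?A @ ?B" "[]"] by (simp add: le_fun_def)
  ultimately show ?thesis by (rule that)
qed

lemma computes_call:
  assumes "computes P i f p" "eval P env a (enc x) s"
  shows "\<exists>t. eval P env (ECall i a) (enc (f x)) t \<and> t \<le> s + poly p (esize x) + 1"
proof -
  from assms(1) obtain t where t: "eval P [enc x] (P ! i) (enc (f x)) t" "t \<le> poly p (esize x)"
    and i: "i < length P"
    unfolding computes_def by blast
  from eval.Call[OF assms(2) i t(1)] t(2) show ?thesis by force
qed

lemma computes_size: "computes P i f p \<Longrightarrow> esize (f x) \<le> poly p (esize x)"
  unfolding computes_def by blast

lemma polytime_size:
  assumes "polytime f"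
  obtains p where "\<And>x. esize (f x) \<le> poly p (esize x)"
  using assms unfolding polytime_def computes_def by blast

lemma eval_Var0 [simp]: "eval P (x # env) (EVar 0) x 1" "eval P (x # env) (EVar 0) x (Suc 0)"
  using eval.Var[of 0 "x # env" P] by simp_all

lemma eval_Var1 [simp]: "eval P (x # y # env) (EVar 1) y 1" "eval P (x # y # env) (EVar (Suc 0)) y 1"
  using eval.Var[of 1 "x # y # env" P] by simp_all

lemma computes_call0:
  assumes "computes P i f p"
  obtains t where "eval P (enc x # env) (ECall i (EVar 0)) (enc (f x)) t" "t \<le> poly p (esize x) + 2"
  using computes_call[OF assms eval_Var0(1)] by force

section \<open>Closure under composition, branching and the primitive operations\<close>

named_theorems polytime_intros

lemma polytime_id [polytime_intros]: "polytime (\<lambda>x. x)"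
proof (rule polytimeI)
  show "\<exists>t. eval [EVar 0] [enc x] (EVar 0) (enc x) t \<and> t \<le> poly 1 (esize x)" for x :: 'a
    by (rule exI[of _ 1]) simp
  show "esize x \<le> poly [:0, 1:] (esize x)" for x :: 'a
    by simp
qed

text \<open>The time of \<open>g\<close> is polynomial in the size of \<open>f x\<close>; the output
  bound of \<open>f\<close> turns this into a composition of polynomials in the size of
  \<open>x\<close>.\<close>

lemma polytime_comp:
  assumes g: "polytime g" and f: "polytime f"
  shows "polytime (\<lambda>x. g (f x))"
proof -
  obtain Q i j k p where
    c: "\<And>e. computes (e # Q) i f p" "\<And>e. computes (e # Q) j g p"
    by (rule link3[OF f g g]) (rule that)
  let ?e = "ECall j (ECall i (EVar 0))"
  show ?thesis
  proof (rule polytimeI)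
    fix x
    obtain t where t: "eval (?e # Q) [enc x] (ECall i (EVar 0)) (enc (f x)) t" "t \<le> poly p (esize x) + 2"
      by (rule computes_call0[OF c(1)])
    obtain t' where "eval (?e # Q) [enc x] ?e (enc (g (f x))) t'" "t' \<le> t + poly p (esize (f x)) + 1"
      using computes_call[OF c(2) t(1)] by blast
    moreover have "poly p (esize (f x)) \<le> poly p (poly p (esize x))"
      by (rule poly_nat_mono[OF computes_size[OF c(1)]])
    ultimately show "\<exists>t. eval (?e # Q) [enc x] ?e (enc (g (f x))) t \<and> t \<le> poly (p + pcompose p p + 3) (esize x)"
      using t(2) by (intro exI[of _ t']) (simp add: poly_pcompose)
    show "esize (g (f x)) \<le> poly (pcompose p p) (esize x)"
      using order_trans[OF computes_size[OF c(2)] poly_nat_mono[OF computes_size[OF c(1)]]]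
      by (simp add: poly_pcompose)
  qed
qed

lemma polytime_Pair [polytime_intros]:
  assumes f: "polytime f" and g: "polytime g"
  shows "polytime (\<lambda>x. (f x, g x))"
proof -
  obtain Q i j k p where
    c: "\<And>e. computes (e # Q) i f p" "\<And>e. computes (e # Q) j g p"
    by (rule link3[OF f g g]) (rule that)
  let ?e = "EPair (ECall i (EVar 0)) (ECall j (EVar 0))"
  show ?thesis
  proof (rule polytimeI)
    fix x
    obtain t where t: "eval (?e # Q) [enc x] (ECall i (EVar 0)) (enc (f x)) t" "t \<le> poly p (esize x) + 2"
      by (rule computes_call0[OF c(1)])
    obtain t' where t': "eval (?e # Q) [enc x] (ECall j (EVar 0)) (enc (g x)) t'" "t' \<le> poly p (esize x) + 2"
      by (rule computes_call0[OF c(2)])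
    show "\<exists>t. eval (?e # Q) [enc x] ?e (enc (f x, g x)) t \<and> t \<le> poly (p + p + 5) (esize x)"
      using eval.Pair[OF t(1) t'(1)] t(2) t'(2) by (intro exI[of _ "t + t' + 1"]) simp
    show "esize (f x, g x) \<le> poly (p + p + 1) (esize x)"
      using computes_size[OF c(1), of x] computes_size[OF c(2), of x] by simp
  qed
qed

lemma polytime_if [polytime_intros]:
  assumes b: "polytime b" and f: "polytime f" and g: "polytime g"
  shows "polytime (\<lambda>x. if b x then f x else g x)"
proof -
  obtain Q i j k p where
    c: "\<And>e. computes (e # Q) i b p" "\<And>e. computes (e # Q) j f p" "\<And>e. computes (e # Q) k g p"
    by (rule link3[OF b f g]) (rule that)
  let ?e = "EIfPair (ECall i (EVar 0)) (ECall j (EVar 0)) (ECall k (EVar 0))"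
  show ?thesis
  proof (rule polytimeI)
    fix x
    obtain s where s: "eval (?e # Q) [enc x] (ECall i (EVar 0)) (enc (b x)) s" "s \<le> poly p (esize x) + 2"
      by (rule computes_call0[OF c(1)])
    obtain t where t: "eval (?e # Q) [enc x] (ECall j (EVar 0)) (enc (f x)) t" "t \<le> poly p (esize x) + 2"
      by (rule computes_call0[OF c(2)])
    obtain t' where t': "eval (?e # Q) [enc x] (ECall k (EVar 0)) (enc (g x)) t'" "t' \<le> poly p (esize x) + 2"
      by (rule computes_call0[OF c(3)])
    have "eval (?e # Q) [enc x] ?e (enc (if b x then f x else g x)) (s + (if b x then t else t') + 1)"
      using t(1) t'(1) by (cases "b x") (auto intro!: eval.IfPair[OF s(1)] eval.IfPair[OF s(1), simplified])
    then show "\<exists>t. eval (?e # Q) [enc x] ?e (enc (if b x then f x else g x)) t \<and> t \<le> poly (p + p + 5) (esize x)"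
      using s(2) t(2) t'(2) by (intro exI[of _ "s + (if b x then t else t') + 1"]) auto
    show "esize (if b x then f x else g x) \<le> poly (p + p) (esize x)"
      using computes_size[OF c(2), of x] computes_size[OF c(3), of x] by simp
  qed
qed

lemma polytime_case_list [polytime_intros]:
  assumes l: "polytime l" and f: "polytime f"
    and g: "polytime (\<lambda>z. g (fst z) (fst (snd z)) (snd (snd z)))"
  shows "polytime (\<lambda>x. case l x of [] \<Rightarrow> f x | y # ys \<Rightarrow> g x y ys)"
proof -
  obtain Q i j k p where
    c: "\<And>e. computes (e # Q) i l p" "\<And>e. computes (e # Q) j f p"
    "\<And>e. computes (e # Q) k (\<lambda>z. g (fst z) (fst (snd z)) (snd (snd z))) p"
    by (rule link3[OF l f g]) (rule that)
  \<comment> \<open>A called function sees nothing but its argument, so \<open>x\<close> has to be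
    passed to the branches; under the \<open>ELet\<close> it is variable 1.\<close>
  let ?e = "ELet (ECall i (EVar 0)) (EIfPair (EVar 0) (ECall k (EPair (EVar 1) (EVar 0))) (ECall j (EVar 1)))"
  let ?h = "\<lambda>x. case l x of [] \<Rightarrow> f x | y # ys \<Rightarrow> g x y ys"
  show ?thesis
  proof (rule polytimeI)
    fix x
    obtain s where s: "eval (?e # Q) [enc x] (ECall i (EVar 0)) (enc (l x)) s" "s \<le> poly p (esize x) + 2"
      by (rule computes_call0[OF c(1)])
    have sz: "esize (l x) \<le> poly p (esize x)" by (rule computes_size[OF c(1)])
    let ?E = "[enc (l x), enc x]"
    let ?q = "pcompose p (p + [:1, 1:])"
    have hsz: "esize (?h x) \<le> poly (p + ?q) (esize x)"
    proof (cases "l x")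
      case Nil
      then show ?thesis using computes_size[OF c(2), of x] by simp
    next
      case (Cons y ys)
      have "esize (g x y ys) \<le> poly p (esize (x, y, ys))"
        using computes_size[OF c(3), of "(x, y, ys)"] by simp
      also have "\<dots> \<le> poly p (poly p (esize x) + (esize x + 1))"
        using sz Cons by (intro poly_nat_mono) simp
      finally show ?thesis using Cons by (simp add: poly_pcompose algebra_simps)
    qed
    then show "esize (?h x) \<le> poly (p + ?q) (esize x)" .
    have "\<exists>t. eval (?e # Q) ?E (EIfPair (EVar 0) (ECall k (EPair (EVar 1) (EVar 0))) (ECall j (EVar 1)))
        (enc (?h x)) t \<and> t \<le> poly (p + ?q + 10) (esize x)"
    proof (cases "l x")
      case Nil
      obtain t where t: "eval (?e # Q) ?E (ECall j (EVar 1)) (enc (f x)) t" "t \<le> 1 + poly p (esize x) + 1"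
        using computes_call[OF c(2)] eval_Var1(1) by blast
      have "eval (?e # Q) ?E (EIfPair (EVar 0) (ECall k (EPair (EVar 1) (EVar 0))) (ECall j (EVar 1)))
        (enc (?h x)) (1 + t + 1)"
        using t(1) Nil by (intro eval.IfPair[OF eval_Var0(1)]) auto
      then show ?thesis using t(2) by (intro exI[of _ "1 + t + 1"]) auto
    next
      case (Cons y ys)
      \<comment> \<open>A nonempty list is encoded as the pair of its head and tail, so pairing
        \<open>x\<close> with the list already yields the encoded triple.\<close>
      have "eval (?e # Q) ?E (EPair (EVar 1) (EVar 0)) (enc (x, y, ys)) (1 + 1 + 1)"
        using eval.Pair[OF eval_Var1(1) eval_Var0(1), where P = "?e # Q"] Cons by simp
      from computes_call[OF c(3) this] obtain t where
        t: "eval (?e # Q) ?E (ECall k (EPair (EVar 1) (EVar 0))) (enc (g x y ys)) t"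
          "t \<le> 3 + poly p (esize (x, y, ys)) + 1"
        by auto
      have "poly p (esize (x, y, ys)) \<le> poly p (poly p (esize x) + (esize x + 1))"
        using sz Cons by (intro poly_nat_mono) simp
      moreover have "eval (?e # Q) ?E (EIfPair (EVar 0) (ECall k (EPair (EVar 1) (EVar 0))) (ECall j (EVar 1)))
        (enc (?h x)) (1 + t + 1)"
        using t(1) Cons by (intro eval.IfPair[OF eval_Var0(1)]) auto
      ultimately show ?thesis using t(2)
        by (intro exI[of _ "1 + t + 1"]) (auto simp: poly_pcompose algebra_simps)
    qed
    then obtain t where t: "eval (?e # Q) ?E (EIfPair (EVar 0) (ECall k (EPair (EVar 1) (EVar 0))) (ECall j (EVar 1)))
        (enc (?h x)) t" "t \<le> poly (p + ?q + 10) (esize x)" by blast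
    show "\<exists>t. eval (?e # Q) [enc x] ?e (enc (?h x)) t \<and> t \<le> poly (p + p + ?q + 13) (esize x)"
      using eval.Let[OF s(1) t(1)] s(2) t(2) by (intro exI[of _ "s + t + 1"]) simp
  qed
qed

lemma polytime_prim:
  assumes "\<And>x. \<exists>t. eval [e] [enc x] e (enc (f x)) t \<and> t \<le> k" "\<And>x. esize (f x) \<le> esize x + k"
  shows "polytime f"
proof (rule polytimeI)
  show "\<exists>t. eval [e] [enc x] e (enc (f x)) t \<and> t \<le> poly [:k:] (esize x)" for x
    using assms(1) by simp
  show "esize (f x) \<le> poly [:k, 1:] (esize x)" for x
    using assms(2)[of x] by simp
qed

lemma polytime_fst [polytime_intros]:
  assumes "polytime f" shows "polytime (\<lambda>x. fst (f x))"
proof (rule polytime_comp[OF _ assms], rule polytime_prim)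
  fix x :: "'b \<times> 'c"
  show "\<exists>t. eval [EFst (EVar 0)] [enc x] (EFst (EVar 0)) (enc (fst x)) t \<and> t \<le> 2"
    using eval.Fst[OF eval_Var0(1)[of "[EFst (EVar 0)]" "enc x" "[]"]] by (cases x) auto
  show "esize (fst x) \<le> esize x + 2" by (cases x) auto
qed

lemma polytime_snd [polytime_intros]:
  assumes "polytime f" shows "polytime (\<lambda>x. snd (f x))"
proof (rule polytime_comp[OF _ assms], rule polytime_prim)
  fix x :: "'b \<times> 'c"
  show "\<exists>t. eval [ESnd (EVar 0)] [enc x] (ESnd (EVar 0)) (enc (snd x)) t \<and> t \<le> 2"
    using eval.Snd[OF eval_Var0(1)[of "[ESnd (EVar 0)]" "enc x" "[]"]] by (cases x) auto
  show "esize (snd x) \<le> esize x + 2" by (cases x) auto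
qed

lemma polytime_Nil [polytime_intros]: "polytime (\<lambda>x. [])"
  by (rule polytime_prim[where e = ENil and k = 1]) (auto intro!: exI[of _ 1] eval.Nil)

lemma polytime_False [polytime_intros]: "polytime (\<lambda>x. False)"
  by (rule polytime_prim[where e = ENil and k = 1]) (auto intro!: exI[of _ 1] eval.Nil)

lemma polytime_True [polytime_intros]: "polytime (\<lambda>x. True)"
  by (rule polytime_prim[where e = "EPair ENil ENil" and k = 3])
    (auto intro!: exI[of _ "1 + 1 + 1"] eval.Pair eval.Nil)

lemma eval_zero: "eval P env (ESub EOne EOne) (VNum 0) 3"
  using eval.Sub[OF eval.One eval.One, of P env] by (simp add: numeral_eq_Suc)

lemma polytime_zero_nat [polytime_intros]: "polytime (\<lambda>x. 0::nat)"
  using eval_zero by (intro polytime_prim[where e = "ESub EOne EOne" and k = 3]) auto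

lemma polytime_zero_real [polytime_intros]: "polytime (\<lambda>x. 0::real)"
  using eval_zero by (intro polytime_prim[where e = "ESub EOne EOne" and k = 3]) auto

lemma polytime_one_nat [polytime_intros]: "polytime (\<lambda>x. 1::nat)"
  using eval.One by (intro polytime_prim[where e = EOne and k = 1]) auto

lemma eval_args:
  "eval P [VPair x y] (EFst (EVar 0)) x 2" "eval P [VPair x y] (ESnd (EVar 0)) y 2"
  using eval.Fst[OF eval_Var0(1)[of P "VPair x y" "[]"]] eval.Snd[OF eval_Var0(1)[of P "VPair x y" "[]"]]
  by (simp_all add: numeral_eq_Suc)

lemma polytime_op2:
  assumes "\<And>P x y. eval P [VPair (enc x) (enc y)] e (enc (h x y)) k"
    and "\<And>x y. esize (h x y) \<le> esize x + esize y + k"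
    and "polytime f" "polytime g"
  shows "polytime (\<lambda>x. h (f x) (g x))"
proof -
  have "polytime (\<lambda>z. h (fst z) (snd z))"
  proof (rule polytime_prim[where e = e and k = k])
    fix z :: "'a \<times> 'b"
    show "\<exists>t. eval [e] [enc z] e (enc (h (fst z) (snd z))) t \<and> t \<le> k"
      using assms(1) by (cases z) auto
    show "esize (h (fst z) (snd z)) \<le> esize z + k"
      using assms(2)[of "fst z" "snd z"] by (cases z) auto
  qed
  from polytime_comp[OF this polytime_Pair[OF assms(3,4)]] show ?thesis by simp
qed

lemma eval_add: "eval P [VPair (VNum a) (VNum b)] (EAdd (EFst (EVar 0)) (ESnd (EVar 0))) (VNum (a + b)) 5"
  using eval.Add[OF eval_args(1)[of P "VNum a" "VNum b"] eval_args(2)[of P "VNum a" "VNum b"]] by simp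

lemma eval_sub: "eval P [VPair (VNum a) (VNum b)] (ESub (EFst (EVar 0)) (ESnd (EVar 0))) (VNum (a - b)) 5"
  using eval.Sub[OF eval_args(1)[of P "VNum a" "VNum b"] eval_args(2)[of P "VNum a" "VNum b"]] by simp

lemma polytime_add_real [polytime_intros]:
  "polytime f \<Longrightarrow> polytime g \<Longrightarrow> polytime (\<lambda>x. f x + g x :: real)"
  by (rule polytime_op2[where e = "EAdd (EFst (EVar 0)) (ESnd (EVar 0))" and k = 5])
    (simp_all add: eval_add)

lemma polytime_add_nat [polytime_intros]:
  "polytime f \<Longrightarrow> polytime g \<Longrightarrow> polytime (\<lambda>x. f x + g x :: nat)"
  by (rule polytime_op2[where e = "EAdd (EFst (EVar 0)) (ESnd (EVar 0))" and k = 5])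
    (simp_all add: eval_add)

lemma polytime_diff_real [polytime_intros]:
  "polytime f \<Longrightarrow> polytime g \<Longrightarrow> polytime (\<lambda>x. f x - g x :: real)"
  by (rule polytime_op2[where e = "ESub (EFst (EVar 0)) (ESnd (EVar 0))" and k = 5])
    (simp_all add: eval_sub)

lemma polytime_less_real [polytime_intros]:
  assumes "polytime f" "polytime g" shows "polytime (\<lambda>x. f x < (g x :: real))"
proof -
  have "polytime (\<lambda>z. fst z < (snd z :: real))"
  proof (rule polytime_prim)
    fix z :: "real \<times> real"
    let ?e = "EIfLess (EFst (EVar 0)) (ESnd (EVar 0)) (EPair ENil ENil) ENil"
    obtain a b where z: "z = (a, b)" by (cases z)
    have "eval [?e] [enc z] (if a < b then EPair ENil ENil else ENil) (enc (a < b)) (if a < b then 3 else 1)"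
      by (auto intro!: eval_time[OF eval.Pair[OF eval.Nil eval.Nil]] eval.Nil[THEN eval_time])
    then have "eval [?e] [enc z] ?e (enc (a < b)) (2 + 2 + (if a < b then 3 else 1) + 1)"
      unfolding z enc_Pair enc_num by (intro eval.IfLess[OF eval_args]) simp
    then show "\<exists>t. eval [?e] [enc z] ?e (enc (fst z < snd z)) t \<and> t \<le> 8"
      unfolding z by (intro exI conjI) auto
    show "esize (fst z < snd z) \<le> esize z + 8" using esize_bool[of "fst z < snd z"] by linarith
  qed
  from polytime_comp[OF this polytime_Pair[OF assms]] show ?thesis by simp
qed

lemma polytime_real_of_nat [polytime_intros]: "polytime f \<Longrightarrow> polytime (\<lambda>x. real (f x))"
  by (rule polytime_comp[of real], rule polytime_prim[where e = "EVar 0" and k = 1])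
    (auto intro!: exI[of _ 1])

lemma polytime_less_nat [polytime_intros]:
  "polytime f \<Longrightarrow> polytime g \<Longrightarrow> polytime (\<lambda>x. f x < (g x :: nat))"
  using polytime_less_real[OF polytime_real_of_nat polytime_real_of_nat] by (simp add: of_nat_less_iff)

lemma polytime_Cons [polytime_intros]:
  assumes "polytime f" "polytime g" shows "polytime (\<lambda>x. f x # g x)"
proof -
  have "polytime (\<lambda>z::'b \<times> 'b list. fst z # snd z)"
    by (rule polytime_prim[where e = "EVar 0" and k = 1]) (auto intro!: exI[of _ 1])
  from polytime_comp[OF this polytime_Pair[OF assms]] show ?thesis by simp
qed

lemma polytime_not [polytime_intros]:
  assumes "polytime f" shows "polytime (\<lambda>x. \<not> f x)"
  using polytime_if[OF assms polytime_False polytime_True]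
  by (rule back_subst[of polytime]) auto

lemma polytime_conj [polytime_intros]:
  assumes "polytime f" "polytime g" shows "polytime (\<lambda>x. f x \<and> g x)"
  using polytime_if[OF assms polytime_False]
  by (rule back_subst[of polytime]) auto

lemma polytime_disj [polytime_intros]:
  assumes "polytime f" "polytime g" shows "polytime (\<lambda>x. f x \<or> g x)"
  using polytime_if[OF assms(1) polytime_True assms(2)]
  by (rule back_subst[of polytime]) auto

lemma polytime_le_real [polytime_intros]:
  "polytime f \<Longrightarrow> polytime g \<Longrightarrow> polytime (\<lambda>x. f x \<le> (g x :: real))"
  using polytime_not[OF polytime_less_real, of g f] by (simp add: not_less)

lemma polytime_le_nat [polytime_intros]:
  "polytime f \<Longrightarrow> polytime g \<Longrightarrow> polytime (\<lambda>x. f x \<le> (g x :: nat))"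
  using polytime_not[OF polytime_less_nat, of g f] by (simp add: not_less)

lemma polytime_eq_real [polytime_intros]:
  "polytime f \<Longrightarrow> polytime g \<Longrightarrow> polytime (\<lambda>x. f x = (g x :: real))"
  unfolding order_eq_iff by (intro polytime_intros)

lemma polytime_eq_nat [polytime_intros]:
  "polytime f \<Longrightarrow> polytime g \<Longrightarrow> polytime (\<lambda>x. f x = (g x :: nat))"
  unfolding order_eq_iff by (intro polytime_intros)

section \<open>Iteration over lists\<close>

lemma foldl_size:
  assumes "\<And>a y. y \<in> set ys \<Longrightarrow> esize (g a y) \<le> esize a + G"
  shows "esize (foldl g a ys) \<le> esize a + length ys * G"
  using assms
proof (induction ys arbitrary: a)
  case (Cons y ys)
  have "esize (foldl g (g a y) ys) \<le> esize (g a y) + length ys * G"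
    using Cons by simp
  moreover have "esize (g a y) \<le> esize a + G" using Cons.prems by simp
  ultimately show ?case by simp
qed simp

text \<open>The size hypothesis allows the accumulator to grow additively only, which excludes repeated
  doubling.\<close>

lemma polytime_foldl:
  assumes g: "polytime (\<lambda>z. g (fst z) (fst (snd z)) (snd (snd z)))"
    and b: "\<And>x a y. esize (g x a y) \<le> esize a + poly b (esize x + esize y)"
    and a: "polytime a" and l: "polytime l"
  shows "polytime (\<lambda>x. foldl (g x) (a x) (l x))"
proof -
  let ?g = "\<lambda>z. g (fst z) (fst (snd z)) (snd (snd z))"
  obtain Q i p where c: "\<And>e. computes (e # Q) i ?g p"
    by (rule link3[OF g g g]) (rule that)
  \<comment> \<open>Function 0 is the loop. Its argument is the triple of parameter, accumulator and
    remaining list; under the \<open>ELet\<close>, variable 0 is the list and variable 1 the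
    triple.\<close>
  let ?body = "EPair (EFst (EVar 1)) (EPair (ECall i (EPair (EFst (EVar 1))
      (EPair (EFst (ESnd (EVar 1))) (EFst (EVar 0))))) (ESnd (EVar 0)))"
  let ?e1 = "EIfPair (EVar 0) (ECall 0 ?body) (EFst (ESnd (EVar 1)))"
  let ?e = "ELet (ESnd (ESnd (EVar 0))) ?e1"
  let ?P = "?e # Q"
  \<comment> \<open>\<open>A\<close> bounds the accumulator in all later iterations, since each
    remaining element accounts for a growth of at most \<open>G\<close>, and \<open>S\<close> bounds
    the elements. Hence every iteration has the same time bound.\<close>
  have step: "\<exists>t. eval ?P [enc (x, a, ys)] ?e (enc (foldl (g x) a ys)) t \<and>
      t \<le> (length ys + 1) * (30 + poly p (esize x + A + S + 2))"
    if "esize a + length ys * G \<le> A" "\<And>y. y \<in> set ys \<Longrightarrow> poly b (esize x + esize y) \<le> G"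
       "\<And>y. y \<in> set ys \<Longrightarrow> esize y \<le> S" for x ys a A S G
    using that
  proof (induction ys arbitrary: a)
    case Nil
    let ?z = "enc (x, a, [] :: 'c list)"
    have 1: "eval ?P [?z] (ESnd (ESnd (EVar 0))) VNil 3"
      using eval.Snd[OF eval.Snd[OF eval_Var0(1)[of ?P ?z "[]"]]] by (simp add: numeral_eq_Suc)
    have 2: "eval ?P [VNil, ?z] (EFst (ESnd (EVar 1))) (enc a) 3"
      using eval.Fst[OF eval.Snd[OF eval_Var1(1)[of ?P VNil ?z "[]"]]] by (simp add: numeral_eq_Suc)
    have "eval ?P [VNil, ?z] ?e1 (enc a) (1 + 3 + 1)"
      using 2 by (intro eval.IfPair[OF eval_Var0(1)]) auto
    from eval.Let[OF 1 this] show ?case by (auto intro!: exI)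
  next
    case (Cons y ys)
    let ?z = "enc (x, a, y # ys)" and ?l = "enc (y # ys)"
    have ga: "esize (g x a y) \<le> esize a + G"
      using b[of x a y] Cons.prems(2)[of y] by simp
    have 1: "eval ?P [?z] (ESnd (ESnd (EVar 0))) ?l 3"
      using eval.Snd[OF eval.Snd[OF eval_Var0(1)[of ?P ?z "[]"]]] by (simp add: numeral_eq_Suc)
    have x: "eval ?P [?l, ?z] (EFst (EVar 1)) (enc x) 2"
      using eval.Fst[OF eval_Var1(1)[of ?P ?l ?z "[]"]] by (simp add: numeral_eq_Suc)
    have a: "eval ?P [?l, ?z] (EFst (ESnd (EVar 1))) (enc a) 3"
      using eval.Fst[OF eval.Snd[OF eval_Var1(1)[of ?P ?l ?z "[]"]]] by (simp add: numeral_eq_Suc)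
    have y: "eval ?P [?l, ?z] (EFst (EVar 0)) (enc y) 2"
      using eval.Fst[OF eval_Var0(1)[of ?P ?l "[?z]"]] by (simp add: numeral_eq_Suc)
    have ys: "eval ?P [?l, ?z] (ESnd (EVar 0)) (enc ys) 2"
      using eval.Snd[OF eval_Var0(1)[of ?P ?l "[?z]"]] by (simp add: numeral_eq_Suc)
    have "eval ?P [?l, ?z] (EPair (EFst (EVar 1)) (EPair (EFst (ESnd (EVar 1))) (EFst (EVar 0))))
        (enc (x, a, y)) 9"
      using eval.Pair[OF x eval.Pair[OF a y]] by (simp add: numeral_eq_Suc)
    from computes_call[OF c this] obtain t1 where
      t1: "eval ?P [?l, ?z] (ECall i (EPair (EFst (EVar 1)) (EPair (EFst (ESnd (EVar 1))) (EFst (EVar 0)))))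
        (enc (g x a y)) t1" "t1 \<le> 9 + poly p (esize (x, a, y)) + 1"
      by auto
    have "esize y \<le> S" using Cons.prems by simp
    moreover have "esize a \<le> A" using Cons.prems(1) by simp
    ultimately have "poly p (esize (x, a, y)) \<le> poly p (esize x + A + S + 2)"
      by (intro poly_nat_mono) simp
    with t1(2) have t1': "t1 \<le> 10 + poly p (esize x + A + S + 2)" by simp
    have body: "eval ?P [?l, ?z] ?body (enc (x, g x a y, ys)) (2 + (t1 + 2 + 1) + 1)"
      using eval.Pair[OF x eval.Pair[OF t1(1) ys]] by simp
    have "esize (g x a y) + length ys * G \<le> A"
      using ga Cons.prems(1) by simp
    then obtain t where t: "eval ?P [enc (x, g x a y, ys)] ?e (enc (foldl (g x) (g x a y) ys)) t"
      "t \<le> (length ys + 1) * (30 + poly p (esize x + A + S + 2))"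
      using Cons.IH[of "g x a y"] Cons.prems by auto
    have "eval ?P [?l, ?z] (ECall 0 ?body) (enc (foldl (g x) (g x a y) ys)) (2 + (t1 + 2 + 1) + 1 + t + 1)"
      using eval.Call[OF body, of 0] t(1) by simp
    then have "eval ?P [?l, ?z] ?e1 (enc (foldl (g x) a (y # ys))) (1 + (2 + (t1 + 2 + 1) + 1 + t + 1) + 1)"
      by (intro eval.IfPair[OF eval_Var0(1)]) auto
    from eval.Let[OF 1 this] show ?case using t1' t(2) by (intro exI conjI) (assumption, simp)
  qed
  have "polytime (\<lambda>z. foldl (g (fst z)) (fst (snd z)) (snd (snd z)))"
  proof (rule polytimeI)
    fix z :: "'a \<times> 'b \<times> 'c list"
    obtain x a ys where z: "z = (x, a, ys)" by (cases z) auto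
    let ?n = "esize z"
    let ?A = "?n + ?n * poly b ?n"
    have G: "poly b (esize x + esize y) \<le> poly b ?n" if "y \<in> set ys" for y
      using esize_elem[OF that] z by (intro poly_nat_mono) simp
    have S: "esize y \<le> ?n" if "y \<in> set ys" for y
      using esize_elem[OF that] z by simp
    have "length ys \<le> ?n" using length_esize[of ys] z by simp
    then have A: "esize a + length ys * poly b ?n \<le> ?A"
      using z by (intro add_mono mult_mono) auto
    have "esize (foldl (g x) a ys) \<le> esize a + length ys * poly b ?n"
      using b G by (intro foldl_size) (meson add_le_mono le_refl order_trans)
    then show "esize (foldl (g (fst z)) (fst (snd z)) (snd (snd z))) \<le> poly ([:0, 1:] + [:0, 1:] * b) (esize z)"
      using A z by simp
    let ?q = "[:1, 1:] * (30 + pcompose p ([:0, 1:] + ([:0, 1:] + [:0, 1:] * b) + [:0, 1:] + [:2:]))"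
    obtain t where t: "eval ?P [enc (x, a, ys)] ?e (enc (foldl (g x) a ys)) t"
      "t \<le> (length ys + 1) * (30 + poly p (esize x + ?A + ?n + 2))"
      using step[OF A G S] by auto
    note t(2)
    also have "(length ys + 1) * (30 + poly p (esize x + ?A + ?n + 2)) \<le>
        (?n + 1) * (30 + poly p (?n + ?A + ?n + 2))"
      using \<open>length ys \<le> ?n\<close> z by (intro mult_mono add_mono poly_nat_mono) auto
    finally have "t \<le> poly ?q ?n"
      by (simp add: poly_pcompose algebra_simps)
    with t(1) show "\<exists>t. eval ?P [enc z] ?e (enc (foldl (g (fst z)) (fst (snd z)) (snd (snd z)))) t \<and>
        t \<le> poly ?q (esize z)"
      using z by auto
  qed
  from polytime_comp[OF this polytime_Pair[OF polytime_id polytime_Pair[OF a l]]] show ?thesis by simp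
qed

lemma polytime2:
  "polytime (\<lambda>z. f (fst z) (snd z)) \<Longrightarrow> polytime a \<Longrightarrow> polytime b \<Longrightarrow> polytime (\<lambda>x. f (a x) (b x))"
  using polytime_comp[of "\<lambda>z. f (fst z) (snd z)" "\<lambda>x. (a x, b x)"] polytime_Pair by fastforce

lemma polytime3:
  assumes "polytime (\<lambda>z. f (fst z) (fst (snd z)) (snd (snd z)))" "polytime a" "polytime b" "polytime c"
  shows "polytime (\<lambda>x. f (a x) (b x) (c x))"
  using polytime_comp[OF assms(1) polytime_Pair[OF assms(2) polytime_Pair[OF assms(3,4)]]] by simp

lemma polytime4:
  assumes "polytime (\<lambda>z. f (fst z) (fst (snd z)) (fst (snd (snd z))) (snd (snd (snd z))))"
    "polytime a" "polytime b" "polytime c" "polytime d"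
  shows "polytime (\<lambda>x. f (a x) (b x) (c x) (d x))"
  using polytime_comp[OF assms(1) polytime_Pair[OF assms(2) polytime_Pair[OF assms(3) polytime_Pair[OF assms(4,5)]]]]
  by simp

section \<open>List functions\<close>

lemma polytime_rev [polytime_intros]:
  assumes "polytime l" shows "polytime (\<lambda>x. rev (l x))"
proof -
  have "polytime (\<lambda>x. foldl (\<lambda>a y. y # a) [] (l x))"
    by (rule polytime_foldl[where b = "[:1, 1:]"]) (intro polytime_intros assms | simp)+
  moreover have "foldl (\<lambda>a y. y # a) a ys = rev ys @ a" for a ys :: "'b list"
    by (induction ys arbitrary: a) auto
  ultimately show ?thesis by simp
qed

lemma polytime_append [polytime_intros]:
  assumes "polytime l" "polytime l'" shows "polytime (\<lambda>x. l x @ l' x)"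
proof -
  have "polytime (\<lambda>x. foldl (\<lambda>a y. y # a) (l' x) (rev (l x)))"
    by (rule polytime_foldl[where b = "[:1, 1:]"]) (intro polytime_intros assms | simp)+
  moreover have "foldl (\<lambda>a y. y # a) a ys = rev ys @ a" for a ys :: "'b list"
    by (induction ys arbitrary: a) auto
  ultimately show ?thesis by simp
qed

lemma esize_append: "esize (xs @ ys) + 1 = esize xs + esize ys"
  by (induction xs) auto

lemma polytime_concat [polytime_intros]:
  assumes "polytime l" shows "polytime (\<lambda>x. concat (l x))"
proof -
  have "polytime (\<lambda>x. foldl (\<lambda>a y. a @ y) [] (l x))"
  proof (rule polytime_foldl[where b = "[:0, 1:]"])
    show "esize (a @ y) \<le> esize a + poly [:0, 1:] (esize x + esize y)" for x :: 'a and a y :: "'b list"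
      using esize_append[of a y] by simp
  qed (intro polytime_intros assms)+
  moreover have "foldl (\<lambda>a y. a @ y) a ys = a @ concat ys" for a :: "'b list" and ys
    by (induction ys arbitrary: a) auto
  ultimately show ?thesis by simp
qed

lemma polytime_map [polytime_intros]:
  assumes f: "polytime (\<lambda>z. f (fst z) (snd z))" and l: "polytime l"
  shows "polytime (\<lambda>x. map (f x) (l x))"
proof -
  obtain p where p: "\<And>z. esize (f (fst z) (snd z)) \<le> poly p (esize z)"
    using polytime_size[OF f] by blast
  have "polytime (\<lambda>x. foldl (\<lambda>a y. f x y # a) [] (l x))"
  proof (rule polytime_foldl[where b = "1 + pcompose p [:1, 1:]"])
    show "esize (f x y # a) \<le> esize a + poly (1 + pcompose p [:1, 1:]) (esize x + esize y)" for x y a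
      using p[of "(x, y)"] by (simp add: poly_pcompose algebra_simps)
  qed (intro polytime_intros polytime2[OF f] l)+
  then have "polytime (\<lambda>x. rev (foldl (\<lambda>a y. f x y # a) [] (l x)))"
    by (rule polytime_rev)
  moreover have "foldl (\<lambda>a y. f x y # a) a ys = rev (map (f x) ys) @ a" for a ys x
    by (induction ys arbitrary: a) auto
  ultimately show ?thesis by simp
qed

lemma polytime_filter [polytime_intros]:
  assumes f: "polytime (\<lambda>z. f (fst z) (snd z))" and l: "polytime l"
  shows "polytime (\<lambda>x. filter (f x) (l x))"
proof -
  have "polytime (\<lambda>x. foldl (\<lambda>a y. if f x y then y # a else a) [] (l x))"
    by (rule polytime_foldl[where b = "[:1, 1:]"]) (intro polytime_intros polytime2[OF f] l | simp)+
  then have "polytime (\<lambda>x. rev (foldl (\<lambda>a y. if f x y then y # a else a) [] (l x)))"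
    by (rule polytime_rev)
  moreover have "foldl (\<lambda>a y. if f x y then y # a else a) a ys = rev (filter (f x) ys) @ a" for a ys x
    by (induction ys arbitrary: a) auto
  ultimately show ?thesis by simp
qed

lemma polytime_Ball [polytime_intros]:
  assumes f: "polytime (\<lambda>z. f (fst z) (snd z))" and l: "polytime l"
  shows "polytime (\<lambda>x. \<forall>y\<in>set (l x). f x y)"
proof -
  have "polytime (\<lambda>x. foldl (\<lambda>a y. a \<and> f x y) True (l x))"
  proof (rule polytime_foldl[where b = "[:3:]"])
    show "esize (a \<and> f x y) \<le> esize a + poly [:3:] (esize x + esize y)" for x y a
      using esize_bool[of "a \<and> f x y"] by simp
  qed (intro polytime_intros polytime2[OF f] l)+
  moreover have "foldl (\<lambda>a y. a \<and> f x y) a ys = (a \<and> (\<forall>y\<in>set ys. f x y))" for a ys x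
    by (induction ys arbitrary: a) auto
  ultimately show ?thesis by simp
qed

lemma polytime_Bex [polytime_intros]:
  assumes f: "polytime (\<lambda>z. f (fst z) (snd z))" and l: "polytime l"
  shows "polytime (\<lambda>x. \<exists>y\<in>set (l x). f x y)"
proof -
  have "polytime (\<lambda>x. \<not> (\<forall>y\<in>set (l x). \<not> f x y))"
    by (intro polytime_intros f l)
  then show ?thesis by simp
qed

lemma polytime_length [polytime_intros]:
  assumes l: "polytime l" shows "polytime (\<lambda>x. length (l x))"
proof -
  have "polytime (\<lambda>x. foldl (\<lambda>a y. a + 1) (0::nat) (l x))"
    by (rule polytime_foldl[where b = "[:1:]"]) (intro polytime_intros l | simp)+
  moreover have "foldl (\<lambda>a y. a + 1) a ys = a + length ys" for a :: nat and ys :: "'b list"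
    by (induction ys arbitrary: a) auto
  ultimately show ?thesis by simp
qed

lemma polytime_const_nat: "polytime (\<lambda>x. c :: nat)"
proof (induction c)
  case (Suc c)
  from polytime_add_nat[OF this polytime_one_nat] show ?case by simp
qed (rule polytime_zero_nat)

text \<open>There is no multiplication in the model. The factor is fixed together with the program,
  so it is unrolled into \<open>c\<close> additions.\<close>

lemma polytime_const_mult: "polytime f \<Longrightarrow> polytime (\<lambda>x. real c * f x)"
proof (induction c)
  case (Suc c)
  from polytime_add_real[OF Suc.IH[OF Suc.prems] Suc.prems] show ?case by (simp add: algebra_simps)
qed (simp add: polytime_zero_real)

lemma polytime_enumerate [polytime_intros]:
  assumes l: "polytime l" shows "polytime (\<lambda>x. List.enumerate 0 (l x))"
proof -
  have "polytime (\<lambda>x. foldl (\<lambda>a y. (length a, y) # a) [] (l x))"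
    by (rule polytime_foldl[where b = "[:3, 1:]"]) (intro polytime_intros l | simp)+
  then have "polytime (\<lambda>x. rev (foldl (\<lambda>a y. (length a, y) # a) [] (l x)))"
    by (rule polytime_rev)
  moreover have "foldl (\<lambda>a y. (length a, y) # a) a ys = rev (List.enumerate (length a) ys) @ a" for a and ys :: "'b list"
    by (induction ys arbitrary: a) auto
  ultimately show ?thesis by simp
qed

text \<open>The range is given by the length of a list because a number has size one: listing all
  numbers below a numerical argument would not be polynomial in the input size.\<close>

lemma polytime_upt [polytime_intros]:
  assumes l: "polytime l" shows "polytime (\<lambda>x. [0..<length (l x)])"
proof -
  have "polytime (\<lambda>x. map fst (List.enumerate 0 (l x)))"
    by (intro polytime_intros l)
  then show ?thesis by (simp add: List.enumerate_eq_zip)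
qed

lemma polytime_eq_prod [polytime_intros]:
  assumes "polytime (\<lambda>x. fst (f x) = fst (g x))" "polytime (\<lambda>x. snd (f x) = snd (g x))"
  shows "polytime (\<lambda>x. f x = g x)"
  unfolding prod_eq_iff by (intro polytime_intros assms)

lemma polytime_is_Nil [polytime_intros]:
  assumes "polytime l" shows "polytime (\<lambda>x. l x = [])"
proof -
  have "polytime (\<lambda>x. case l x of [] \<Rightarrow> True | _ # _ \<Rightarrow> False)"
    by (intro polytime_intros assms)
  moreover have "(case xs of [] \<Rightarrow> True | _ # _ \<Rightarrow> False) = (xs = [])" for xs :: "'b list"
    by (cases xs) auto
  ultimately show ?thesis by simp
qed

section \<open>The dynamic program\<close>

type_synonym item = "nat \<times> real"
type_synonym config = "item list \<times> item list \<times> (nat \<times> nat) list"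
type_synonym table = "config list"
type_synonym link = "(nat \<times> nat) \<times> (nat \<times> nat) \<times> real"
type_synonym params = "nat list \<times> nat list \<times> real \<times> real"

text \<open>A configuration of the users and facilities of a subtree consists of the users that will
  be served outside, the open slots to be filled from outside, and the pairs matched so far; users
  and slots carry their rounded depth. The parameters are a list as long as the number of users, a
  list whose length bounds the table size, the distance bound and the rounding error. The two
  numerical bounds are given in unary because a number has size one, whatever its value. A link
  consists of a node, its parent and its depth.\<close>

definition same_values :: "real list \<Rightarrow> real list \<Rightarrow> bool" where
  "same_values xs ys \<longleftrightarrow>
     (\<forall>y\<in>set (xs @ ys). length (filter (\<lambda>z. z = y) xs) = length (filter (\<lambda>z. z = y) ys))"

definition equivalent :: "config \<Rightarrow> config \<Rightarrow> bool" where
  "equivalent c c' \<longleftrightarrow> same_values (map snd (fst c)) (map snd (fst c')) \<and>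
     same_values (map snd (fst (snd c))) (map snd (fst (snd c')))"

text \<open>Write \<theta> and \<delta> for the last two components of \<open>g\<close>. At a node
  of depth \<open>d\<close>, whatever is left over lies at or below the node, so its rounded depth
  is at least \<open>d - \<delta>\<close>; it can be matched at or above the node only if that depth
  is at most \<open>d + \<theta>\<close>. The length bounds limit the size of a
  configuration.\<close>

definition admissible :: "params \<Rightarrow> real \<Rightarrow> config \<Rightarrow> bool" where
  "admissible g d c \<longleftrightarrow> length (fst c) \<le> length (fst g) \<and> length (fst (snd c)) \<le> length (fst g) \<and>
     length (snd (snd c)) \<le> length (fst g) \<and>
     (\<forall>y\<in>set (fst c @ fst (snd c)).
        d - snd (snd (snd g)) \<le> snd y \<and> snd y \<le> d + fst (snd (snd g)))"

text \<open>The cap on the number of entries keeps the result small for every input, as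
  \<open>polytime\<close> demands. On the tables that arise it never turns away an admissible
  configuration of a new class.\<close>

definition prune :: "params \<Rightarrow> real \<Rightarrow> table \<Rightarrow> table" where
  "prune g d t = foldl (\<lambda>a c. if admissible g d c \<and> \<not> (\<exists>c'\<in>set a. equivalent c c') \<and>
     length a < length (fst (snd g)) then c # a else a) [] t"

definition join :: "table \<Rightarrow> table \<Rightarrow> table" where
  "join t t' = concat (map (\<lambda>c. map (\<lambda>c'. (fst c @ fst c', fst (snd c) @ fst (snd c'),
     snd (snd c) @ snd (snd c'))) t') t)"

definition remove :: "item \<Rightarrow> item list \<Rightarrow> item list" where
  "remove y ys = snd (foldl (\<lambda>a z. if \<not> fst a \<and> z = y then (True, snd a) else (fst a, z # snd a))
     (False, []) ys)"

definition matches :: "real \<Rightarrow> table \<Rightarrow> table" where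
  "matches b t = concat (map (\<lambda>c. concat (map (\<lambda>p. map (\<lambda>s.
     (remove p (fst c), remove s (fst (snd c)), (fst p, fst s) # snd (snd c)))
     (filter (\<lambda>s. snd p + snd s \<le> b) (fst (snd c)))) (fst c))) t)"

text \<open>Each round matches one further pair, and there are as many rounds as users; retaining
  the old entries \<open>a\<close> allows for fewer pairs. Pruning in every round prevents
  exponential growth. Two points meeting at depth \<open>d\<close> have as distance the sum of their
  depths minus \<open>d + d\<close>, hence the bound in the test.\<close>

definition merge :: "params \<Rightarrow> real \<Rightarrow> table \<Rightarrow> table \<Rightarrow> table" where
  "merge g d t t' = foldl (\<lambda>a _. prune g d (a @ matches (fst (snd (snd g)) + (d + d)) a))
     (prune g d (join t t')) (fst g)"

text \<open>The fold starts from the table of the empty configuration, a unit for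
  \<open>join\<close>, so even a single waiting entry is pruned at the depth of the node.\<close>

definition step :: "params \<Rightarrow> ((nat \<times> nat) \<times> table) list \<Rightarrow> link \<Rightarrow>
    ((nat \<times> nat) \<times> table) list" where
  "step g acc n = (fst (snd n), foldl (\<lambda>t e. if fst e = fst n then merge g (snd (snd n)) t (snd e) else t)
     [([], [], [])] acc) # filter (\<lambda>e. fst e \<noteq> fst n) acc"

text \<open>The facility commits to its number \<open>k\<close> of slots in advance. For
  \<open>N = [0..<n]\<close>, \<open>k\<close> runs from 0 to \<open>n\<close>, and filtering
  \<open>N\<close> produces \<open>k\<close> copies without iterating over a number.\<close>

definition facility_table :: "nat \<Rightarrow> nat list \<Rightarrow> item \<Rightarrow> table" where
  "facility_table s N y = map (\<lambda>k. ([], map (\<lambda>_. y) (filter (\<lambda>i. i < k) N), []))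
     (filter (\<lambda>k. k = 0 \<or> s \<le> k) (N @ [length N]))"

section \<open>Running time of the dynamic program\<close>

lemma polytime_same_values [polytime_intros]:
  "polytime a \<Longrightarrow> polytime b \<Longrightarrow> polytime (\<lambda>x. same_values (a x) (b x))"
  by (rule polytime2, unfold same_values_def) (intro polytime_intros)

lemma polytime_equivalent [polytime_intros]:
  "polytime a \<Longrightarrow> polytime b \<Longrightarrow> polytime (\<lambda>x. equivalent (a x) (b x))"
  by (rule polytime2, unfold equivalent_def) (intro polytime_intros)

lemma polytime_admissible [polytime_intros]:
  "polytime a \<Longrightarrow> polytime b \<Longrightarrow> polytime c \<Longrightarrow> polytime (\<lambda>x. admissible (a x) (b x) (c x))"
  by (rule polytime3, unfold admissible_def) (intro polytime_intros)

lemma polytime_prune [polytime_intros]: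
  "polytime a \<Longrightarrow> polytime b \<Longrightarrow> polytime c \<Longrightarrow> polytime (\<lambda>x. prune (a x) (b x) (c x))"
  by (rule polytime3, unfold prune_def, rule polytime_foldl[where b = "[:1, 1:]"])
    (intro polytime_intros | simp)+

lemma polytime_join [polytime_intros]:
  "polytime a \<Longrightarrow> polytime b \<Longrightarrow> polytime (\<lambda>x. join (a x) (b x))"
  by (rule polytime2, unfold join_def) (intro polytime_intros)

lemma polytime_remove [polytime_intros]:
  assumes "polytime a" "polytime b" shows "polytime (\<lambda>x. remove (a x) (b x))"
proof (rule polytime2[OF _ assms], unfold remove_def, rule polytime_snd, rule polytime_foldl[where b = "[:3, 1:]"])
  fix x :: "item \<times> item list" and a :: "bool \<times> item list" and y :: item
  show "esize (if \<not> fst a \<and> y = fst x then (True, snd a) else (fst a, y # snd a))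
     \<le> esize a + poly [:3, 1:] (esize x + esize y)"
    by (cases a) auto
qed (intro polytime_intros)+

lemma polytime_matches [polytime_intros]:
  "polytime a \<Longrightarrow> polytime b \<Longrightarrow> polytime (\<lambda>x. matches (a x) (b x))"
  by (rule polytime2, unfold matches_def) (intro polytime_intros)

lemma esize_list_le:
  assumes "\<And>x. x \<in> set xs \<Longrightarrow> esize x \<le> k"
  shows "esize xs \<le> 1 + length xs * (1 + k)"
  using assms
proof (induction xs)
  case (Cons x xs)
  have "esize x \<le> k" "esize xs \<le> 1 + length xs * (1 + k)" using Cons by simp_all
  then show ?case by simp
qed simp

lemma prune_invariant:
  "set (prune g d t) \<subseteq> {c \<in> set t. admissible g d c} \<and> length (prune g d t) \<le> length (fst (snd g))"
proof -
  let ?f = "\<lambda>a c. if admissible g d c \<and> \<not> (\<exists>c'\<in>set a. equivalent c c') \<and>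
     length a < length (fst (snd g)) then c # a else a"
  have "set (foldl ?f a t) \<subseteq> set a \<union> {c \<in> set t. admissible g d c} \<and> length (foldl ?f a t) \<le> length (fst (snd g))"
    if "length a \<le> length (fst (snd g))" for a
    using that
  proof (induction t arbitrary: a)
    case (Cons c t)
    have "length (?f a c) \<le> length (fst (snd g))" using Cons.prems by auto
    note IH = Cons.IH[OF this]
    have "set (?f a c) \<subseteq> set a \<union> {c' \<in> {c}. admissible g d c'}" by auto
    moreover have "foldl ?f a (c # t) = foldl ?f (?f a c) t" by simp
    ultimately show ?case using IH by (intro conjI) (force, simp)
  qed simp
  from this[of "[]"] show ?thesis unfolding prune_def by simp
qed

text \<open>The bound depends on \<open>g\<close> alone, not on the table, which stops sizes from
  accumulating over successive merges. There are at most \<open>length B\<close> entries, each made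
  of three lists of length at most \<open>length N\<close>, and items and pairs have encoded size
  3.\<close>

lemma esize_prune: "\<exists>p. \<forall>g d t. esize (prune g d t) \<le> poly p (esize (g::params))"
proof (intro exI allI)
  fix g :: params and d and t :: table
  let ?n = "esize g"
  obtain N B r where g: "g = (N, B, r)" by (cases g) auto
  have N: "length N \<le> ?n" "length B \<le> ?n" using length_esize[of N] length_esize[of B] g by simp_all
  have item: "esize xs \<le> 1 + length xs * 4" for xs :: "item list"
    using esize_list_le[of xs 3] by fastforce
  have pair: "esize xs \<le> 1 + length xs * 4" for xs :: "(nat \<times> nat) list"
    using esize_list_le[of xs 3] by fastforce
  have "esize c \<le> 12 * ?n + 5" if "c \<in> set (prune g d t)" for c
  proof -
    obtain P S m where c: "c = (P, S, m)" by (cases c) auto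
    have "admissible g d c" using that prune_invariant[of g d t] by auto
    then have "length P \<le> ?n" "length S \<le> ?n" "length m \<le> ?n"
      using N unfolding admissible_def c g by auto
    with item[of P] item[of S] pair[of m] c show ?thesis by simp
  qed
  then have "esize (prune g d t) \<le> 1 + length (prune g d t) * (1 + (12 * ?n + 5))"
    by (rule esize_list_le)
  also have "\<dots> \<le> 1 + ?n * (1 + (12 * ?n + 5))"
    using prune_invariant[of g d t] N g by (intro add_mono mult_mono) auto
  finally show "esize (prune g d t) \<le> poly [:1, 6, 12:] ?n"
    by (simp add: algebra_simps)
qed

lemma esize_merge: "\<exists>p. \<forall>g d t t'. esize (merge g d t t') \<le> poly p (esize g)"
proof -
  obtain p where p: "\<And>g d t. esize (prune g d t) \<le> poly p (esize g)"
    using esize_prune by blast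
  have "esize (foldl (\<lambda>a _. prune g d (a @ h a)) (prune g d t) ys) \<le> poly p (esize g)" for g :: params and d h and t :: table and ys :: "nat list"
    by (induction ys arbitrary: t) (auto simp: p)
  then show ?thesis unfolding merge_def by blast
qed

lemma polytime_merge [polytime_intros]:
  assumes "polytime a" "polytime b" "polytime c" "polytime c'"
  shows "polytime (\<lambda>x. merge (a x) (b x) (c x) (c' x))"
proof -
  obtain p where p: "\<And>g d t. esize (prune g d t) \<le> poly p (esize g)"
    using esize_prune by blast
  show ?thesis
  proof (rule polytime4[OF _ assms], unfold merge_def, rule polytime_foldl[where b = p])
    fix x :: "params \<times> real \<times> table \<times> table" and a :: table and y :: nat
    have "poly p (esize (fst x)) \<le> poly p (esize x + esize y)"
      by (cases x, intro poly_nat_mono) simp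
    then show "esize (prune (fst x) (fst (snd x)) (a @ matches (fst (snd (snd (fst x))) +
        (fst (snd x) + fst (snd x))) a)) \<le> esize a + poly p (esize x + esize y)"
      using p trans_le_add2 order_trans by blast
  qed (intro polytime_intros)+
qed

lemma polytime_step [polytime_intros]:
  assumes "polytime a" "polytime b" "polytime c"
  shows "polytime (\<lambda>x. step (a x) (b x) (c x))"
proof -
  obtain p where p: "\<And>g d t t'. esize (merge g d t t') \<le> poly p (esize g)"
    using esize_merge by blast
  let ?h = "\<lambda>g (n :: link) t (e :: (nat \<times> nat) \<times> table). if fst e = fst n then merge g (snd (snd n)) t (snd e) else t"
  have "polytime (\<lambda>x. foldl (?h (fst x) (snd (snd x))) [([], [], [])] (fst (snd x)))"
  proof (rule polytime_foldl[where b = p])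
    fix x :: "params \<times> ((nat \<times> nat) \<times> table) list \<times> link"
      and a :: table and y :: "(nat \<times> nat) \<times> table"
    have "poly p (esize (fst x)) \<le> poly p (esize x + esize y)"
      by (cases x, intro poly_nat_mono) simp
    then have "esize (merge (fst x) (snd (snd (snd (snd x)))) a (snd y)) \<le> poly p (esize x + esize y)"
      using p order_trans by blast
    then show "esize (?h (fst x) (snd (snd x)) a y) \<le> esize a + poly p (esize x + esize y)"
      by auto
  qed (intro polytime_intros)+
  then show ?thesis
    by (intro polytime3[OF _ assms], unfold step_def) (intro polytime_intros)
qed

lemma esize_filter: "esize (filter P xs) \<le> esize xs"
  by (induction xs) auto

text \<open>A step adds one entry, whose table is bounded in terms of the parameters alone, and
  otherwise only deletes, so the accumulator grows additively.\<close>

lemma polytime_foldl_step: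
  assumes "polytime a" "polytime b" "polytime c"
  shows "polytime (\<lambda>x. foldl (step (a x)) (b x) (c x))"
proof -
  obtain p where p: "\<And>g d t t'. esize (merge g d t t') \<le> poly p (esize g)"
    using esize_merge by blast
  let ?q = "p + [:20, 1:]"
  show ?thesis
  proof (rule polytime3[OF _ assms], rule polytime_foldl[where b = ?q])
    fix x :: "params \<times> ((nat \<times> nat) \<times> table) list \<times> link list"
      and a :: "((nat \<times> nat) \<times> table) list" and y :: "link"
    let ?h = "\<lambda>g (n :: link) t (e :: (nat \<times> nat) \<times> table). if fst e = fst n then merge g (snd (snd n)) t (snd e) else t"
    have "esize t \<le> poly p (esize g) + 10 \<Longrightarrow> esize (foldl (?h g y) t es) \<le> poly p (esize g) + 10" for g t es
      by (induction es arbitrary: t) (auto intro: p trans_le_add1)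
    from this[of "[([], [], [])]" "fst x" a]
    have "esize (foldl (?h (fst x) y) [([], [], [])] a) \<le> poly p (esize (fst x)) + 10" by simp
    moreover have "poly p (esize (fst x)) \<le> poly p (esize x + esize y)"
      by (cases x, intro poly_nat_mono) simp
    moreover have "esize (fst (snd y)) = 3" by (cases y) auto
    ultimately show "esize (step (fst x) a y) \<le> esize a + poly ?q (esize x + esize y)"
      using esize_filter[of "\<lambda>e. fst e \<noteq> fst y" a] unfolding step_def by simp
  qed (intro polytime_intros)+
qed

section \<open>Correctness of the dynamic program\<close>

abbreviation "pending c \<equiv> fst (c :: config)"
abbreviation "slots c \<equiv> fst (snd (c :: config))"
abbreviation "matched c \<equiv> snd (snd (c :: config))"

definition key :: "config \<Rightarrow> real multiset \<times> real multiset" where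
  "key c = (mset (map snd (pending c)), mset (map snd (slots c)))"

lemma same_values_iff: "same_values xs ys \<longleftrightarrow> mset xs = mset ys"
proof -
  have c: "count (mset zs) y = length (filter (\<lambda>z. z = y) zs)" for zs and y :: real
    by (induction zs) auto
  show ?thesis
    unfolding same_values_def multiset_eq_iff c
    by (metis (mono_tags, lifting) Un_iff empty_filter_conv set_append)
qed

lemma equivalent_iff: "equivalent c c' \<longleftrightarrow> key c = key c'"
  unfolding equivalent_def same_values_iff key_def by simp

lemma mset_remove: "mset (remove y ys) = mset ys - {#y#}"
proof -
  let ?f = "\<lambda>a z. if \<not> fst a \<and> z = y then (True, snd a) else (fst a, z # snd a)"
  have 1: "mset (snd (foldl ?f (True, a) ys)) = mset ys + mset a" for a ys
    by (induction ys arbitrary: a) auto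
  have "mset (snd (foldl ?f (False, a) ys)) = mset ys - {#y#} + mset a" for a
  proof (induction ys arbitrary: a)
    case (Cons z ys)
    show ?case
    proof (cases "z = y")
      case True
      then show ?thesis using 1[of a ys] by simp
    next
      case False
      then show ?thesis using Cons[of "z # a"] by simp
    qed
  qed simp
  from this[of "[]"] show ?thesis by (simp add: remove_def)
qed

text \<open>A multiset over \<open>W\<close> is determined by its multiplicities on
  \<open>W\<close>, a function from \<open>W\<close> to \<open>{0..n}\<close>.\<close>

lemma card_bounded_multisets:
  fixes W :: "'b set"
  assumes "finite W"
  shows "finite {X. set_mset X \<subseteq> W \<and> size X \<le> n}"
    and "card {X. set_mset X \<subseteq> W \<and> size X \<le> n} \<le> (n + 1) ^ card W"
proof -
  let ?S = "{X. set_mset X \<subseteq> W \<and> size X \<le> n}"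
  let ?h = "\<lambda>X :: 'b multiset. restrict (count X) W"
  let ?T = "W \<rightarrow>\<^sub>E {0..n}"
  have inj: "inj_on ?h ?S"
  proof (rule inj_onI)
    fix X Y assume X: "X \<in> ?S" and Y: "Y \<in> ?S" and e: "?h X = ?h Y"
    have "count X w = count Y w" for w
    proof (cases "w \<in> W")
      case True
      then show ?thesis using e by (metis restrict_apply')
    next
      case False
      then have "w \<notin># X" "w \<notin># Y" using X Y by auto
      then show ?thesis by (simp add: not_in_iff)
    qed
    then show "X = Y" by (simp add: multiset_eq_iff)
  qed
  have sub: "?h ` ?S \<subseteq> ?T"
  proof (intro image_subsetI PiE_I)
    fix X w assume "X \<in> ?S" "w \<in> W"
    then show "?h X w \<in> {0..n}" using count_le_size[of X w] by simp
  qed auto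
  have fin: "finite ?T" using assms by (intro finite_PiE) auto
  show "finite ?S" using finite_imageD[OF finite_subset[OF sub fin] inj] .
  show "card ?S \<le> (n + 1) ^ card W"
    using card_inj_on_le[OF inj sub fin] assms by (simp add: card_PiE)
qed

text \<open>The key of an admissible configuration is a pair of multisets of size at most
  \<open>n = length (fst g)\<close> over the part of \<open>G\<close> in the window, which has at
  most \<open>K\<close> elements. So there are at most \<open>(n + 1) ^ (2 * K)\<close> keys, and
  the cap is at least that large.\<close>

lemma prune_equivalent:
  assumes c: "c \<in> set t" "admissible g d c"
    and G: "finite G" "\<And>c. c \<in> set t \<Longrightarrow> snd ` set (pending c @ slots c) \<subseteq> G"
    and K: "card {v \<in> G. d - snd (snd (snd g)) \<le> v \<and> v \<le> d + fst (snd (snd g))} \<le> K"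
    and B: "(length (fst g) + 1) ^ (2 * K) \<le> length (fst (snd g))"
  shows "\<exists>c'\<in>set (prune g d t). key c = key c'"
proof -
  let ?n = "length (fst g)" and ?B = "length (fst (snd g))"
  let ?W = "{v \<in> G. d - snd (snd (snd g)) \<le> v \<and> v \<le> d + fst (snd (snd g))}"
  let ?M = "{X. set_mset X \<subseteq> ?W \<and> size X \<le> ?n}"
  have fW: "finite ?W" using G(1) by simp
  have key: "key c \<in> ?M \<times> ?M" if "c \<in> set t" "admissible g d c" for c
    using that(2) G(2)[OF that(1)] unfolding key_def admissible_def by auto
  have bound: "length a \<le> ?B" if "distinct (map key a)" "set a \<subseteq> {c \<in> set t. admissible g d c}" for a
  proof -
    have "length a = card (key ` set a)"
      using that(1) by (metis distinct_card length_map set_map)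
    also have "\<dots> \<le> card (?M \<times> ?M)"
    proof (rule card_mono)
      show "finite (?M \<times> ?M)" by (intro finite_cartesian_product card_bounded_multisets(1) fW)
      show "key ` set a \<subseteq> ?M \<times> ?M" using that(2) key by blast
    qed
    also have "\<dots> \<le> (?n + 1) ^ card ?W * (?n + 1) ^ card ?W"
      unfolding card_cartesian_product by (intro mult_mono card_bounded_multisets(2) fW) auto
    also have "\<dots> = (?n + 1) ^ (2 * card ?W)"
      by (simp add: mult_2 power_add)
    also have "\<dots> \<le> (?n + 1) ^ (2 * K)"
      using K by (intro power_increasing) auto
    finally show ?thesis using B by simp
  qed
  let ?f = "\<lambda>a c. if admissible g d c \<and> \<not> (\<exists>c'\<in>set a. equivalent c c') \<and> length a < ?B then c # a else a"
  have "set a \<subseteq> set (foldl ?f a us) \<and> (\<forall>c\<in>set us. admissible g d c \<longrightarrow> (\<exists>c'\<in>set (foldl ?f a us). key c = key c'))"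
    if "distinct (map key a)" "set a \<subseteq> {c \<in> set t. admissible g d c}" "set us \<subseteq> set t" for a us
    using that
  proof (induction us arbitrary: a)
    case (Cons c us)
    let ?a = "?f a c"
    \<comment> \<open>\<open>c # a\<close> would itself be a list of admissible configurations with
      distinct keys, so the count applies to it and leaves room for \<open>c\<close>.\<close>
    have full: "length a < ?B" if "admissible g d c" "\<not> (\<exists>c'\<in>set a. equivalent c c')"
    proof -
      have "length (c # a) \<le> ?B"
        using Cons.prems that unfolding equivalent_iff by (intro bound) auto
      then show ?thesis by simp
    qed
    have a: "distinct (map key ?a)" "set ?a \<subseteq> {c \<in> set t. admissible g d c}"
      using Cons.prems by (auto simp: equivalent_iff)
    have ca: "admissible g d c \<Longrightarrow> \<exists>c'\<in>set ?a. key c = key c'" and aa: "set a \<subseteq> set ?a"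
      using full by (auto simp: equivalent_iff)
    define b where "b = ?a"
    have "set b \<subseteq> set (foldl ?f b us) \<and> (\<forall>c\<in>set us. admissible g d c \<longrightarrow> (\<exists>c'\<in>set (foldl ?f b us). key c = key c'))"
      using Cons.IH[OF a] Cons.prems(3) unfolding b_def by simp
    moreover have "foldl ?f a (c # us) = foldl ?f b us" unfolding b_def by simp
    moreover have "admissible g d c \<Longrightarrow> \<exists>c'\<in>set b. key c = key c'" "set a \<subseteq> set b"
      using ca aa unfolding b_def by auto
    ultimately show ?case by (simp only: set_simps) blast
  qed simp
  from this[of "[]" t] c show ?thesis unfolding prune_def by auto
qed

text \<open>The ancestors of \<open>p\<close>, including \<open>p\<close>, with their depths. A
  single pass finds them when parents come later in the list than their children.\<close>

fun up :: "('n \<times> 'n \<times> real) list \<Rightarrow> 'n \<Rightarrow> ('n \<times> real) set" where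
  "up [] p = {}"
| "up ((x, q, d) # ns) p = (if p = x then insert (x, d) (up ns q) else up ns p)"

text \<open>Children precede their parents; the parent of the last link, the root, is a dummy.\<close>

fun ordered :: "('n \<times> 'n \<times> real) list \<Rightarrow> bool" where
  "ordered [] = True"
| "ordered ((x, q, d) # ns) \<longleftrightarrow> x \<notin> fst ` set ns \<and> (ns \<noteq> [] \<longrightarrow> q \<in> fst ` set ns) \<and>
     (\<forall>z\<in>up ns q. snd z \<le> d) \<and> ordered ns"

lemma up_names: "z \<in> up ns p \<Longrightarrow> fst z \<in> fst ` set ns"
  by (induction ns p rule: up.induct) (auto split: if_splits)

text \<open>\<open>H\<close> states that an assignment \<open>\<pi>\<close> of small cost is given, \<open>wit i\<close> being a common ancestor of
  user \<open>i\<close> and its facility. Only completeness uses it, so soundness is the instance where \<open>H\<close> is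
  false.\<close>

locale gathering_dp =
  fixes n m r K :: nat
    and N B :: "nat list" and \<theta> \<delta> :: real and G :: "real set"
    and \<rho>u \<rho>f Du Df :: "nat \<Rightarrow> real" and lu lf :: "nat \<Rightarrow> nat \<times> nat"
    and nodes :: "link list"
    and H :: bool and \<pi> :: "nat \<Rightarrow> nat" and wit :: "nat \<Rightarrow> (nat \<times> nat) \<times> real"
  assumes \<delta>: "0 \<le> \<delta>" and N: "N = [0..<n]" and len_B: "(n + 1) ^ (2 * K) \<le> length B"
    and \<rho>u: "i < n \<Longrightarrow> \<rho>u i \<in> G \<and> \<bar>\<rho>u i - Du i\<bar> \<le> \<delta>"
    and \<rho>f: "j < m \<Longrightarrow> \<rho>f j \<in> G \<and> \<bar>\<rho>f j - Df j\<bar> \<le> \<delta>"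
    and G: "finite G" "card {v \<in> G. d - \<delta> \<le> v \<and> v \<le> d + \<theta>} \<le> K"
    and lu: "i < n \<Longrightarrow> lu i \<in> fst ` set nodes" "i < n \<Longrightarrow> z \<in> up nodes (lu i) \<Longrightarrow> snd z \<le> Du i"
    and lf: "j < m \<Longrightarrow> lf j \<in> fst ` set nodes" "j < m \<Longrightarrow> z \<in> up nodes (lf j) \<Longrightarrow> snd z \<le> Df j"
    and nodes: "ordered nodes" "nodes \<noteq> []"
    and \<pi>: "H \<Longrightarrow> i < n \<Longrightarrow> \<pi> i < m"
    and wit: "H \<Longrightarrow> i < n \<Longrightarrow> wit i \<in> up nodes (lu i) \<inter> up nodes (lf (\<pi> i)) \<and>
      Du i + Df (\<pi> i) - 2 * snd (wit i) + 2 * \<delta> \<le> \<theta>"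
    and feas: "H \<Longrightarrow> j < m \<Longrightarrow> card {i. i < n \<and> \<pi> i = j} = 0 \<or> r \<le> card {i. i < n \<and> \<pi> i = j}"
begin

lemma len_N: "length N = n"
  by (simp add: N)

abbreviation g :: params where "g \<equiv> (N, B, \<theta>, \<delta>)"

text \<open>Every common ancestor \<open>z\<close> gives an upper bound for the distance, so
  \<open>z\<close> may be arbitrary. The term \<open>2 * \<delta>\<close> undoes the rounding of
  both depths.\<close>

definition close :: "nat \<Rightarrow> nat \<Rightarrow> bool" where
  "close i j \<longleftrightarrow> (\<exists>z\<in>up nodes (lu i) \<inter> up nodes (lf j). Du i + Df j - 2 * snd z \<le> \<theta> + 2 * \<delta>)"

text \<open>Open and filled slots of a facility are counted together. Matching does not change this
  number, so the lower bound \<open>r\<close>, met by the initial slots, persists and becomes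
  feasibility once no slot is open.\<close>

definition sound_config :: "nat set \<Rightarrow> nat set \<Rightarrow> config \<Rightarrow> bool" where
  "sound_config U F c \<longleftrightarrow>
     mset (map fst (pending c)) + mset (map fst (matched c)) = mset_set U \<and>
     (\<forall>y\<in>set (pending c). snd y = \<rho>u (fst y)) \<and>
     (\<forall>y\<in>set (slots c). snd y = \<rho>f (fst y) \<and> fst y \<in> F) \<and>
     (\<forall>y\<in>set (matched c). snd y \<in> F \<and> close (fst y) (snd y)) \<and>
     (\<forall>j\<in>F. let k = count (mset (map fst (slots c)) + mset (map snd (matched c))) j in k = 0 \<or> r \<le> k)"

definition sound :: "nat set \<Rightarrow> nat set \<Rightarrow> table \<Rightarrow> bool" where
  "sound U F t \<longleftrightarrow> (\<forall>c\<in>set t. sound_config U F c)"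

definition goal_key :: "nat set \<Rightarrow> nat set \<Rightarrow> real multiset \<times> real multiset" where
  "goal_key X Y = (image_mset \<rho>u (mset_set X), image_mset (\<lambda>i. \<rho>f (\<pi> i)) (mset_set Y))"

text \<open>What \<open>\<pi>\<close> leaves over are the users of \<open>U\<close> served outside
  and one slot in \<open>F\<close> for each outside user assigned there. Only rounded depths are
  compared: the configuration found may have matched other users and slots than \<open>\<pi>\<close>
  does.\<close>

definition complete :: "nat set \<Rightarrow> nat set \<Rightarrow> table \<Rightarrow> bool" where
  "complete U F t \<longleftrightarrow> (\<exists>c\<in>set t. key c =
     goal_key {i \<in> U. \<pi> i \<notin> F} {i. i < n \<and> i \<notin> U \<and> \<pi> i \<in> F})"

section \<open>Soundness and completeness of table operations\<close>

lemma sound_config_join: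
  assumes c: "sound_config U F c" and c': "sound_config U' F' c'"
    and disj: "U \<inter> U' = {}" "F \<inter> F' = {}" and fin: "finite U" "finite U'"
  shows "sound_config (U \<union> U') (F \<union> F')
    (pending c @ pending c', slots c @ slots c', matched c @ matched c')"
proof -
  \<comment> \<open>A facility belongs to one side only, so the other side contributes nothing to
    its count.\<close>
  have out: "count (mset (map fst (slots c)) + mset (map snd (matched c))) j = 0"
    if "sound_config U F c" "j \<notin> F" for U F c j
  proof -
    have "j \<notin># mset (map fst (slots c))" "j \<notin># mset (map snd (matched c))"
      using that unfolding sound_config_def by auto
    then show ?thesis by (simp only: not_in_iff count_union)
  qed
  let ?k = "\<lambda>c j. count (mset (map fst (slots c)) + mset (map snd (matched c))) j"
  have "?k c j + ?k c' j = 0 \<or> r \<le> ?k c j + ?k c' j" if "j \<in> F \<union> F'" for j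
  proof (cases "j \<in> F")
    case True
    then have "?k c' j = 0" using out[OF c'] disj by auto
    then show ?thesis using c True unfolding sound_config_def Let_def by auto
  next
    case False
    then have "?k c j = 0" using out[OF c] by auto
    moreover have "j \<in> F'" using False that by simp
    ultimately show ?thesis using c' unfolding sound_config_def Let_def by auto
  qed
  then have k: "\<forall>j\<in>F \<union> F'. let k = count (mset (map fst (slots c @ slots c')) +
      mset (map snd (matched c @ matched c'))) j in k = 0 \<or> r \<le> k"
    by (simp add: Let_def algebra_simps)
  have "mset_set (U \<union> U') = mset_set U + mset_set U'"
    using disj fin by (simp add: mset_set_Union)
  then have "mset (map fst (pending c @ pending c')) + mset (map fst (matched c @ matched c')) = mset_set (U \<union> U')"
    using c c' unfolding sound_config_def by (simp add: ac_simps flip: mset_map)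
  with k c c' show ?thesis unfolding sound_config_def
    by (simp only: fst_conv snd_conv set_append) blast
qed

lemma sound_config_pending:
  assumes "sound_config U F c" "finite U" "y \<in> set (pending c)"
  shows "fst y \<in> U"
proof -
  have "fst y \<in># mset (map fst (pending c)) + mset (map fst (matched c))" using assms(3) by simp
  then have "fst y \<in># mset_set U" using assms(1) unfolding sound_config_def by metis
  then show ?thesis using assms(2) by simp
qed

text \<open>One user moves from pending to matched and one slot of the same facility from open to
  filled, so both sums in \<open>sound_config\<close> are unchanged.\<close>

lemma sound_config_match:
  assumes c: "sound_config U F c" and p: "p \<in> set (pending c)" and s: "s \<in> set (slots c)"
    and close: "close (fst p) (fst s)"
  shows "sound_config U F (remove p (pending c), remove s (slots c), (fst p, fst s) # matched c)"
proof -
  let ?c = "(remove p (pending c), remove s (slots c), (fst p, fst s) # matched c)"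
  have P: "mset (pending c) = add_mset p (mset (remove p (pending c)))"
    using p by (simp add: mset_remove)
  have S: "mset (slots c) = add_mset s (mset (remove s (slots c)))"
    using s by (simp add: mset_remove)
  have sub: "set (remove p (pending c)) \<subseteq> set (pending c)" "set (remove s (slots c)) \<subseteq> set (slots c)"
    using P S by (metis set_mset_add_mset_insert set_mset_mset subset_insertI)+
  have "mset (map fst (pending c)) = add_mset (fst p) (mset (map fst (remove p (pending c))))"
    using P by simp
  moreover have "mset (map fst (slots c)) = add_mset (fst s) (mset (map fst (remove s (slots c))))"
    using S by simp
  ultimately show ?thesis
    using c close s sub unfolding sound_config_def by (auto simp: Let_def)
qed

lemma sound_prune: "sound U F t \<Longrightarrow> sound U F (prune g d t)"
  using prune_invariant[of g d t] unfolding sound_def by auto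

lemma sound_join:
  assumes "sound U F t" "sound U' F' t'" "U \<inter> U' = {}" "F \<inter> F' = {}" "finite U" "finite U'"
  shows "sound (U \<union> U') (F \<union> F') (join t t')"
  using sound_config_join[OF _ _ assms(3-6)] assms(1,2) unfolding sound_def join_def by auto

lemma sound_matches:
  assumes t: "sound U F t" and fin: "finite U"
    and cl: "\<And>i j. i \<in> U \<Longrightarrow> j \<in> F \<Longrightarrow> \<rho>u i + \<rho>f j \<le> b \<Longrightarrow> close i j"
  shows "sound U F (t @ matches b t)"
proof -
  have "sound_config U F c'" if "c' \<in> set (matches b t)" for c'
  proof -
    obtain c p s where c: "c \<in> set t" "p \<in> set (pending c)" "s \<in> set (slots c)"
      "snd p + snd s \<le> b" "c' = (remove p (pending c), remove s (slots c), (fst p, fst s) # matched c)"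
      using \<open>c' \<in> set (matches b t)\<close> unfolding matches_def by auto
    have sc: "sound_config U F c" using t c(1) unfolding sound_def by blast
    have "fst p \<in> U" by (rule sound_config_pending[OF sc fin c(2)])
    moreover have "snd p = \<rho>u (fst p)" "snd s = \<rho>f (fst s)" "fst s \<in> F"
      using sc c unfolding sound_config_def by auto
    ultimately have "close (fst p) (fst s)" using cl c(4) by simp
    then show ?thesis
      using sound_config_match[OF sc c(2,3)] c(5) by simp
  qed
  with t show ?thesis by (auto simp: sound_def)
qed

lemma merge_sound:
  assumes "sound U F t" "sound U' F' t'"
    and "U \<inter> U' = {}" "F \<inter> F' = {}" and "finite U" "finite U'"
    and cl: "\<And>i j. i \<in> U \<union> U' \<Longrightarrow> j \<in> F \<union> F' \<Longrightarrow> \<rho>u i + \<rho>f j \<le> \<theta> + (d + d) \<Longrightarrow> close i j"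
  shows "sound (U \<union> U') (F \<union> F') (merge g d t t')"
proof -
  have "sound (U \<union> U') (F \<union> F') a \<Longrightarrow>
      sound (U \<union> U') (F \<union> F') (foldl (\<lambda>a _. prune g d (a @ matches (\<theta> + (d + d)) a)) a ys)" for a and ys :: "nat list"
  proof (induction ys arbitrary: a)
    case (Cons y ys)
    have "sound (U \<union> U') (F \<union> F') (a @ matches (\<theta> + (d + d)) a)"
      by (rule sound_matches[OF Cons.prems _ cl]) (simp add: assms)
    from Cons.IH[OF sound_prune[OF this]] show ?case by simp
  qed simp
  from this[OF sound_prune[OF sound_join[OF assms(1-6)]]] show ?thesis unfolding merge_def by simp
qed

text \<open>Soundness places all rounded depths in \<open>G\<close> and bounds the number of matched
  pairs by that of the users; the window hypotheses supply the rest of admissibility.\<close>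

lemma prune_goal_key:
  assumes t: "sound U F t" and UF: "U \<subseteq> {..<n}" "F \<subseteq> {..<m}"
    and c: "c \<in> set t" "key c = goal_key X Y" and XY: "X \<subseteq> {..<n}" "Y \<subseteq> {..<n}"
    and wX: "\<And>i. i \<in> X \<Longrightarrow> d - \<delta> \<le> \<rho>u i \<and> \<rho>u i \<le> d + \<theta>"
    and wY: "\<And>i. i \<in> Y \<Longrightarrow> d - \<delta> \<le> \<rho>f (\<pi> i) \<and> \<rho>f (\<pi> i) \<le> d + \<theta>"
  shows "\<exists>c\<in>set (prune g d t). key c = goal_key X Y"
proof -
  have fin: "finite U" "finite X" "finite Y" using UF XY finite_subset by blast+
  have U: "fst y \<in> U" if "c \<in> set t" "y \<in> set (pending c)" for c y
    using sound_config_pending[OF _ fin(1) that(2)] t that(1) unfolding sound_def by blast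
  have vals: "snd ` set (pending c @ slots c) \<subseteq> G" if c: "c \<in> set t" for c
  proof -
    have sc: "sound_config U F c" using t c unfolding sound_def by blast
    have "snd y \<in> G" if "y \<in> set (pending c)" for y
    proof -
      have "snd y = \<rho>u (fst y)" using sc that unfolding sound_config_def by blast
      then show ?thesis using U[OF c that] UF(1) \<rho>u by auto
    qed
    moreover have "snd y \<in> G" if "y \<in> set (slots c)" for y
    proof -
      have "snd y = \<rho>f (fst y)" "fst y \<in> F" using sc that unfolding sound_config_def by blast+
      then show ?thesis using UF(2) \<rho>f by auto
    qed
    ultimately show ?thesis by auto
  qed
  have kP: "mset (map snd (pending c)) = image_mset \<rho>u (mset_set X)"
    and kS: "mset (map snd (slots c)) = image_mset (\<lambda>i. \<rho>f (\<pi> i)) (mset_set Y)"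
    using c(2) unfolding key_def goal_key_def by simp_all
  have "length (pending c) = card X" using arg_cong[OF kP, of size] by simp
  moreover have "length (slots c) = card Y" using arg_cong[OF kS, of size] by simp
  moreover have "length (matched c) \<le> card U"
  proof -
    have "mset (map fst (pending c)) + mset (map fst (matched c)) = mset_set U"
      using t c(1) unfolding sound_def sound_config_def by blast
    from arg_cong[OF this, of size] show ?thesis by simp
  qed
  moreover have "card X \<le> n" "card Y \<le> n" "card U \<le> n"
    using card_mono[of "{..<n}" X] card_mono[of "{..<n}" Y] card_mono[of "{..<n}" U] XY UF by simp_all
  moreover have "d - \<delta> \<le> v \<and> v \<le> d + \<theta>" if "v \<in> snd ` set (pending c)" for v
  proof -
    have "v \<in> set_mset (image_mset \<rho>u (mset_set X))" using that kP by (metis set_map set_mset_mset)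
    then show ?thesis using wX fin by auto
  qed
  moreover have "d - \<delta> \<le> v \<and> v \<le> d + \<theta>" if "v \<in> snd ` set (slots c)" for v
  proof -
    have "v \<in> set_mset (image_mset (\<lambda>i. \<rho>f (\<pi> i)) (mset_set Y))" using that kS by (metis set_map set_mset_mset)
    then show ?thesis using wY fin by auto
  qed
  ultimately have "admissible g d c" unfolding admissible_def using len_N by auto
  from prune_equivalent[OF c(1) this G(1) vals, of K] G(2) len_N len_B c(2)
  show ?thesis by auto
qed

text \<open>Beyond what is left over for the union, joining the two goal configurations leaves over
  exactly the users in \<open>C\<close>, whose facility lies on the other side. By
  \<open>near\<close> they pass the matching test, so the rounds remove them one at a time.\<close>

lemma merge_complete:
  assumes H: H
    and t: "sound U F t" "sound U' F' t'" and compl: "complete U F t" "complete U' F' t'"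
    and UF: "U \<subseteq> {..<n}" "U' \<subseteq> {..<n}" "F \<subseteq> {..<m}" "F' \<subseteq> {..<m}"
    and disj: "U \<inter> U' = {}" "F \<inter> F' = {}"
    and cl: "\<And>i j. i \<in> U \<union> U' \<Longrightarrow> j \<in> F \<union> F' \<Longrightarrow> \<rho>u i + \<rho>f j \<le> \<theta> + (d + d) \<Longrightarrow> close i j"
    and near: "\<And>i. i < n \<Longrightarrow> (i \<in> U) \<noteq> (\<pi> i \<in> F) \<or> (i \<in> U') \<noteq> (\<pi> i \<in> F') \<Longrightarrow>
      \<rho>u i + \<rho>f (\<pi> i) \<le> \<theta> + (d + d) \<and>
      (i \<in> U \<union> U' \<longrightarrow> d - \<delta> \<le> \<rho>u i \<and> \<rho>u i \<le> d + \<theta>) \<and>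
      (\<pi> i \<in> F \<union> F' \<longrightarrow> d - \<delta> \<le> \<rho>f (\<pi> i) \<and> \<rho>f (\<pi> i) \<le> d + \<theta>)"
  shows "complete (U \<union> U') (F \<union> F') (merge g d t t')"
proof -
  let ?U = "U \<union> U'" and ?F = "F \<union> F'" and ?b = "\<theta> + (d + d)"
  let ?X = "{i \<in> ?U. \<pi> i \<notin> ?F}" and ?Y = "{i. i < n \<and> i \<notin> ?U \<and> \<pi> i \<in> ?F}"
  define C where "C = {i. i \<in> U \<and> \<pi> i \<in> F' \<or> i \<in> U' \<and> \<pi> i \<in> F}"
  \<comment> \<open>\<open>A\<close> is the part of \<open>C\<close> still to be matched.\<close>
  define present where "present = (\<lambda>A a. \<exists>c\<in>set a. key c = goal_key (?X \<union> A) (?Y \<union> A))"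
  have fin: "finite U" "finite U'" using UF finite_subset by blast+
  have finU: "finite ?U" using fin by simp
  have Cn: "C \<subseteq> {..<n}" unfolding C_def using UF by auto
  then have Cfin: "finite C" "card C \<le> n" using finite_subset card_mono[of "{..<n}" C] by auto
  have pr: "present A (prune g d a)" if "present A a" "sound ?U ?F a" "A \<subseteq> C" for A a
  proof -
    obtain c where c: "c \<in> set a" "key c = goal_key (?X \<union> A) (?Y \<union> A)"
      using \<open>present A a\<close> unfolding present_def by blast
    have 1: "?U \<subseteq> {..<n}" "?F \<subseteq> {..<m}" using UF by auto
    have 2: "?X \<union> A \<subseteq> {..<n}" "?Y \<union> A \<subseteq> {..<n}" using UF \<open>A \<subseteq> C\<close> Cn by auto
    have 3: "d - \<delta> \<le> \<rho>u i \<and> \<rho>u i \<le> d + \<theta>" if "i \<in> ?X \<union> A" for i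
    proof -
      have "i \<in> ?U" "i < n" "(i \<in> U) \<noteq> (\<pi> i \<in> F) \<or> (i \<in> U') \<noteq> (\<pi> i \<in> F')"
        using that \<open>A \<subseteq> C\<close> UF disj unfolding C_def by auto
      with near show ?thesis by blast
    qed
    have 4: "d - \<delta> \<le> \<rho>f (\<pi> i) \<and> \<rho>f (\<pi> i) \<le> d + \<theta>" if "i \<in> ?Y \<union> A" for i
    proof -
      have "\<pi> i \<in> ?F" "i < n" "(i \<in> U) \<noteq> (\<pi> i \<in> F) \<or> (i \<in> U') \<noteq> (\<pi> i \<in> F')"
        using that \<open>A \<subseteq> C\<close> UF disj unfolding C_def by auto
      with near show ?thesis by blast
    qed
    show ?thesis unfolding present_def
      using prune_goal_key[OF \<open>sound ?U ?F a\<close> 1 c 2 3 4] by blast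
  qed
  have start: "present C (prune g d (join t t'))"
  proof -
    obtain c c' where c: "c \<in> set t" "key c = goal_key {i \<in> U. \<pi> i \<notin> F} {i. i < n \<and> i \<notin> U \<and> \<pi> i \<in> F}"
      and c': "c' \<in> set t'" "key c' = goal_key {i \<in> U'. \<pi> i \<notin> F'} {i. i < n \<and> i \<notin> U' \<and> \<pi> i \<in> F'}"
      using compl unfolding complete_def by blast
    let ?c = "(pending c @ pending c', slots c @ slots c', matched c @ matched c')"
    have "?c \<in> set (join t t')" using c(1) c'(1) unfolding join_def by auto
    moreover have "key ?c = goal_key (?X \<union> C) (?Y \<union> C)"
    proof -
      have "?X \<union> C = {i \<in> U. \<pi> i \<notin> F} \<union> {i \<in> U'. \<pi> i \<notin> F'}"
        using disj unfolding C_def by auto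
      moreover have "{i \<in> U. \<pi> i \<notin> F} \<inter> {i \<in> U'. \<pi> i \<notin> F'} = {}" using disj by auto
      moreover have "?Y \<union> C = {i. i < n \<and> i \<notin> U \<and> \<pi> i \<in> F} \<union> {i. i < n \<and> i \<notin> U' \<and> \<pi> i \<in> F'}"
        using disj UF unfolding C_def by auto
      moreover have "{i. i < n \<and> i \<notin> U \<and> \<pi> i \<in> F} \<inter> {i. i < n \<and> i \<notin> U' \<and> \<pi> i \<in> F'} = {}"
        using disj by auto
      ultimately show ?thesis
        using c(2) c'(2) fin unfolding key_def goal_key_def by (simp add: mset_set_Union)
    qed
    ultimately have "present C (join t t')" unfolding present_def by blast
    moreover have "sound ?U ?F (join t t')" by (rule sound_join[OF t disj fin])
    ultimately show ?thesis using pr by blast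
  qed
  \<comment> \<open>The pair found need not contain user \<open>i\<close>. Any user and slot with
    the rounded depths of \<open>i\<close> and \<open>\<pi> i\<close> give the same test and the
    same key.\<close>
  have match: "present (A - {i}) (matches ?b a)" if "present A a" "sound ?U ?F a" "A \<subseteq> C" "i \<in> A" for A a i
  proof -
    obtain c where c: "c \<in> set a" "key c = goal_key (?X \<union> A) (?Y \<union> A)"
      using \<open>present A a\<close> unfolding present_def by blast
    have i: "i \<in> C" using that by blast
    have iX: "i \<notin> ?X" "i \<notin> ?Y" using i unfolding C_def by auto
    have finX: "finite (?X \<union> A)" "finite (?Y \<union> A)"
      using fin finite_subset[OF \<open>A \<subseteq> C\<close> Cfin(1)] by auto
    have kP: "mset (map snd (pending c)) = image_mset \<rho>u (mset_set (?X \<union> A))"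
      and kS: "mset (map snd (slots c)) = image_mset (\<lambda>i. \<rho>f (\<pi> i)) (mset_set (?Y \<union> A))"
      using c(2) unfolding key_def goal_key_def by simp_all
    have "\<rho>u i \<in># mset (map snd (pending c))" unfolding kP using finX \<open>i \<in> A\<close> by simp
    then obtain p where p: "p \<in> set (pending c)" "snd p = \<rho>u i" by auto
    have "\<rho>f (\<pi> i) \<in># mset (map snd (slots c))" unfolding kS using finX \<open>i \<in> A\<close> by simp
    then obtain s where s: "s \<in> set (slots c)" "snd s = \<rho>f (\<pi> i)" by auto
    have "\<rho>u i + \<rho>f (\<pi> i) \<le> ?b"
      using near[of i] i Cn disj unfolding C_def by blast
    then have m: "(remove p (pending c), remove s (slots c), (fst p, fst s) # matched c) \<in> set (matches ?b a)"
      (is "?c \<in> _")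
      using c(1) p s unfolding matches_def by force
    have "image_mset \<rho>u (mset_set (?X \<union> A)) = add_mset (\<rho>u i) (image_mset \<rho>u (mset_set (?X \<union> (A - {i}))))"
    proof -
      have "?X \<union> A = insert i (?X \<union> (A - {i}))" using \<open>i \<in> A\<close> by blast
      moreover have "i \<notin> ?X \<union> (A - {i})" using iX by blast
      ultimately show ?thesis using finX by simp
    qed
    moreover have "image_mset (\<lambda>i. \<rho>f (\<pi> i)) (mset_set (?Y \<union> A)) =
        add_mset (\<rho>f (\<pi> i)) (image_mset (\<lambda>i. \<rho>f (\<pi> i)) (mset_set (?Y \<union> (A - {i}))))"
    proof -
      have "?Y \<union> A = insert i (?Y \<union> (A - {i}))" using \<open>i \<in> A\<close> by blast
      moreover have "i \<notin> ?Y \<union> (A - {i})" using iX by blast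
      ultimately show ?thesis using finX by simp
    qed
    moreover have "mset (map snd (remove p (pending c))) = mset (map snd (pending c)) - {#\<rho>u i#}"
      using p by (simp add: mset_remove image_mset_Diff)
    moreover have "mset (map snd (remove s (slots c))) = mset (map snd (slots c)) - {#\<rho>f (\<pi> i)#}"
      using s by (simp add: mset_remove image_mset_Diff)
    ultimately have "key ?c = goal_key (?X \<union> (A - {i})) (?Y \<union> (A - {i}))"
      unfolding key_def goal_key_def using kP kS by simp
    with m show ?thesis unfolding present_def by blast
  qed
  have "present {} (foldl (\<lambda>a _. prune g d (a @ matches ?b a)) a ys)"
    if "present A a" "sound ?U ?F a" "A \<subseteq> C" "card A \<le> length ys" for A a and ys :: "nat list"
    using that
  proof (induction ys arbitrary: a A)
    case Nil
    then have "A = {}" using Cfin finite_subset by fastforce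
    with Nil show ?case by simp
  next
    case (Cons y ys)
    let ?a = "prune g d (a @ matches ?b a)"
    have sa': "sound ?U ?F (a @ matches ?b a)"
      by (rule sound_matches[OF Cons.prems(2) finU cl])
    then have sa: "sound ?U ?F ?a" by (rule sound_prune)
    show ?case
    proof (cases "A = {}")
      case True
      then have "present {} (a @ matches ?b a)" using Cons.prems(1) unfolding present_def by auto
      then have "present {} ?a" using pr[OF _ sa'] by simp
      with Cons.IH[OF _ sa, of "{}"] show ?thesis by simp
    next
      case False
      then obtain i where i: "i \<in> A" by blast
      have "present (A - {i}) (a @ matches ?b a)"
        using match[OF Cons.prems(1-3) i] unfolding present_def by auto
      then have "present (A - {i}) ?a" using pr[OF _ sa'] Cons.prems(3) by blast
      moreover have "card (A - {i}) \<le> length ys"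
        using i Cons.prems(4) by simp
      ultimately show ?thesis using Cons.IH[OF _ sa, of "A - {i}"] Cons.prems(3) by auto
    qed
  qed
  from this[OF start sound_prune[OF sound_join[OF t disj fin]], of N] Cfin len_N show ?thesis
    unfolding complete_def merge_def present_def by simp
qed

section \<open>The sweep from the leaves to the root\<close>

type_synonym entry = "(nat \<times> nat) \<times> table \<times> nat set \<times> nat set"

abbreviation "users e \<equiv> fst (snd (snd (e :: entry)))"
abbreviation "facs e \<equiv> snd (snd (snd (e :: entry)))"
abbreviation "erase e \<equiv> (fst e, fst (snd (e :: entry)))"

text \<open>The two sets of an entry are bookkeeping for the proof and vanish under
  \<open>erase\<close>; \<open>ns\<close> holds the links not yet processed. Ancestors still ahead
  are common to everything in the entry, and a user separated from its facility has its witness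
  still ahead.\<close>

definition entry_ok :: "link list \<Rightarrow> entry \<Rightarrow> bool" where
  "entry_ok ns e \<longleftrightarrow> users e \<subseteq> {..<n} \<and> facs e \<subseteq> {..<m} \<and>
     sound (users e) (facs e) (fst (snd e)) \<and> (H \<longrightarrow> complete (users e) (facs e) (fst (snd e))) \<and>
     (\<forall>i\<in>users e. up ns (fst e) \<subseteq> up nodes (lu i)) \<and>
     (\<forall>j\<in>facs e. up ns (fst e) \<subseteq> up nodes (lf j)) \<and>
     (H \<longrightarrow> (\<forall>i<n. (i \<in> users e) \<noteq> (\<pi> i \<in> facs e) \<longrightarrow> wit i \<in> up ns (fst e)))"

definition disjoint_entries :: "entry \<Rightarrow> entry \<Rightarrow> bool" where
  "disjoint_entries e e' \<longleftrightarrow> users e \<inter> users e' = {} \<and> facs e \<inter> facs e' = {}"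

text \<open>Node \<open>x\<close> is a common ancestor of everything in both entries, so a pair
  passing the test is \<open>close\<close>. Conversely, the witness of a separated pair lies at
  \<open>x\<close> or above, hence at depth at most \<open>d\<close>, which yields both the test and
  the window of \<open>admissible\<close>.\<close>

lemma entry_ok_merge:
  assumes ns: "ns = (x, q, d) # ns'" "ordered ns"
    and ok: "entry_ok ns (x, t, U, F)" "entry_ok ns (x, t', U', F')"
    and disj: "U \<inter> U' = {}" "F \<inter> F' = {}"
  shows "entry_ok ns (x, merge g d t t', U \<union> U', F \<union> F')"
proof -
  have xd: "(x, d) \<in> up ns x" using ns(1) by simp
  have le_d: "snd z \<le> d" if "z \<in> up ns x" for z
    using that ns by auto
  have UF: "U \<subseteq> {..<n}" "U' \<subseteq> {..<n}" "F \<subseteq> {..<m}" "F' \<subseteq> {..<m}"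
    and snd: "sound U F t" "sound U' F' t'"
    and compl: "H \<Longrightarrow> complete U F t" "H \<Longrightarrow> complete U' F' t'"
    and up: "\<And>i. i \<in> U \<union> U' \<Longrightarrow> up ns x \<subseteq> up nodes (lu i)"
      "\<And>j. j \<in> F \<union> F' \<Longrightarrow> up ns x \<subseteq> up nodes (lf j)"
    and wit': "\<And>i. H \<Longrightarrow> i < n \<Longrightarrow> (i \<in> U) \<noteq> (\<pi> i \<in> F) \<or> (i \<in> U') \<noteq> (\<pi> i \<in> F') \<Longrightarrow> wit i \<in> up ns x"
    using ok unfolding entry_ok_def by auto
  have fin: "finite U" "finite U'" using UF finite_subset by blast+
  have cl: "close i j" if "i \<in> U \<union> U'" "j \<in> F \<union> F'" "\<rho>u i + \<rho>f j \<le> \<theta> + (d + d)" for i j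
  proof -
    have ij: "i < n" "j < m" using that UF by auto
    have "(x, d) \<in> up nodes (lu i) \<inter> up nodes (lf j)" using up that xd by blast
    moreover have "Du i + Df j - 2 * snd (x, d) \<le> \<theta> + 2 * \<delta>"
      using \<rho>u[OF ij(1)] \<rho>f[OF ij(2)] that(3) by (simp add: abs_le_iff)
    ultimately show ?thesis unfolding close_def by blast
  qed
  have "complete (U \<union> U') (F \<union> F') (merge g d t t')" if H
  proof (rule merge_complete[OF that snd compl[OF that] UF disj cl])
    fix i assume i: "i < n" "(i \<in> U) \<noteq> (\<pi> i \<in> F) \<or> (i \<in> U') \<noteq> (\<pi> i \<in> F')"
    have wd: "snd (wit i) \<le> d" using wit'[OF that i] le_d by blast
    have w: "wit i \<in> up nodes (lu i)" "wit i \<in> up nodes (lf (\<pi> i))"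
      and wc: "Du i + Df (\<pi> i) - 2 * snd (wit i) + 2 * \<delta> \<le> \<theta>" using wit[OF that i(1)] by auto
    have pi: "\<pi> i < m" using \<pi>[OF that i(1)] .
    have wu: "snd (wit i) \<le> Du i" "snd (wit i) \<le> Df (\<pi> i)"
      using lu(2)[OF i(1) w(1)] lf(2)[OF pi w(2)] .
    have r: "\<bar>\<rho>u i - Du i\<bar> \<le> \<delta>" "\<bar>\<rho>f (\<pi> i) - Df (\<pi> i)\<bar> \<le> \<delta>" using \<rho>u[OF i(1)] \<rho>f[OF pi] by auto
    have dU: "d \<le> Du i" if "i \<in> U \<union> U'"
      using lu(2)[OF i(1), of "(x, d)"] up(1)[OF that] xd by auto
    have dF: "d \<le> Df (\<pi> i)" if "\<pi> i \<in> F \<union> F'"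
      using lf(2)[OF pi, of "(x, d)"] up(2)[OF that] xd by auto
    \<comment> \<open>The upper end of the window comes from \<open>wc\<close>: as the witness is no
      deeper than \<open>Df (\<pi> i)\<close> and than \<open>d\<close>, it bounds
      \<open>Du i\<close> by \<open>d + \<theta> - 2 * \<delta>\<close>, and
      \<open>Df (\<pi> i)\<close> likewise.\<close>
    show "\<rho>u i + \<rho>f (\<pi> i) \<le> \<theta> + (d + d) \<and>
      (i \<in> U \<union> U' \<longrightarrow> d - \<delta> \<le> \<rho>u i \<and> \<rho>u i \<le> d + \<theta>) \<and>
      (\<pi> i \<in> F \<union> F' \<longrightarrow> d - \<delta> \<le> \<rho>f (\<pi> i) \<and> \<rho>f (\<pi> i) \<le> d + \<theta>)"
      using r wd wc wu dU dF \<delta> unfolding abs_le_iff by (intro conjI impI) (force simp: algebra_simps)+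
  qed
  moreover have "sound (U \<union> U') (F \<union> F') (merge g d t t')"
    by (rule merge_sound[OF snd disj fin cl])
  ultimately show ?thesis using UF up wit' unfolding entry_ok_def by auto
qed

lemma entry_ok_foldl:
  assumes ns: "ns = (x, q, d) # ns'" "ordered ns"
    and "entry_ok ns (x, t, U, F)" "\<And>e. e \<in> set es \<Longrightarrow> entry_ok ns e" "sorted_wrt disjoint_entries es"
    and "\<And>e. e \<in> set es \<Longrightarrow> fst e = x \<Longrightarrow> U \<inter> users e = {} \<and> F \<inter> facs e = {}"
  shows "entry_ok ns (x, foldl (\<lambda>t e. if fst e = x then merge g d t (snd e) else t) t (map erase es),
    U \<union> \<Union> (users ` {e \<in> set es. fst e = x}), F \<union> \<Union> (facs ` {e \<in> set es. fst e = x}))"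
  using assms(3-)
proof (induction es arbitrary: t U F)
  case (Cons e es)
  show ?case
  proof (cases "fst e = x")
    case True
    obtain t' U' F' where e: "e = (x, t', U', F')" using True by (cases e) auto
    have "entry_ok ns (x, merge g d t t', U \<union> U', F \<union> F')"
      using Cons.prems(1) Cons.prems(2)[of e] Cons.prems(4)[of e] e by (intro entry_ok_merge[OF ns]) auto
    moreover have "(U \<union> U') \<inter> users e' = {} \<and> (F \<union> F') \<inter> facs e' = {}" if "e' \<in> set es" "fst e' = x" for e'
      using Cons.prems(3) Cons.prems(4)[of e'] that e unfolding disjoint_entries_def by auto
    ultimately have "entry_ok ns (x, foldl (\<lambda>t e. if fst e = x then merge g d t (snd e) else t) (merge g d t t') (map erase es),
      (U \<union> U') \<union> \<Union> (users ` {e \<in> set es. fst e = x}), (F \<union> F') \<union> \<Union> (facs ` {e \<in> set es. fst e = x}))"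
      using Cons.prems(2,3) by (intro Cons.IH) auto
    moreover have "{e' \<in> set (e # es). fst e' = x} = insert e {e \<in> set es. fst e = x}" using e by auto
    ultimately show ?thesis using e by (simp add: Un_assoc)
  next
    case False
    then have *: "{e' \<in> set (e # es). fst e' = x} = {e \<in> set es. fst e = x}" by auto
    have "entry_ok ns (x, foldl (\<lambda>t e. if fst e = x then merge g d t (snd e) else t) t (map erase es),
      U \<union> \<Union> (users ` {e \<in> set es. fst e = x}), F \<union> \<Union> (facs ` {e \<in> set es. fst e = x}))"
      using Cons.prems by (intro Cons.IH) auto
    then show ?thesis unfolding * using False by simp
  qed
qed simp

text \<open>Disjointness refers to positions in the list, so equal entries with empty sets may
  recur. Names are constrained only while links remain, because the last step hands its entry to the
  dummy parent of the root.\<close>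

definition invariant :: "link list \<Rightarrow> entry list \<Rightarrow> bool" where
  "invariant ns es \<longleftrightarrow> sorted_wrt disjoint_entries es \<and> \<Union> (users ` set es) = {..<n} \<and>
     \<Union> (facs ` set es) = {..<m} \<and>
     (\<forall>e\<in>set es. entry_ok ns e \<and> (ns \<noteq> [] \<longrightarrow> fst e \<in> fst ` set ns))"

lemma sorted_wrt_disjoint:
  "sorted_wrt disjoint_entries es \<Longrightarrow> e \<in> set es \<Longrightarrow> e' \<in> set es \<Longrightarrow> e \<noteq> e' \<Longrightarrow> disjoint_entries e e'"
  by (induction es) (auto simp: disjoint_entries_def)

lemma invariant_step:
  assumes inv: "invariant (x # ns) es" and ord: "ordered (x # ns)"
  obtains es' where "invariant ns es'" "step g (map erase es) x = map erase es'" "ns = [] \<Longrightarrow> length es' = 1"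
proof -
  obtain y q d where x: "x = (y, q, d)" by (cases x) auto
  let ?ns = "(y, q, d) # ns"
  let ?in = "{e \<in> set es. fst e = y}"
  define U where "U = \<Union> (users ` ?in)"
  define F where "F = \<Union> (facs ` ?in)"
  define t where "t = foldl (\<lambda>t e. if fst e = y then merge g d t (snd e) else t) [([], [], [])] (map erase es)"
  have srt: "sorted_wrt disjoint_entries es" and ok: "\<And>e. e \<in> set es \<Longrightarrow> entry_ok ?ns e"
    and cov: "\<Union> (users ` set es) = {..<n}" "\<Union> (facs ` set es) = {..<m}"
    and nm: "\<And>e. e \<in> set es \<Longrightarrow> fst e \<in> fst ` set ?ns"
    using inv unfolding invariant_def x by blast+
  have "entry_ok ?ns (y, [([], [], [])], {}, {})"
    unfolding entry_ok_def sound_def sound_config_def complete_def key_def goal_key_def by simp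
  then have "entry_ok ?ns (y, t, {} \<union> U, {} \<union> F)"
    unfolding t_def U_def F_def
    by (rule entry_ok_foldl[OF refl ord[unfolded x] _ ok srt]) simp_all
  then have t: "entry_ok ?ns (y, t, U, F)" by (simp only: Un_empty_left)
  have y: "y \<notin> fst ` set ns" and q: "ns \<noteq> [] \<Longrightarrow> q \<in> fst ` set ns" using ord x by auto
  have disj: "e = e' \<or> disjoint_entries e e'" if "e \<in> set es" "e' \<in> set es" for e e'
    using sorted_wrt_disjoint[OF srt that] by blast
  have upy: "up ?ns y = insert (y, d) (up ns q)" by simp
  \<comment> \<open>The other end of the pair waits at a node different from \<open>y\<close>, and
    the witness is an ancestor of that node too. This makes it a node of the remaining links
    \<open>ns\<close>, which do not contain \<open>y\<close>, so it lies strictly above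
    \<open>y\<close>.\<close>
  have "wit i \<in> up ns q" if H "i < n" and ex: "(i \<in> U) \<noteq> (\<pi> i \<in> F)" for i
  proof -
    have 1: "wit i \<in> up ?ns y" using t that unfolding entry_ok_def fst_conv snd_conv by blast
    have "\<exists>e\<in>set es. fst e \<noteq> y \<and> (i \<in> users e) \<noteq> (\<pi> i \<in> facs e)"
    proof (cases "i \<in> U")
      case True
      then obtain e0 where e0: "e0 \<in> set es" "fst e0 = y" "i \<in> users e0" unfolding U_def by blast
      have "\<pi> i \<in> \<Union> (facs ` set es)" unfolding cov(2) using \<pi>[OF that(1,2)] by simp
      then obtain e where e: "e \<in> set es" "\<pi> i \<in> facs e" by blast
      have "\<pi> i \<notin> F" using ex True by blast
      then have ne: "fst e \<noteq> y" using e unfolding F_def by blast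
      then have "disjoint_entries e e0" using disj[OF e(1) e0(1)] e0(2) by blast
      then have "i \<notin> users e" using e0(3) unfolding disjoint_entries_def by blast
      with ne show ?thesis using e by blast
    next
      case False
      then have "\<pi> i \<in> F" using ex by blast
      then obtain e0 where e0: "e0 \<in> set es" "fst e0 = y" "\<pi> i \<in> facs e0" unfolding F_def by blast
      have "i \<in> \<Union> (users ` set es)" unfolding cov(1) using that(2) by simp
      then obtain e where e: "e \<in> set es" "i \<in> users e" by blast
      have ne: "fst e \<noteq> y" using e False unfolding U_def by blast
      then have "disjoint_entries e e0" using disj[OF e(1) e0(1)] e0(2) by blast
      then have "\<pi> i \<notin> facs e" using e0(3) unfolding disjoint_entries_def by blast
      with ne show ?thesis using e by blast
    qed
    then obtain e where e: "e \<in> set es" "fst e \<noteq> y" "(i \<in> users e) \<noteq> (\<pi> i \<in> facs e)" by blast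
    have "H \<longrightarrow> (\<forall>i<n. (i \<in> users e) \<noteq> (\<pi> i \<in> facs e) \<longrightarrow> wit i \<in> up ?ns (fst e))"
      using ok[OF e(1)] unfolding entry_ok_def by (elim conjE)
    then have "wit i \<in> up ?ns (fst e)" using that(1,2) e(3) by simp
    then have "wit i \<in> up ns (fst e)" using e(2) by simp
    from up_names[OF this] have "fst (wit i) \<noteq> y" using y by metis
    then have "wit i \<noteq> (y, d)" by auto
    with 1 show ?thesis unfolding upy by simp
  qed
  then have new: "entry_ok ns (q, t, U, F)"
  proof -
    have "up ns q \<subseteq> up ?ns y" unfolding upy by blast
    with \<open>\<And>i. H \<Longrightarrow> i < n \<Longrightarrow> (i \<in> U) \<noteq> (\<pi> i \<in> F) \<Longrightarrow> wit i \<in> up ns q\<close> t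
    show ?thesis unfolding entry_ok_def fst_conv snd_conv by blast
  qed
  have old: "entry_ok ns e" if "e \<in> set es" "fst e \<noteq> y" for e
    using ok[OF that(1)] that(2) unfolding entry_ok_def by simp
  let ?es = "(q, t, U, F) # filter (\<lambda>e. fst e \<noteq> y) es"
  have "disjoint_entries (q, t, U, F) e" if "e \<in> set es" "fst e \<noteq> y" for e
  proof -
    have "users e0 \<inter> users e = {} \<and> facs e0 \<inter> facs e = {}" if e0: "e0 \<in> ?in" for e0
    proof -
      have "e0 \<noteq> e" using e0 \<open>fst e \<noteq> y\<close> by blast
      then have "disjoint_entries e0 e" using disj[of e0 e] e0 \<open>e \<in> set es\<close> by blast
      then show ?thesis unfolding disjoint_entries_def .
    qed
    then show ?thesis unfolding disjoint_entries_def U_def F_def fst_conv snd_conv by blast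
  qed
  then have "sorted_wrt disjoint_entries ?es" using srt by (simp add: sorted_wrt_filter)
  moreover have "\<Union> (users ` set ?es) = {..<n}" "\<Union> (facs ` set ?es) = {..<m}"
    unfolding cov[symmetric] U_def F_def by auto
  moreover have "entry_ok ns e \<and> (ns \<noteq> [] \<longrightarrow> fst e \<in> fst ` set ns)" if "e \<in> set ?es" for e
  proof (cases "e = (q, t, U, F)")
    case True
    then show ?thesis using new q by simp
  next
    case False
    then have e: "e \<in> set es" "fst e \<noteq> y" using that by auto
    show ?thesis using old[OF e] nm[OF e(1)] e(2) by simp
  qed
  ultimately have "invariant ns ?es" unfolding invariant_def by blast
  moreover have "step g (map erase es) x = map erase ?es"
    unfolding step_def t_def x fst_conv snd_conv by (simp add: filter_map comp_def)
  \<comment> \<open>At the last link every entry waits at \<open>y\<close>, so only the merged one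
    remains.\<close>
  moreover have "length ?es = 1" if "ns = []" using nm that by (auto simp: filter_empty_conv)
  ultimately show ?thesis by (rule that)
qed

lemma invariant_foldl:
  assumes "ns \<noteq> []" "invariant ns es" "ordered ns"
  shows "\<exists>e. invariant [] [e] \<and> foldl (step g) (map erase es) ns = [erase e]"
  using assms
proof (induction ns arbitrary: es)
  case (Cons x ns)
  obtain es' where es': "invariant ns es'" "step g (map erase es) x = map erase es'" "ns = [] \<Longrightarrow> length es' = 1"
    using invariant_step[OF Cons.prems(2,3)] by blast
  show ?case
  proof (cases "ns = []")
    case True
    then obtain e where "es' = [e]" using es'(3) by (auto simp: length_Suc_conv)
    then show ?thesis using es' True by (intro exI[of _ e]) simp
  next
    case False
    have "ordered ns" using Cons.prems(3) by (cases x) simp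
    from Cons.IH[OF False es'(1) this] show ?thesis using es'(2) by simp
  qed
qed simp

section \<open>Initial tables and the final result\<close>

definition start :: "entry list" where
  "start = map (\<lambda>i. (lu i, [([(i, \<rho>u i)], [], [])], {i}, {})) [0..<n] @
     map (\<lambda>j. (lf j, facility_table r N (j, \<rho>f j), {}, {j})) [0..<m]"

lemma filter_less_N: "k \<le> n \<Longrightarrow> map (\<lambda>_. y) (filter (\<lambda>i. i < k) N) = replicate k y"
proof -
  assume "k \<le> n"
  then have "[0..<n] = [0..<k] @ [k..<n]"
    using upt_add_eq_append[of 0 k "n - k"] by simp
  then have "filter (\<lambda>i. i < k) N = [0..<k]" by (simp add: N)
  then show ?thesis by (simp add: map_replicate_const)
qed

lemma invariant_start: "invariant nodes start"
proof -
  have user: "entry_ok nodes (lu i, [([(i, \<rho>u i)], [], [])], {i}, {})" if "i < n" for i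
  proof -
    have "{i' \<in> {i}. \<pi> i' \<notin> {}} = {i}" by auto
    then show ?thesis
      using that wit unfolding entry_ok_def sound_def sound_config_def complete_def key_def goal_key_def by auto
  qed
  have fac: "entry_ok nodes (lf j, facility_table r N (j, \<rho>f j), {}, {j})" if "j < m" for j
  proof -
    let ?t = "facility_table r N (j, \<rho>f j)"
    have t: "set ?t = {([], replicate k (j, \<rho>f j), []) |k. k \<le> n \<and> (k = 0 \<or> r \<le> k)}"
    proof -
      have "{k \<in> set (N @ [length N]). k = 0 \<or> r \<le> k} = {k. k \<le> n \<and> (k = 0 \<or> r \<le> k)}"
        by (auto simp: N)
      then have "set ?t = (\<lambda>k. ([], map (\<lambda>_. (j, \<rho>f j)) (filter (\<lambda>i. i < k) N), [])) ` {k. k \<le> n \<and> (k = 0 \<or> r \<le> k)}"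
        unfolding facility_table_def set_map set_filter by simp
      also have "\<dots> = (\<lambda>k. ([], replicate k (j, \<rho>f j), [])) ` {k. k \<le> n \<and> (k = 0 \<or> r \<le> k)}"
        by (intro image_cong) (simp_all add: filter_less_N)
      finally show ?thesis by auto
    qed
    have "sound {} {j} ?t"
      unfolding sound_def t sound_config_def by auto
    moreover have "complete {} {j} ?t" if H
    proof -
      let ?I = "{i. i < n \<and> \<pi> i = j}"
      have "card ?I \<le> n" using card_mono[of "{..<n}" ?I] by auto
      \<comment> \<open>The number of slots to open is the load of \<open>j\<close> under
        \<open>\<pi>\<close>.\<close>
      then have "([], replicate (card ?I) (j, \<rho>f j), []) \<in> set ?t"
        using feas[OF that \<open>j < m\<close>] unfolding t by auto
      moreover have "image_mset (\<lambda>i. \<rho>f (\<pi> i)) (mset_set ?I) = image_mset (\<lambda>i. \<rho>f j) (mset_set ?I)"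
        by (intro image_mset_cong) auto
      ultimately show ?thesis
        unfolding complete_def key_def goal_key_def by (force simp: image_mset_const_eq)
    qed
    ultimately show ?thesis
      using that wit unfolding entry_ok_def by auto
  qed
  have "sorted_wrt disjoint_entries start"
  proof -
    have "sorted_wrt (\<lambda>i i'. disjoint_entries (lu i, [([(i, \<rho>u i)], [], [])], {i}, {})
        (lu i', [([(i', \<rho>u i')], [], [])], {i'}, {})) [0..<n]"
      by (rule sorted_wrt_mono_rel[OF _ sorted_wrt_upt]) (simp add: disjoint_entries_def)
    moreover have "sorted_wrt (\<lambda>j j'. disjoint_entries (lf j, facility_table r N (j, \<rho>f j), {}, {j})
        (lf j', facility_table r N (j', \<rho>f j'), {}, {j'})) [0..<m]"
      by (rule sorted_wrt_mono_rel[OF _ sorted_wrt_upt]) (simp add: disjoint_entries_def)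
    ultimately show ?thesis
      unfolding start_def by (simp add: sorted_wrt_append sorted_wrt_map) (simp add: disjoint_entries_def)
  qed
  moreover have "\<forall>e\<in>set start. entry_ok nodes e \<and> fst e \<in> fst ` set nodes"
    using user fac lu(1) lf(1) unfolding start_def by auto
  ultimately show ?thesis unfolding invariant_def start_def by auto
qed

definition result :: "(nat \<times> nat) list list" where
  "result = map (\<lambda>c. snd (snd c)) (filter (\<lambda>c. fst c = [] \<and> fst (snd c) = [])
     (concat (map snd (foldl (step g) (map erase start) nodes))))"

theorem result_sound:
  assumes "M \<in> set result"
  shows "mset (map fst M) = mset_set {..<n}" "\<And>y. y \<in> set M \<Longrightarrow> snd y < m \<and> close (fst y) (snd y)"
    "\<And>j. j < m \<Longrightarrow> count (mset (map snd M)) j = 0 \<or> r \<le> count (mset (map snd M)) j"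
proof -
  obtain e where e: "invariant [] [e]" "foldl (step g) (map erase start) nodes = [erase e]"
    using invariant_foldl[OF nodes(2) invariant_start nodes(1)] by blast
  from e(1) have "users e = {..<n}" "facs e = {..<m}" "entry_ok [] e"
    unfolding invariant_def by simp_all
  then have s: "sound {..<n} {..<m} (fst (snd e))"
    unfolding entry_ok_def by metis
  have "([], [], M) \<in> set (fst (snd e))" using assms unfolding result_def e(2) by auto
  with s have "sound_config {..<n} {..<m} ([], [], M)" unfolding sound_def by blast
  then show "mset (map fst M) = mset_set {..<n}" "\<And>y. y \<in> set M \<Longrightarrow> snd y < m \<and> close (fst y) (snd y)"
    "\<And>j. j < m \<Longrightarrow> count (mset (map snd M)) j = 0 \<or> r \<le> count (mset (map snd M)) j"
    unfolding sound_config_def Let_def by auto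
qed

text \<open>The last entry comprises all users and facilities, so \<open>\<pi>\<close> leaves
  nothing over: the goal key is a pair of empty multisets, and a configuration with this key passes
  the filter in \<open>result\<close>.\<close>

theorem result_complete:
  assumes H shows "result \<noteq> []"
proof -
  obtain e where e: "invariant [] [e]" "foldl (step g) (map erase start) nodes = [erase e]"
    using invariant_foldl[OF nodes(2) invariant_start nodes(1)] by blast
  from e(1) have "users e = {..<n}" "facs e = {..<m}" "entry_ok [] e"
    unfolding invariant_def by simp_all
  then have s: "complete {..<n} {..<m} (fst (snd e))"
    using assms unfolding entry_ok_def by metis
  have *: "{i \<in> {..<n}. \<pi> i \<notin> {..<m}} = {}" "{i. i < n \<and> i \<notin> {..<n} \<and> \<pi> i \<in> {..<m}} = {}"
    using \<pi>[OF assms] by auto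
  obtain c where "c \<in> set (fst (snd e))" "key c = goal_key {} {}"
    using s unfolding complete_def * by blast
  then have "c \<in> set (fst (snd e))" "key c = ({#}, {#})"
    by (simp_all add: goal_key_def)
  then show ?thesis unfolding result_def e(2) key_def by (auto simp: filter_empty_conv)
qed

end

section \<open>Rounding\<close>

text \<open>A greedy maximal subset with gaps larger than \<open>\<delta>\<close>, replacing a grid,
  which would need division or rounding. The absolute value is split into two comparisons that the
  model can evaluate.\<close>

definition net :: "real \<Rightarrow> real list \<Rightarrow> real list" where
  "net \<delta> ds = foldl (\<lambda>G x. if \<exists>v\<in>set G. x - v \<le> \<delta> \<and> v - x \<le> \<delta> then G else x # G) [] ds"

text \<open>The initial value \<open>x\<close> is a mere default: a point of the list from which the
  net was built has a net point within \<open>\<delta>\<close>.\<close>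

definition round_to :: "real \<Rightarrow> real list \<Rightarrow> real \<Rightarrow> real" where
  "round_to \<delta> G x = foldl (\<lambda>a v. if x - v \<le> \<delta> \<and> v - x \<le> \<delta> then v else a) x G"

lemma net_cover:
  assumes "x \<in> set ds" "0 \<le> \<delta>" shows "\<exists>v\<in>set (net \<delta> ds). \<bar>x - v\<bar> \<le> \<delta>"
proof -
  let ?f = "\<lambda>G x. if \<exists>v\<in>set G. x - v \<le> \<delta> \<and> v - x \<le> \<delta> then G else x # G"
  have "set G \<subseteq> set (foldl ?f G ds) \<and> (\<forall>x\<in>set ds. \<exists>v\<in>set (foldl ?f G ds). x - v \<le> \<delta> \<and> v - x \<le> \<delta>)" for G
  proof (induction ds arbitrary: G)
    case (Cons y ds)
    define G' where "G' = ?f G y"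
    have "set G \<subseteq> set G'" "\<exists>v\<in>set G'. y - v \<le> \<delta> \<and> v - y \<le> \<delta>"
      using assms(2) by (auto simp: G'_def)
    moreover have "foldl ?f G (y # ds) = foldl ?f G' ds" by (simp add: G'_def)
    ultimately show ?case using Cons.IH[of G'] by (auto 0 3)
  qed simp
  from this[of "[]"] assms(1) obtain v where v: "v \<in> set (net \<delta> ds)" "x - v \<le> \<delta> \<and> v - x \<le> \<delta>"
    unfolding net_def by auto
  then have "\<bar>x - v\<bar> \<le> \<delta>" by linarith
  with v show ?thesis by blast
qed

lemma net_separated:
  assumes "v \<in> set (net \<delta> ds)" "w \<in> set (net \<delta> ds)" "v \<noteq> w" shows "\<delta> < \<bar>v - w\<bar>"
proof -
  let ?f = "\<lambda>G x. if \<exists>v\<in>set G. x - v \<le> \<delta> \<and> v - x \<le> \<delta> then G else x # G"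
  let ?sep = "\<lambda>G. \<forall>v\<in>set G. \<forall>w\<in>set G. v \<noteq> w \<longrightarrow> \<delta> < \<bar>v - w\<bar>"
  have "?sep G \<Longrightarrow> ?sep (foldl ?f G ds)" for G
  proof (induction ds arbitrary: G)
    case (Cons y ds)
    have "?sep (?f G y)"
    proof (cases "\<exists>v\<in>set G. y - v \<le> \<delta> \<and> v - y \<le> \<delta>")
      case False
      then have "\<delta> < \<bar>y - v\<bar> \<and> \<delta> < \<bar>v - y\<bar>" if "v \<in> set G" for v
        using that by (force simp: abs_if)
      with False Cons.prems show ?thesis by simp
    qed (use Cons.prems in simp)
    from Cons.IH[OF this] show ?case by simp
  qed simp
  from this[of "[]"] assms show ?thesis unfolding net_def by auto
qed

lemma round_to:
  assumes "x \<in> set ds" "0 \<le> \<delta>"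
  shows "round_to \<delta> (net \<delta> ds) x \<in> set (net \<delta> ds) \<and> \<bar>round_to \<delta> (net \<delta> ds) x - x\<bar> \<le> \<delta>"
proof -
  let ?f = "\<lambda>a v. if x - v \<le> \<delta> \<and> v - x \<le> \<delta> then v else a"
  have "(\<exists>v\<in>set G. x - v \<le> \<delta> \<and> v - x \<le> \<delta>) \<or> a \<in> A \<and> x - a \<le> \<delta> \<and> a - x \<le> \<delta> \<Longrightarrow> set G \<subseteq> A \<Longrightarrow>
      foldl ?f a G \<in> A \<and> x - foldl ?f a G \<le> \<delta> \<and> foldl ?f a G - x \<le> \<delta>" for a A G
    by (induction G arbitrary: a) auto
  moreover obtain v where "v \<in> set (net \<delta> ds)" "\<bar>x - v\<bar> \<le> \<delta>" using net_cover[OF assms] by blast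
  ultimately have "foldl ?f x (net \<delta> ds) \<in> set (net \<delta> ds) \<and> x - foldl ?f x (net \<delta> ds) \<le> \<delta> \<and>
      foldl ?f x (net \<delta> ds) - x \<le> \<delta>"
    by (auto simp: abs_le_iff)
  then show ?thesis unfolding round_to_def by (simp add: abs_le_iff)
qed

text \<open>Removing the minimum raises the lower end of the interval by \<open>\<delta>\<close>,
  which lowers \<open>k\<close> by one. The case \<open>\<delta> = 0\<close> is included, since a
  distance bound of 0 leads to that rounding error.\<close>

lemma card_separated:
  fixes A :: "real set"
  assumes "finite A" "\<And>v w. v \<in> A \<Longrightarrow> w \<in> A \<Longrightarrow> v \<noteq> w \<Longrightarrow> \<delta> < \<bar>v - w\<bar>"
    and "\<And>v. v \<in> A \<Longrightarrow> lo \<le> v \<and> v \<le> lo + real k * \<delta>" and "0 \<le> \<delta>"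
  shows "card A \<le> k + 1"
  using assms(1-3)
proof (induction k arbitrary: A lo)
  case 0
  then have "A \<subseteq> {lo}" by force
  then show ?case using card_mono[of "{lo}" A] by simp
next
  case (Suc k)
  show ?case
  proof (cases "A = {}")
    case False
    let ?m = "Min A"
    have m: "?m \<in> A" "\<And>v. v \<in> A \<Longrightarrow> ?m \<le> v" using Suc.prems(1) False by auto
    have "card (A - {?m}) \<le> k + 1"
    proof (rule Suc.IH)
      fix v assume v: "v \<in> A - {?m}"
      have "\<delta> < \<bar>v - ?m\<bar>" using Suc.prems(2)[of v ?m] v m(1) by blast
      then have "?m + \<delta> < v" using m(2)[of v] v by auto
      moreover have "lo \<le> ?m" "v \<le> lo + real (Suc k) * \<delta>" using Suc.prems(3) m(1) v by blast+
      ultimately show "lo + \<delta> \<le> v \<and> v \<le> (lo + \<delta>) + real k * \<delta>" by (simp add: algebra_simps)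
    qed (use Suc.prems in auto)
    then show ?thesis using Suc.prems(1) m(1) by (simp add: card_Diff_singleton)
  qed simp
qed

lemma polytime_net [polytime_intros]:
  "polytime a \<Longrightarrow> polytime b \<Longrightarrow> polytime (\<lambda>x. net (a x) (b x))"
  by (rule polytime2, unfold net_def, rule polytime_foldl[where b = "[:2:]"])
    (intro polytime_intros | simp)+

lemma polytime_round_to [polytime_intros]:
  "polytime a \<Longrightarrow> polytime b \<Longrightarrow> polytime c \<Longrightarrow> polytime (\<lambda>x. round_to (a x) (b x) (c x))"
  by (rule polytime3, unfold round_to_def, rule polytime_foldl[where b = "[:2:]"])
    (intro polytime_intros | simp)+

section \<open>Gathering on a rooted tree with a given distance bound\<close>

text \<open>A power of \<open>length N + 1\<close> written in unary, polynomial because the exponent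
  is fixed; it serves as the cap on table sizes.\<close>

primrec unary_power :: "nat \<Rightarrow> nat list \<Rightarrow> nat list" where
  "unary_power 0 N = [0]"
| "unary_power (Suc k) N = concat (map (\<lambda>_. unary_power k N) (0 # N))"

lemma length_unary_power: "length (unary_power k N) = (length N + 1) ^ k"
  by (induction k) (simp_all add: length_concat comp_def sum_list_triv)

type_synonym point = "(nat \<times> nat) \<times> real"

text \<open>In units of \<open>\<delta>\<close>, a given assignment within \<open>M + 1\<close> is
  within \<open>M + 3\<close> after two roundings. The window from \<open>d - \<delta>\<close> to
  \<open>d + \<theta>\<close> then has width \<open>M + 4\<close> and contains at most
  \<open>M + 5\<close> net points, and undoing the roundings leaves solutions within
  \<open>M + 5\<close>. The exponent has a factor 2 since a key is a pair of multisets.\<close>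

definition solve :: "nat \<Rightarrow> nat \<Rightarrow> real \<Rightarrow> link list \<Rightarrow>
    point list \<Rightarrow> point list \<Rightarrow> (nat \<times> nat) list list" where
  "solve M r \<delta> nodes us fs =
     map (\<lambda>c. snd (snd c)) (filter (\<lambda>c. fst c = [] \<and> fst (snd c) = []) (concat (map snd
       (foldl (step ([0..<length us], unary_power (2 * (M + 5)) [0..<length us], real (M + 3) * \<delta>, \<delta>))
         (map (\<lambda>z. (fst (snd z),
             [([(fst z, round_to \<delta> (net \<delta> (map snd us @ map snd fs)) (snd (snd z)))], [], [])]))
           (List.enumerate 0 us) @
          map (\<lambda>z. (fst (snd z), facility_table r [0..<length us]
             (fst z, round_to \<delta> (net \<delta> (map snd us @ map snd fs)) (snd (snd z)))))
           (List.enumerate 0 fs))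
         nodes))))"

lemma polytime_unary_power: "polytime (unary_power k)"
proof (induction k)
  case 0
  show ?case unfolding unary_power.simps by (intro polytime_intros)
next
  case (Suc k)
  show ?case unfolding unary_power.simps
    by (intro polytime_intros polytime_comp[OF Suc.IH])
qed

lemma polytime_facility_table [polytime_intros]:
  "polytime a \<Longrightarrow> polytime b \<Longrightarrow> polytime c \<Longrightarrow> polytime (\<lambda>x. facility_table (a x) (b x) (c x))"
  by (rule polytime3, unfold facility_table_def) (intro polytime_intros)

lemma polytime_solve:
  assumes "polytime r" "polytime \<delta>" "polytime nodes" "polytime us" "polytime fs"
  shows "polytime (\<lambda>x. solve M (r x) (\<delta> x) (nodes x) (us x) (fs x))"
proof -
  have "polytime (\<lambda>z. solve M (fst z) (fst (snd z)) (fst (snd (snd z))) (fst (snd (snd (snd z)))) (snd (snd (snd (snd z)))))"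
    unfolding solve_def
    by (intro polytime_intros polytime_foldl_step polytime_comp[OF polytime_unary_power] polytime_const_mult)
  from polytime_comp[OF this polytime_Pair[OF assms(1) polytime_Pair[OF assms(2)
        polytime_Pair[OF assms(3) polytime_Pair[OF assms(4,5)]]]]]
  show ?thesis by simp
qed

lemma map_enumerate: "map f (List.enumerate 0 xs) = map (\<lambda>i. f (i, xs ! i)) [0..<length xs]"
  by (rule nth_equalityI) (simp_all add: nth_enumerate_eq)

locale gathering_instance =
  fixes M r :: nat and \<delta> :: real and nodes :: "link list"
    and us fs :: "point list"
  assumes \<delta>: "0 \<le> \<delta>" and nodes: "ordered nodes" "nodes \<noteq> []"
    and us: "p \<in> set us \<Longrightarrow> fst p \<in> fst ` set nodes" "p \<in> set us \<Longrightarrow> z \<in> up nodes (fst p) \<Longrightarrow> snd z \<le> snd p"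
    and fs: "p \<in> set fs \<Longrightarrow> fst p \<in> fst ` set nodes" "p \<in> set fs \<Longrightarrow> z \<in> up nodes (fst p) \<Longrightarrow> snd z \<le> snd p"
begin

definition reaches :: "real \<Rightarrow> nat \<Rightarrow> nat \<Rightarrow> bool" where
  "reaches c i j \<longleftrightarrow> (\<exists>z\<in>up nodes (fst (us ! i)) \<inter> up nodes (fst (fs ! j)).
     snd (us ! i) + snd (fs ! j) - 2 * snd z \<le> c)"

abbreviation "G \<equiv> net \<delta> (map snd us @ map snd fs)"

lemma solve_spec:
  assumes \<pi>: "H \<Longrightarrow> gathering_feasible {..<length us} {..<length fs} r \<pi>"
    and reach: "\<And>i. H \<Longrightarrow> i < length us \<Longrightarrow> reaches (real (M + 1) * \<delta>) i (\<pi> i)"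
  shows "m \<in> set (solve M r \<delta> nodes us fs) \<Longrightarrow> mset (map fst m) = mset_set {..<length us} \<and>
      (\<forall>y\<in>set m. snd y < length fs \<and> reaches (real (M + 5) * \<delta>) (fst y) (snd y)) \<and>
      (\<forall>j<length fs. count (mset (map snd m)) j = 0 \<or> r \<le> count (mset (map snd m)) j)"
    and "H \<Longrightarrow> solve M r \<delta> nodes us fs \<noteq> []"
proof -
  \<comment> \<open>The choice is made under \<open>H\<close>, which yields a total function
    \<open>w\<close> for the locale also when no assignment is given.\<close>
  have "\<exists>z. H \<longrightarrow> i < length us \<longrightarrow> z \<in> up nodes (fst (us ! i)) \<inter> up nodes (fst (fs ! \<pi> i)) \<and>
      snd (us ! i) + snd (fs ! \<pi> i) - 2 * snd z \<le> real (M + 1) * \<delta>" for i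
    using reach[of i] unfolding reaches_def by metis
  then obtain w where w: "\<And>i. H \<Longrightarrow> i < length us \<Longrightarrow> w i \<in> up nodes (fst (us ! i)) \<inter> up nodes (fst (fs ! \<pi> i)) \<and>
      snd (us ! i) + snd (fs ! \<pi> i) - 2 * snd (w i) \<le> real (M + 1) * \<delta>"
    by metis
  interpret dp: gathering_dp "length us" "length fs" r "M + 5" "[0..<length us]"
    "unary_power (2 * (M + 5)) [0..<length us]" "real (M + 3) * \<delta>" \<delta> "set G"
    "\<lambda>i. round_to \<delta> G (snd (us ! i))" "\<lambda>j. round_to \<delta> G (snd (fs ! j))"
    "\<lambda>i. snd (us ! i)" "\<lambda>j. snd (fs ! j)" "\<lambda>i. fst (us ! i)" "\<lambda>j. fst (fs ! j)" nodes H \<pi> w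
  proof
    show "(length us + 1) ^ (2 * (M + 5)) \<le> length (unary_power (2 * (M + 5)) [0..<length us])"
      by (simp only: length_unary_power length_upt diff_zero)
    show "card {v \<in> set G. d - \<delta> \<le> v \<and> v \<le> d + real (M + 3) * \<delta>} \<le> M + 5" for d
    proof -
      have "card {v \<in> set G. d - \<delta> \<le> v \<and> v \<le> d + real (M + 3) * \<delta>} \<le> (M + 4) + 1"
        by (rule card_separated[where \<delta> = \<delta> and lo = "d - \<delta>"])
          (auto intro: net_separated simp: \<delta> algebra_simps)
      then show ?thesis by simp
    qed
    show "\<pi> i < length fs" if H "i < length us" for i
      using \<pi>[OF that(1)] that(2) unfolding gathering_feasible_def by auto
    show "w i \<in> up nodes (fst (us ! i)) \<inter> up nodes (fst (fs ! \<pi> i)) \<and>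
       snd (us ! i) + snd (fs ! \<pi> i) - 2 * snd (w i) + 2 * \<delta> \<le> real (M + 3) * \<delta>" if H "i < length us" for i
      using w[OF that] by (simp add: algebra_simps)
    show "card {i. i < length us \<and> \<pi> i = j} = 0 \<or> r \<le> card {i. i < length us \<and> \<pi> i = j}"
      if H "j < length fs" for j
      using \<pi>[OF that(1)] that(2) unfolding gathering_feasible_def by auto
  qed (use \<delta> nodes us fs in \<open>auto intro!: round_to\<close>)
  have eq: "solve M r \<delta> nodes us fs = dp.result"
    unfolding solve_def dp.result_def dp.start_def map_enumerate by (simp add: comp_def)
  have close: "dp.close i j \<Longrightarrow> reaches (real (M + 5) * \<delta>) i j" for i j
    unfolding dp.close_def reaches_def by (simp add: algebra_simps)
  show "m \<in> set (solve M r \<delta> nodes us fs) \<Longrightarrow> mset (map fst m) = mset_set {..<length us} \<and>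
      (\<forall>y\<in>set m. snd y < length fs \<and> reaches (real (M + 5) * \<delta>) (fst y) (snd y)) \<and>
      (\<forall>j<length fs. count (mset (map snd m)) j = 0 \<or> r \<le> count (mset (map snd m)) j)"
    unfolding eq using dp.result_sound close by metis
  show "H \<Longrightarrow> solve M r \<delta> nodes us fs \<noteq> []"
    unfolding eq by (rule dp.result_complete)
qed

end

section \<open>Reading an assignment off a list of pairs\<close>

definition assigned :: "(nat \<times> nat) list \<Rightarrow> nat \<Rightarrow> nat" where
  "assigned m i = foldl (\<lambda>a y. if fst y = i then snd y else a) 0 m"

lemma assigned_eq:
  assumes "distinct (map fst m)" "(i, j) \<in> set m" shows "assigned m i = j"
proof -
  have "i \<notin> fst ` set m \<Longrightarrow> foldl (\<lambda>a y. if fst y = i then snd y else a) b m = b" for b and m :: "(nat \<times> nat) list"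
    by (induction m arbitrary: b) auto
  then have "foldl (\<lambda>a y. if fst y = i then snd y else a) b m = j" for b
    using assms by (induction m arbitrary: b) (auto simp: image_iff)
  then show ?thesis unfolding assigned_def .
qed

lemma polytime_assigned [polytime_intros]:
  "polytime a \<Longrightarrow> polytime b \<Longrightarrow> polytime (\<lambda>x. assigned (a x) (b x))"
  by (rule polytime2, unfold assigned_def, rule polytime_foldl[where b = "[:1:]"])
    (intro polytime_intros | simp)+

text \<open>Each user occurs exactly once as a first component, so the list is the graph of a
  function, and counting second components gives the loads.\<close>

lemma assigned_graph:
  assumes "mset (map fst m) = mset_set {..<n}"
  shows "distinct (map fst m)" "set m = (\<lambda>i. (i, assigned m i)) ` {..<n}"
    "count (mset (map snd m)) j = card {i\<in>{..<n}. assigned m i = j}"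
proof -
  have m: "mset (map fst m) = mset [0..<n]" using assms by (simp add: lessThan_atLeast0)
  then show d: "distinct (map fst m)" by (metis distinct_upt mset_eq_imp_distinct_iff)
  have "set (map fst m) = {..<n}" using m by (metis atLeast_upt mset_eq_setD)
  have s: "snd y = assigned m (fst y)" if "y \<in> set m" for y
    using assigned_eq[OF d, of "fst y" "snd y"] that by simp
  have "set m = (\<lambda>y. (fst y, assigned m (fst y))) ` set m"
    using s by (force simp: image_iff prod_eq_iff)
  also have "\<dots> = (\<lambda>i. (i, assigned m i)) ` set (map fst m)"
    by (simp add: image_image)
  finally show "set m = (\<lambda>i. (i, assigned m i)) ` {..<n}"
    unfolding \<open>set (map fst m) = {..<n}\<close> .
  have "map snd m = map (assigned m) (map fst m)"
    using s by simp
  then have "mset (map snd m) = image_mset (assigned m) (mset (map fst m))"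
    by (metis mset_map)
  then show "count (mset (map snd m)) j = card {i\<in>{..<n}. assigned m i = j}"
  proof -
    assume *: "mset (map snd m) = image_mset (assigned m) (mset (map fst m))"
    have "count (mset (map snd m)) j = (\<Sum>i | i < n \<and> j = assigned m i. count (mset_set {..<n}) i)"
      unfolding * assms count_image_mset' by simp
    also have "\<dots> = (\<Sum>i | i < n \<and> j = assigned m i. 1)"
      by (intro sum.cong) auto
    also have "\<dots> = card {i\<in>{..<n}. assigned m i = j}"
      by (simp add: eq_commute)
    finally show ?thesis .
  qed
qed

context gathering_instance
begin

lemma solve_sound:
  assumes "m \<in> set (solve M r \<delta> nodes us fs)"
  shows "gathering_feasible {..<length us} {..<length fs} r (assigned m)"
    and "i < length us \<Longrightarrow> reaches (real (M + 5) * \<delta>) i (assigned m i)"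
proof -
  have spec: "mset (map fst m) = mset_set {..<length us} \<and>
      (\<forall>y\<in>set m. snd y < length fs \<and> reaches (real (M + 5) * \<delta>) (fst y) (snd y)) \<and>
      (\<forall>j<length fs. count (mset (map snd m)) j = 0 \<or> r \<le> count (mset (map snd m)) j)"
    by (rule solve_spec(1)[of False "\<lambda>_. 0", OF _ _ assms]) simp_all
  note a = assigned_graph[OF conjunct1[OF spec]]
  have i: "(i, assigned m i) \<in> set m" if "i < length us" for i
    using that unfolding a(2) by simp
  have count: "count (mset (map snd m)) j = 0 \<or> r \<le> count (mset (map snd m)) j" if "j < length fs" for j
    using spec that by simp
  have pair: "assigned m i < length fs \<and> reaches (real (M + 5) * \<delta>) i (assigned m i)" if "i < length us" for i
    using conjunct1[OF conjunct2[OF spec]] i[OF that] by fastforce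
  then show "i < length us \<Longrightarrow> reaches (real (M + 5) * \<delta>) i (assigned m i)" by blast
  show "gathering_feasible {..<length us} {..<length fs} r (assigned m)"
    unfolding gathering_feasible_def using pair count unfolding a(3) by simp
qed

lemma solve_complete:
  assumes "gathering_feasible {..<length us} {..<length fs} r \<pi>"
    and "\<And>i. i < length us \<Longrightarrow> reaches (real (M + 1) * \<delta>) i (\<pi> i)"
  shows "solve M r \<delta> nodes us fs \<noteq> []"
  using assms by (intro solve_spec(2)[of True]) simp_all

end

section \<open>Rooting a tree\<close>

text \<open>A rooted tree is a list of tuples of a vertex, its parent, its depth and the depth of its
  parent, children before parents. The root is its own parent.\<close>

type_synonym node = "nat \<times> nat \<times> real \<times> real"

inductive rooted :: "nat wtree \<Rightarrow> node list \<Rightarrow> bool" for T where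
  root: "v \<in> verts T \<Longrightarrow> rooted T [(v, v, 0, 0)]"
| child: "rooted T ns \<Longrightarrow> (u, p, d, e) \<in> set ns \<Longrightarrow> {u, v} \<in> edges T \<Longrightarrow> v \<notin> fst ` set ns \<Longrightarrow>
    rooted T ((v, u, d + len T {u, v}, d) # ns)"

abbreviation names :: "node list \<Rightarrow> nat set" where "names ns \<equiv> fst ` set ns"

text \<open>Forgetting the depth of the parent gives a list for \<open>up\<close>. The root may name
  itself as parent because \<open>up\<close> continues only in the rest of the list.\<close>

definition parents :: "node list \<Rightarrow> (nat \<times> nat \<times> real) list" where
  "parents ns = map (\<lambda>x. (fst x, fst (snd x), fst (snd (snd x)))) ns"

lemma parents_Cons: "parents ((v, u, d, e) # ns) = (v, u, d) # parents ns"
  by (simp add: parents_def)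

section \<open>Paths and distances in a rooted tree\<close>

lemma is_path_alt:
  "is_path T v p w \<longleftrightarrow> p \<noteq> [] \<and> hd p = v \<and> last p = w \<and> distinct p \<and> set p \<subseteq> verts T \<and>
     successively (\<lambda>a b. {a, b} \<in> edges T) p"
  unfolding is_path_def successively_conv_nth by blast

lemma is_path_Cons:
  "is_path T v (x # p) w \<longleftrightarrow> x = v \<and> v \<in> verts T \<and>
     (p = [] \<and> w = v \<or> p \<noteq> [] \<and> {v, hd p} \<in> edges T \<and> v \<notin> set p \<and> is_path T (hd p) p w)"
  unfolding is_path_alt by (cases p) auto

lemma is_path_rev: "is_path T v (rev p) w \<longleftrightarrow> is_path T w p v"
  unfolding is_path_alt by (auto simp: hd_rev last_rev successively_rev insert_commute)

lemma is_path_ends: "is_path T v p w \<Longrightarrow> v \<in> set p \<and> w \<in> set p"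
  unfolding is_path_alt by auto

lemma path_len_Cons: "p \<noteq> [] \<Longrightarrow> path_len T (x # p) = len T {x, hd p} + path_len T p"
proof -
  assume "p \<noteq> []"
  then obtain y q where p: "p = y # q" by (cases p) auto
  show ?thesis unfolding path_len_def p by (simp add: sum.lessThan_Suc_shift del: sum.lessThan_Suc)
qed

lemma path_len_snoc: "p \<noteq> [] \<Longrightarrow> path_len T (p @ [x]) = path_len T p + len T {last p, x}"
proof (induction p)
  case (Cons y p)
  show ?case
  proof (cases "p = []")
    case True
    then show ?thesis by (simp add: path_len_def)
  next
    case False
    then show ?thesis using Cons.IH by (simp add: path_len_Cons)
  qed
qed simp

lemma path_len_single: "path_len T [x] = 0"
  by (simp add: path_len_def)

context
  fixes T :: "nat wtree"
  assumes T: "weighted_tree T"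
begin

lemma edge_verts: "{u, v} \<in> edges T \<Longrightarrow> u \<in> verts T \<and> v \<in> verts T \<and> u \<noteq> v"
  using T unfolding weighted_tree_def by (metis doubleton_eq_iff insert_absorb2)

lemma len_nonneg: "e \<in> edges T \<Longrightarrow> 0 \<le> len T e"
  using T unfolding weighted_tree_def by blast

lemma rooted_basic:
  assumes "rooted T ns"
  shows "names ns \<subseteq> verts T" "distinct (map fst ns)" "ns \<noteq> []"
    "(v, u, d, e) \<in> set ns \<Longrightarrow> 0 \<le> e \<and> e \<le> d \<and> u \<in> names ns"
proof -
  have "names ns \<subseteq> verts T \<and> distinct (map fst ns) \<and> ns \<noteq> [] \<and>
    (\<forall>v u d e. (v, u, d, e) \<in> set ns \<longrightarrow> 0 \<le> e \<and> e \<le> d \<and> u \<in> names ns)"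
    using assms
  proof (induction rule: rooted.induct)
    case (child ns u p d e v)
    have "0 \<le> d" using child.IH child.hyps(2) order_trans by blast
    moreover have "u \<in> names ns" using child.hyps(2) by force
    ultimately show ?case
      using child edge_verts[OF child.hyps(3)] len_nonneg[OF child.hyps(3)] by auto
  qed auto
  then show "names ns \<subseteq> verts T" "distinct (map fst ns)" "ns \<noteq> []"
    "(v, u, d, e) \<in> set ns \<Longrightarrow> 0 \<le> e \<and> e \<le> d \<and> u \<in> names ns" by blast+
qed

text \<open>Keeping the path within the vertices already reached guarantees that the next new vertex
  can be put in front of it.\<close>

lemma rooted_path:
  assumes "rooted T ns" "x \<in> names ns" "y \<in> names ns"
  shows "\<exists>p. is_path T x p y \<and> set p \<subseteq> names ns"
  using assms
proof (induction arbitrary: x y rule: rooted.induct)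
  case (root v)
  then show ?case by (intro exI[of _ "[v]"]) (auto simp: is_path_alt)
next
  case (child ns u p d e v)
  have u: "u \<in> names ns" using child.hyps(2) by force
  have v: "v \<in> verts T" "{v, u} \<in> edges T" using edge_verts child.hyps(3) by (auto simp: insert_commute)
  have up: "\<exists>p. is_path T v p y \<and> set p \<subseteq> insert v (names ns)" if "y \<in> names ns" for y
  proof -
    obtain p where p: "is_path T u p y" "set p \<subseteq> names ns" using child.IH[OF u \<open>y \<in> names ns\<close>] by blast
    then have "p \<noteq> []" "hd p = u" unfolding is_path_alt by auto
    moreover have "v \<notin> set p" using p(2) child.hyps(4) by blast
    ultimately have "is_path T v (v # p) y" using p(1) v by (simp add: is_path_Cons)
    with p(2) show ?thesis by (intro exI[of _ "v # p"]) auto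
  qed
  have down: "\<exists>p. is_path T y p v \<and> set p \<subseteq> insert v (names ns)" if "y \<in> names ns" for y
  proof -
    obtain p where "is_path T v p y" "set p \<subseteq> insert v (names ns)"
      using up[OF \<open>y \<in> names ns\<close>] by blast
    then show ?thesis by (intro exI[of _ "rev p"]) (simp add: is_path_rev)
  qed
  have "is_path T v [v] v" using v by (simp add: is_path_alt)
  then have vv: "\<exists>p. is_path T v p v \<and> set p \<subseteq> insert v (names ns)" by (intro exI[of _ "[v]"]) simp
  have both: "\<exists>p. is_path T x p y \<and> set p \<subseteq> insert v (names ns)" if "x \<in> names ns" "y \<in> names ns" for x y
    using child.IH[OF that] by (meson subset_insertI2)
  have "x = v \<or> x \<in> names ns" "y = v \<or> y \<in> names ns" using child.prems by auto
  then have "\<exists>p. is_path T x p y \<and> set p \<subseteq> insert v (names ns)"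
    using vv up down both by metis
  then show ?case by simp
qed

text \<open>A second edge from a new vertex into the part already reached would close a cycle.\<close>

lemma rooted_unique_edge:
  assumes ns: "rooted T ns" and u: "u \<in> names ns" and w: "w \<in> names ns" and v: "v \<notin> names ns"
    and e: "{u, v} \<in> edges T" "{w, v} \<in> edges T"
  shows "w = u"
proof (rule ccontr)
  assume "w \<noteq> u"
  obtain p where p: "is_path T u p w" "set p \<subseteq> names ns" using rooted_path[OF ns u w] by blast
  then have p': "p \<noteq> []" "hd p = u" "last p = w" unfolding is_path_alt by auto
  have "v \<notin> set p" using p(2) v by blast
  then have "is_path T v (v # p) w"
    using p(1) p' e edge_verts[OF e(1)] by (simp add: is_path_Cons insert_commute)
  moreover have "3 \<le> length (v # p)"
  proof (rule ccontr)
    assume "\<not> 3 \<le> length (v # p)"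
    then have "hd p = last p" using p'(1) by (cases p; cases "tl p") auto
    then show False using p' \<open>w \<noteq> u\<close> by simp
  qed
  ultimately have "is_cycle T (v # p)"
    using p' e(2) unfolding is_cycle_def by simp
  then show False using T unfolding weighted_tree_def by blast
qed

text \<open>The new vertex \<open>v\<close> has \<open>u\<close> as its only neighbour among the old
  ones. A path with \<open>v\<close> in its interior would visit \<open>u\<close> both before and
  after \<open>v\<close>, so \<open>v\<close> occurs at most at an end.\<close>

lemma rooted_path_cases:
  assumes ns: "rooted T ns" and u: "u \<in> names ns" and v: "v \<notin> names ns" "{u, v} \<in> edges T"
    and p: "is_path T x p y" "set p \<subseteq> insert v (names ns)"
  obtains "x \<in> names ns" "y \<in> names ns" "set p \<subseteq> names ns"
  | "x = v" "y = v" "p = [v]"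
  | q where "x = v" "y \<in> names ns" "p = v # q" "is_path T u q y" "set q \<subseteq> names ns"
  | q where "y = v" "x \<in> names ns" "p = q @ [v]" "is_path T x q u" "set q \<subseteq> names ns"
proof -
  have uniq: "w = u" if "w \<in> names ns" "{w, v} \<in> edges T" for w
    using rooted_unique_edge[OF ns u _ v(1) v(2)] that by blast
  have start: "\<exists>q. p = v # q \<and> is_path T u q y \<and> set q \<subseteq> names ns"
    if x: "is_path T v p y" "set p \<subseteq> insert v (names ns)" "y \<in> names ns" for p y
  proof -
    obtain q where q: "p = v # q" using x(1) unfolding is_path_alt by (cases p) auto
    have vy: "v \<noteq> y" using x(3) v(1) by blast
    then have q': "q \<noteq> []" "{v, hd q} \<in> edges T" "v \<notin> set q" "is_path T (hd q) q y"
      using x(1) unfolding q is_path_Cons by auto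
    have sq: "set q \<subseteq> names ns" using q'(3) x(2) q by auto
    have "hd q \<in> names ns" using sq q'(1) by (meson hd_in_set subsetD)
    then have "hd q = u" using uniq q'(2) by (simp add: insert_commute)
    with q q' sq show ?thesis by blast
  qed
  have xy: "x = v \<or> x \<in> names ns" "y = v \<or> y \<in> names ns"
    using is_path_ends[OF p(1)] p(2) by blast+
  show thesis
  proof (cases "x = v")
    case True
    show thesis
    proof (cases "y = v")
      case yv: True
      have "p = [v]"
      proof -
        obtain a q where q: "p = a # q" using p(1) unfolding is_path_alt by (cases p) auto
        have "q = []"
        proof (rule ccontr)
          assume "q \<noteq> []"
          then have "v \<notin> set q" "is_path T (hd q) q v" using p(1) True yv unfolding q is_path_Cons by auto
          then show False using is_path_ends[of T "hd q" q v] by simp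
        qed
        then show ?thesis using p(1) True unfolding q is_path_Cons by simp
      qed
      then show thesis using that(2) True yv by blast
    next
      case False
      then have "y \<in> names ns" using xy by blast
      then show thesis using start[of p y] p True that(3) by blast
    qed
  next
    case False
    then have x: "x \<in> names ns" using xy by blast
    show thesis
    proof (cases "y = v")
      case True
      then have "is_path T v (rev p) x" using p(1) by (simp add: is_path_rev)
      then obtain q where q: "rev p = v # q" "is_path T u q x" "set q \<subseteq> names ns"
        using start[of "rev p" x] p(2) x by auto
      then have "p = rev q @ [v]" by (simp add: rev_swap)
      then show thesis using that(4)[of "rev q"] True x q by (simp add: is_path_rev)
    next
      case yv: False
      then have y: "y \<in> names ns" using xy by blast
      have "v \<notin> set p"
      proof
        assume "v \<in> set p"
        then obtain a b where ab: "p = a @ v # b" by (meson split_list)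
        have a: "a \<noteq> []" using p(1) ab False unfolding is_path_alt by auto
        have b: "b \<noteq> []" using p(1) ab yv unfolding is_path_alt by auto
        have s: "successively (\<lambda>a b. {a, b} \<in> edges T) (a @ v # b)" "distinct (a @ v # b)"
          using p(1) ab unfolding is_path_alt by auto
        have "{last a, v} \<in> edges T" "{v, hd b} \<in> edges T"
          using s(1) a b by (auto simp: successively_append_iff successively_Cons)
        moreover have "last a \<in> names ns" "hd b \<in> names ns"
          using a b p(2) s(2) ab by (metis (no_types, lifting) Un_iff distinct.simps(2) distinct_append
              hd_in_set insertE last_in_set list.set_intros(2) set_append subsetD disjoint_iff list.set_intros(1))+
        moreover have "{hd b, v} = {v, hd b}" by (rule insert_commute)
        ultimately have "last a = u" "hd b = u" using uniq by metis+
        then have "u \<in> set a" "u \<in> set b" using a b last_in_set hd_in_set by metis+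
        then show False using s(2) by auto
      qed
      then show thesis using that(1) x y p(2) by blast
    qed
  qed
qed

lemma rooted_path_unique:
  assumes "rooted T ns" "is_path T x p y" "set p \<subseteq> names ns" "is_path T x q y" "set q \<subseteq> names ns"
  shows "p = q"
  using assms
proof (induction arbitrary: x y p q rule: rooted.induct)
  case (root v)
  have *: "r = [v]" if r: "is_path T x r y" "set r \<subseteq> {v}" for r
  proof -
    obtain a r' where "r = a # r'" using r(1) unfolding is_path_alt by (cases r) auto
    with r show ?thesis unfolding is_path_alt by (cases r') auto
  qed
  show ?case
    using *[OF root.prems(1)] *[OF root.prems(3)] root.prems(2,4) by simp
next
  case (child ns u p' d e v)
  have u: "u \<in> names ns" using child.hyps(2) by force
  have sub: "set p \<subseteq> insert v (names ns)" "set q \<subseteq> insert v (names ns)" using child.prems by auto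
  note cases = rooted_path_cases[OF child.hyps(1) u child.hyps(4,3)]
  show ?case
    using child.hyps(4) child.IH
    by (rule_tac cases[OF child.prems(1) sub(1)]; rule_tac cases[OF child.prems(3) sub(2)])
      (use child.prems in auto)
qed

lemma rooted_up_names: "z \<in> up (parents ns) x \<Longrightarrow> fst z \<in> names ns"
  using up_names[of z "parents ns" x] by (simp add: parents_def image_image)

lemma rooted_up_le:
  assumes "rooted T ns" "(x, u, d, e) \<in> set ns" "z \<in> up (parents ns) x"
  shows "0 \<le> snd z \<and> snd z \<le> d"
  using assms
proof (induction arbitrary: x u d e rule: rooted.induct)
  case (child ns u' p d' e' v)
  have d': "0 \<le> d'" using rooted_basic(4)[OF child.hyps(1,2)] by linarith
  have l: "0 \<le> len T {u', v}" by (rule len_nonneg[OF child.hyps(3)])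
  show ?case
  proof (cases "x = v")
    case True
    then have "d = d' + len T {u', v}" using child.prems(1) child.hyps(4) by force
    moreover have "z = (v, d' + len T {u', v}) \<or> z \<in> up (parents ns) u'"
      using child.prems(2) True by (simp add: parents_Cons)
    ultimately show ?thesis using child.IH[OF child.hyps(2)] d' l by force
  next
    case False
    then show ?thesis using child.IH[of x u d e] child.prems by (simp add: parents_Cons)
  qed
qed (auto simp: parents_def)

text \<open>Induction removes the newest leaf. The lowest common ancestor is not defined explicitly;
  it is where the minimum over all common ancestors is attained.\<close>

lemma rooted_path_len:
  assumes "rooted T ns" "(x, ux, dx, ex) \<in> set ns" "(y, uy, dy, ey) \<in> set ns"
    "is_path T x p y" "set p \<subseteq> names ns"
  shows "(\<forall>z\<in>up (parents ns) x \<inter> up (parents ns) y. path_len T p \<le> dx + dy - 2 * snd z) \<and>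
    (\<exists>z\<in>up (parents ns) x \<inter> up (parents ns) y. path_len T p = dx + dy - 2 * snd z)"
  using assms
proof (induction arbitrary: x ux dx ex y uy dy ey p rule: rooted.induct)
  case (root v)
  obtain a r' where "p = a # r'" using root.prems(3) unfolding is_path_alt by (cases p) auto
  then have "p = [v]" using root.prems(3,4) unfolding is_path_alt by (cases r') auto
  then show ?case using root.prems by (simp add: parents_def path_len_single)
next
  case (child ns u p' d e v)
  have u: "u \<in> names ns" using child.hyps(2) by force
  let ?l = "len T {u, v}"
  let ?up = "up (parents ns)"
  have up_v: "up (parents ((v, u, d + ?l, d) # ns)) v = insert (v, d + ?l) (?up u)"
    and up_x: "\<And>x. x \<noteq> v \<Longrightarrow> up (parents ((v, u, d + ?l, d) # ns)) x = ?up x"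
    by (simp_all add: parents_Cons)
  have not_up: "(v, d + ?l) \<notin> ?up x" for x
    using rooted_up_names[of "(v, d + ?l)" ns x] child.hyps(4) by auto
  have old: "(x, a) \<in> set ns" if "(x, a) \<in> set ((v, u, d + ?l, d) # ns)" "x \<in> names ns" for x a
    using that child.hyps(4) by auto
  have new: "a = (u, d + ?l, d)" if "(v, a) \<in> set ((v, u, d + ?l, d) # ns)" for a
    using that child.hyps(4) by force
  have sub: "set p \<subseteq> insert v (names ns)" using child.prems(4) by simp
  show ?case
  proof (rule rooted_path_cases[OF child.hyps(1) u child.hyps(4,3) child.prems(3) sub])
    assume a: "x \<in> names ns" "y \<in> names ns" "set p \<subseteq> names ns"
    then have ne: "x \<noteq> v" "y \<noteq> v" using child.hyps(4) by auto
    show ?thesis unfolding up_x[OF ne(1)] up_x[OF ne(2)]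
      by (rule child.IH[OF old[OF child.prems(1) a(1)] old[OF child.prems(2) a(2)] child.prems(3) a(3)])
  next
    assume a: "x = v" "y = v" "p = [v]"
    have d: "dx = d + ?l" "dy = d + ?l" using new child.prems(1,2) a by auto
    have "2 * snd z \<le> 2 * d + 2 * ?l" if "z \<in> ?up u" for z
      using rooted_up_le[OF child.hyps(1,2) that] len_nonneg[OF child.hyps(3)] by linarith
    then show ?thesis unfolding a up_v d by (auto simp: path_len_single)
  next
    fix q assume a: "x = v" "y \<in> names ns" "p = v # q" "is_path T u q y" "set q \<subseteq> names ns"
    have d: "dx = d + ?l" using new child.prems(1) a by auto
    have ne: "y \<noteq> v" using a(2) child.hyps(4) by auto
    have q: "q \<noteq> []" "hd q = u" using a(4) unfolding is_path_alt by auto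
    have pl: "path_len T p = ?l + path_len T q" using q a(3) by (simp add: path_len_Cons insert_commute)
    \<comment> \<open>The new leaf is an ancestor of no old vertex, so passing from it to its parent
      \<open>u\<close> leaves the common ancestors unchanged.\<close>
    have int: "insert (v, d + ?l) (?up u) \<inter> ?up y = ?up u \<inter> ?up y" using not_up by auto
    have "(\<forall>z\<in>?up u \<inter> ?up y. path_len T q \<le> d + dy - 2 * snd z) \<and>
        (\<exists>z\<in>?up u \<inter> ?up y. path_len T q = d + dy - 2 * snd z)"
      by (rule child.IH[OF child.hyps(2) old[OF child.prems(2) a(2)] a(4,5)])
    then show ?thesis unfolding a(1) up_v up_x[OF ne] int pl d by (simp add: algebra_simps)
  next
    fix q assume a: "y = v" "x \<in> names ns" "p = q @ [v]" "is_path T x q u" "set q \<subseteq> names ns"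
    have d: "dy = d + ?l" using new child.prems(2) a by auto
    have ne: "x \<noteq> v" using a(2) child.hyps(4) by auto
    have q: "q \<noteq> []" "last q = u" using a(4) unfolding is_path_alt by auto
    have pl: "path_len T p = ?l + path_len T q" using q a(3) by (simp add: path_len_snoc)
    have int: "?up x \<inter> insert (v, d + ?l) (?up u) = ?up x \<inter> ?up u" using not_up by auto
    have "(\<forall>z\<in>?up x \<inter> ?up u. path_len T q \<le> dx + d - 2 * snd z) \<and>
        (\<exists>z\<in>?up x \<inter> ?up u. path_len T q = dx + d - 2 * snd z)"
      by (rule child.IH[OF old[OF child.prems(1) a(2)] child.hyps(2) a(4,5)])
    then show ?thesis unfolding a(1) up_v up_x[OF ne] int pl d by (simp add: algebra_simps)
  qed
qed

lemma tree_dist_up: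
  assumes ns: "rooted T ns" "names ns = verts T"
    and x: "(x, ux, dx, ex) \<in> set ns" and y: "(y, uy, dy, ey) \<in> set ns"
  shows "z \<in> up (parents ns) x \<inter> up (parents ns) y \<Longrightarrow> tree_dist T x y \<le> dx + dy - 2 * snd z"
    and "\<exists>z\<in>up (parents ns) x \<inter> up (parents ns) y. tree_dist T x y = dx + dy - 2 * snd z"
proof -
  have xy: "x \<in> names ns" "y \<in> names ns" using x y by force+
  then obtain p where p: "is_path T x p y" "set p \<subseteq> names ns" using rooted_path[OF ns(1)] by blast
  have "(THE p. is_path T x p y) = p"
  proof (rule the_equality[where P = "\<lambda>p. is_path T x p y", OF p(1)])
    fix q assume q: "is_path T x q y"
    then have "set q \<subseteq> names ns" unfolding ns(2) is_path_def by blast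
    then show "q = p" by (rule rooted_path_unique[OF ns(1) q _ p])
  qed
  then have "tree_dist T x y = path_len T p" unfolding tree_dist_def by simp
  then show "z \<in> up (parents ns) x \<inter> up (parents ns) y \<Longrightarrow> tree_dist T x y \<le> dx + dy - 2 * snd z"
    "\<exists>z\<in>up (parents ns) x \<inter> up (parents ns) y. tree_dist T x y = dx + dy - 2 * snd z"
    using rooted_path_len[OF ns(1) x y p] by auto
qed

end

section \<open>Computing a rooted tree from lists of vertices and edges\<close>

definition candidates :: "(nat \<times> nat \<times> real) list \<Rightarrow> node list \<Rightarrow> node list" where
  "candidates es ns = concat (map (\<lambda>x. map (\<lambda>e. (fst (snd e), fst x, fst (snd (snd x)) + snd (snd e), fst (snd (snd x))))
     (filter (\<lambda>e. fst e = fst x \<and> \<not> (\<exists>y\<in>set ns. fst y = fst (snd e))) es)) ns)"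

definition grow :: "(nat \<times> nat \<times> real) list \<Rightarrow> node list \<Rightarrow> node list" where
  "grow es ns = (case candidates es ns of [] \<Rightarrow> ns | y # _ \<Rightarrow> y # ns)"

text \<open>The input lists every edge in one orientation, so the reversed edges are added. The fold
  over the vertices merely counts rounds, one per vertex.\<close>

definition root_tree :: "nat list \<times> (nat \<times> nat \<times> real) list \<Rightarrow> node list" where
  "root_tree t = foldl (\<lambda>ns _. grow (snd t @ map (\<lambda>e. (fst (snd e), fst e, snd (snd e))) (snd t)) ns)
     (case fst t of [] \<Rightarrow> [] | v # _ \<Rightarrow> [(v, v, 0, 0)]) (fst t)"

definition depth :: "node list \<Rightarrow> nat \<Rightarrow> real" where
  "depth ns x = foldl (\<lambda>a y. if fst y = x then fst (snd (snd y)) else a) 0 ns"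

lemma depth_eq:
  assumes "distinct (map fst ns)" "(x, u, d, e) \<in> set ns" shows "depth ns x = d"
proof -
  have "x \<notin> names ns \<Longrightarrow> foldl (\<lambda>a y. if fst y = x then fst (snd (snd y)) else a) b ns = b" for b and ns :: "node list"
    by (induction ns arbitrary: b) auto
  then have "foldl (\<lambda>a y. if fst y = x then fst (snd (snd y)) else a) b ns = d" for b
    using assms by (induction ns arbitrary: b) (auto simp: image_iff)
  then show ?thesis unfolding depth_def .
qed

lemma polytime_depth [polytime_intros]:
  "polytime a \<Longrightarrow> polytime b \<Longrightarrow> polytime (\<lambda>x. depth (a x) (b x))"
  by (rule polytime2, unfold depth_def, rule polytime_foldl[where b = "[:1:]"])
    (intro polytime_intros | simp)+

lemma polytime_grow [polytime_intros]:
  "polytime a \<Longrightarrow> polytime b \<Longrightarrow> polytime (\<lambda>x. grow (a x) (b x))"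
  by (rule polytime2, unfold grow_def candidates_def) (intro polytime_intros)

text \<open>A node has encoded size 7, and its list cell adds one.\<close>

lemma esize_grow: "esize (grow es ns) \<le> esize ns + 8"
proof -
  have "esize y = 7" for y :: node by (cases y) auto
  then show ?thesis unfolding grow_def by (simp split: list.split)
qed

lemma polytime_root_tree [polytime_intros]:
  assumes "polytime a" shows "polytime (\<lambda>x. root_tree (a x))"
proof (rule polytime_comp[OF _ assms], unfold root_tree_def, rule polytime_foldl[where b = "[:8:]"])
  show "esize (grow es a) \<le> esize a + poly [:8:] k" for es a k
    using esize_grow[of es a] by simp
qed (intro polytime_intros)+

definition edge_list :: "nat wtree \<Rightarrow> (nat \<times> nat) list \<Rightarrow> (nat \<times> nat \<times> real) list" where
  "edge_list T es = map (\<lambda>(u, v). (u, v, len T {u, v})) es"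

lemma in_candidates:
  "y \<in> set (candidates es ns) \<longleftrightarrow> (\<exists>x\<in>set ns. \<exists>a\<in>set es. fst a = fst x \<and> fst (snd a) \<notin> names ns \<and>
     y = (fst (snd a), fst x, fst (snd (snd x)) + snd (snd a), fst (snd (snd x))))"
proof -
  have *: "(\<forall>y\<in>set ns. fst y \<noteq> v) = (v \<notin> names ns)" for v
    by (metis imageE imageI)
  have **: "y \<in> f ` {a \<in> A. P a \<and> Q a} \<longleftrightarrow> (\<exists>a\<in>A. P a \<and> Q a \<and> y = f a)" for f P Q and A :: "(nat \<times> nat \<times> real) set"
    by blast
  show ?thesis unfolding candidates_def set_concat set_map set_filter UN_iff bex_simps image_image ** by (simp add: *)
qed

text \<open>When no candidate is left, the vertices reached are closed under adjacency, and
  connectedness makes them all of the tree.\<close>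

lemma grow_rooted:
  assumes T: "weighted_tree T" and es: "(\<lambda>(u, v). {u, v}) ` set es = edges T"
    and ns: "rooted T ns"
    and es': "es' = edge_list T es @ map (\<lambda>e. (fst (snd e), fst e, snd (snd e))) (edge_list T es)"
  shows "rooted T (grow es' ns)" "names (grow es' ns) = verts T \<or> length (grow es' ns) = Suc (length ns)"
proof -
  have mem: "(u, v, l) \<in> set es' \<longleftrightarrow> ((u, v) \<in> set es \<or> (v, u) \<in> set es) \<and> l = len T {u, v}" for u v l
  proof -
    have 1: "(u, v, l) \<in> set (edge_list T es) \<longleftrightarrow> (u, v) \<in> set es \<and> l = len T {u, v}" for u v
      unfolding edge_list_def by auto
    have 2: "(u, v, l) \<in> (\<lambda>e. (fst (snd e), fst e, snd (snd e))) ` A \<longleftrightarrow> (v, u, l) \<in> A" for A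
      by force
    show ?thesis unfolding es' set_append set_map Un_iff 1 2 insert_commute[of v u] by blast
  qed
  have edge: "(u, v) \<in> set es \<or> (v, u) \<in> set es \<longleftrightarrow> {u, v} \<in> edges T" for u v
  proof -
    have "{u, v} \<in> (\<lambda>(u, v). {u, v}) ` set es \<longleftrightarrow> (\<exists>e\<in>set es. {u, v} = {fst e, snd e})"
      by (simp add: image_iff split_beta)
    also have "\<dots> \<longleftrightarrow> (u, v) \<in> set es \<or> (v, u) \<in> set es"
    proof -
      have "(\<exists>e\<in>A. {u, v} = {fst e, snd e}) \<longleftrightarrow> (\<exists>a b. (a, b) \<in> A \<and> {u, v} = {a, b})" for A
        by (metis fst_conv snd_conv prod.collapse)
      then show ?thesis unfolding doubleton_eq_iff by blast
    qed
    finally show ?thesis unfolding es by (rule sym)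
  qed
  have cand: "y \<in> set (candidates es' ns) \<Longrightarrow> rooted T (y # ns)" for y
  proof -
    assume "y \<in> set (candidates es' ns)"
    then obtain x a where xa: "x \<in> set ns" "a \<in> set es'" "fst a = fst x" "fst (snd a) \<notin> names ns"
      "y = (fst (snd a), fst x, fst (snd (snd x)) + snd (snd a), fst (snd (snd x)))"
      unfolding in_candidates by blast
    obtain u p d e where x': "x = (u, p, d, e)" by (cases x) auto
    have x: "(u, p, d, e) \<in> set ns" and a: "a \<in> set es'" "fst a = u"
      "fst (snd a) \<notin> names ns" "y = (fst (snd a), u, d + snd (snd a), d)"
      using xa unfolding x' by simp_all
    obtain v l where "a = (u, v, l)" using a(2) by (cases a) auto
    with a(1) have "{u, v} \<in> edges T" "l = len T {u, v}" using mem edge by auto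
    then show "rooted T (y # ns)" using rooted.child[OF ns x, of v] a \<open>a = (u, v, l)\<close> by simp
  qed
  show "rooted T (grow es' ns)"
  proof (cases "candidates es' ns")
    case (Cons y ys)
    then have "y \<in> set (candidates es' ns)" by simp
    from cand[OF this] Cons show ?thesis unfolding grow_def by simp
  qed (use ns in \<open>simp add: grow_def\<close>)
  show "names (grow es' ns) = verts T \<or> length (grow es' ns) = Suc (length ns)"
  proof (cases "candidates es' ns")
    case Nil
    have closed: "v \<in> names ns" if "u \<in> names ns" "{u, v} \<in> edges T" for u v
    proof (rule ccontr)
      assume v: "v \<notin> names ns"
      obtain p d e where x: "(u, p, d, e) \<in> set ns" using \<open>u \<in> names ns\<close> by auto
      have "(u, v, len T {u, v}) \<in> set es'" using that(2) mem edge by simp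
      then have "(v, u, d + len T {u, v}, d) \<in> set (candidates es' ns)"
        using x v unfolding in_candidates by (intro bexI[of _ "(u, p, d, e)"] bexI[of _ "(u, v, len T {u, v})"]) simp_all
      with Nil show False by simp
    qed
    obtain u where u: "u \<in> names ns" using rooted_basic(3)[OF T ns] by (cases ns) auto
    have "w \<in> names ns" if "w \<in> verts T" for w
    proof -
      have "u \<in> verts T" using rooted_basic(1)[OF T ns] u by blast
      then obtain p where "is_path T u p w" using T \<open>w \<in> verts T\<close> unfolding weighted_tree_def by blast
      moreover have "is_path T u p w \<Longrightarrow> u \<in> names ns \<Longrightarrow> w \<in> names ns" for u p
      proof (induction p arbitrary: u)
        case (Cons x p u)
        have c: "p = [] \<and> w = u \<or> p \<noteq> [] \<and> {u, hd p} \<in> edges T \<and> is_path T (hd p) p w"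
          using Cons.prems(1) unfolding is_path_Cons by blast
        then show ?case
        proof (elim disjE conjE)
          assume "{u, hd p} \<in> edges T" "is_path T (hd p) p w"
          with Cons.IH[of "hd p"] closed[OF Cons.prems(2), of "hd p"] show ?case by simp
        qed (use Cons.prems(2) in simp)
      qed (simp add: is_path_alt)
      ultimately show ?thesis using u by blast
    qed
    then have "names ns = verts T" using rooted_basic(1)[OF T ns] by blast
    then show ?thesis using Nil unfolding grow_def by simp
  next
    case (Cons y ys)
    then show ?thesis unfolding grow_def by simp
  qed
qed

lemma root_tree:
  assumes T: "weighted_tree T" and vs: "set vs = verts T" "distinct vs"
    and es: "(\<lambda>(u, v). {u, v}) ` set es = edges T"
  shows "rooted T (root_tree (vs, edge_list T es))" "names (root_tree (vs, edge_list T es)) = verts T"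
proof -
  let ?es = "edge_list T es @ map (\<lambda>e. (fst (snd e), fst e, snd (snd e))) (edge_list T es)"
  let ?f = "\<lambda>ns (_::nat). grow ?es ns"
  note gr = grow_rooted[OF T es _ refl]
  have fin: "finite (verts T)" using T unfolding weighted_tree_def by blast
  have len: "length ns \<le> card (verts T)" if "rooted T ns" for ns
  proof -
    have "length ns = card (names ns)"
      using distinct_card[OF rooted_basic(2)[OF T that]] by simp
    then show ?thesis using card_mono[OF fin rooted_basic(1)[OF T that]] by simp
  qed
  have full: "names (grow ?es ns) = verts T" if "rooted T ns" "names ns = verts T" for ns
  proof -
    have "names ns \<subseteq> names (grow ?es ns)"
      unfolding grow_def by (cases "candidates ?es ns") (simp_all add: subset_insertI)
    then show ?thesis using rooted_basic(1)[OF T gr(1)[OF that(1)]] unfolding that(2) by (rule subset_antisym[rotated])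
  qed
  have run: "rooted T (foldl ?f ns us) \<and> (names (foldl ?f ns us) = verts T \<or> length (foldl ?f ns us) = length us + length ns)"
    if "rooted T ns" for ns us
    using that
  proof (induction us rule: rev_induct)
    case (snoc x us)
    define ns' where "ns' = foldl ?f ns us"
    have *: "rooted T ns'" "names ns' = verts T \<or> length ns' = length us + length ns"
      using snoc.IH[OF snoc.prems] unfolding ns'_def by (rule conjunct1, rule conjunct2)
    have "foldl ?f ns (us @ [x]) = grow ?es ns'" unfolding ns'_def by simp
    moreover have "names (grow ?es ns') = verts T \<or> length (grow ?es ns') = length (us @ [x]) + length ns"
      using *(2)
    proof
      assume "length ns' = length us + length ns"
      with gr(2)[OF *(1)] show ?thesis by simp
    qed (use full[OF *(1)] in simp)
    ultimately show ?case using gr(1)[OF *(1)] by simp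
  qed simp
  have "verts T \<noteq> {}" using T unfolding weighted_tree_def by blast
  then obtain v vs' where v: "vs = v # vs'" using vs(1) by (cases vs) simp_all
  have "rooted T [(v, v, 0, 0)]" using v vs(1) by (intro rooted.root) auto
  from run[OF this, of vs] have r: "rooted T (foldl ?f [(v, v, 0, 0)] vs)"
    "names (foldl ?f [(v, v, 0, 0)] vs) = verts T \<or> length (foldl ?f [(v, v, 0, 0)] vs) = length vs + 1"
    by simp_all
  have "root_tree (vs, edge_list T es) = foldl ?f [(v, v, 0, 0)] vs"
    unfolding root_tree_def v by simp
  moreover have "length vs = card (verts T)" using vs by (metis distinct_card)
  \<comment> \<open>A list that grew in every round would have one node more than there are
    vertices.\<close>
  ultimately show "rooted T (root_tree (vs, edge_list T es))" "names (root_tree (vs, edge_list T es)) = verts T"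
    using r len[OF r(1)] by force+
qed

section \<open>Subdividing the edges\<close>

lemma up_node: "z \<in> up ns p \<Longrightarrow> \<exists>q. (fst z, q, snd z) \<in> set ns"
proof (induction ns p rule: up.induct)
  case (2 x q d ns p)
  show ?case
  proof (cases "p = x")
    case True
    then have "z = (x, d) \<or> z \<in> up ns q" using "2.prems" by simp
    then show ?thesis
    proof
      assume "z \<in> up ns q"
      then obtain q' where "(fst z, q', snd z) \<in> set ns" using "2.IH"(1)[OF True] by blast
      then show ?thesis by (intro exI[of _ q']) simp
    qed (intro exI[of _ q], simp)
  next
    case False
    then obtain q' where "(fst z, q', snd z) \<in> set ns" using 2 by auto
    then show ?thesis by (intro exI[of _ q']) simp
  qed
qed simp

lemma up_self: "ordered ns \<Longrightarrow> (x, q, d) \<in> set ns \<Longrightarrow> (x, d) \<in> up ns x \<and> (\<forall>z\<in>up ns x. snd z \<le> d)"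
proof (induction ns)
  case (Cons a ns)
  obtain y p e where a: "a = (y, p, e)" by (cases a) auto
  show ?case
  proof (cases "(x, q, d) = a")
    case True
    then show ?thesis using Cons.prems(1) a by simp
  next
    case False
    then have m: "(x, q, d) \<in> set ns" using Cons.prems(2) by simp
    then have "x \<noteq> y" using Cons.prems(1) unfolding a by force
    then show ?thesis using Cons.IH[OF _ m] Cons.prems(1) unfolding a by simp
  qed
qed simp

lemma up_trans: "ordered ns \<Longrightarrow> z \<in> up ns p \<Longrightarrow> up ns (fst z) \<subseteq> up ns p"
proof (induction ns arbitrary: p)
  case (Cons a ns)
  obtain y q e where a: "a = (y, q, e)" by (cases a) auto
  have y: "y \<notin> fst ` set ns" and ord: "ordered ns" using Cons.prems(1) unfolding a by simp_all
  show ?case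
  proof (cases "p = y")
    case True
    show ?thesis
    proof (cases "fst z = y")
      case False
      then have "z \<in> up ns q" using Cons.prems(2) True unfolding a by auto
      from Cons.IH[OF ord this] False True show ?thesis unfolding a by auto
    qed (use True in simp)
  next
    case False
    then have z: "z \<in> up ns p" using Cons.prems(2) unfolding a by simp
    then have "fst z \<noteq> y" using up_names[OF z] y by metis
    with Cons.IH[OF ord z] False show ?thesis unfolding a by simp
  qed
qed simp

text \<open>Parents are unique, so ancestors form a chain. Hence, of two ancestors of one site, the
  higher is also an ancestor of everything below the other.\<close>

lemma up_linear:
  "ordered ns \<Longrightarrow> z \<in> up ns p \<Longrightarrow> z' \<in> up ns p \<Longrightarrow> z \<in> up ns (fst z') \<or> z' \<in> up ns (fst z)"
proof (induction ns arbitrary: p)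
  case (Cons a ns)
  obtain y q e where a: "a = (y, q, e)" by (cases a) auto
  have y: "y \<notin> fst ` set ns" and ord: "ordered ns" using Cons.prems(1) unfolding a by simp_all
  have old: ?case if z: "z \<in> up ns q'" "z' \<in> up ns q'" for q'
  proof -
    have "fst z \<noteq> y" "fst z' \<noteq> y" using up_names[OF z(1)] up_names[OF z(2)] y by metis+
    with Cons.IH[OF ord z] show ?thesis unfolding a by simp
  qed
  show ?case
  proof (cases "p = y")
    case True
    then have zz: "z = (y, e) \<or> z \<in> up ns q" "z' = (y, e) \<or> z' \<in> up ns q"
      using Cons.prems(2,3) unfolding a by simp_all
    have "z' \<in> up (a # ns) y" "z \<in> up (a # ns) y" using Cons.prems True by simp_all
    then show ?thesis using zz old[of q] by (metis fst_conv)
  next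
    case False
    then have "z \<in> up ns p" "z' \<in> up ns p" using Cons.prems(2,3) unfolding a by simp_all
    then show ?thesis by (rule old)
  qed
qed simp

text \<open>Going up from \<open>x\<close>, \<open>K + 1\<close> nodes are spaced by
  \<open>\<delta>\<close> in lengths scaled by \<open>s\<close>, and \<open>max\<close> stops them
  at the depth of the parent. The top node of the root points to \<open>(fst x, K + 1)\<close>,
  which is not in the list, so \<open>up\<close> ends there.\<close>

definition chain :: "nat \<Rightarrow> nat \<Rightarrow> real \<Rightarrow> node \<Rightarrow> link list" where
  "chain K s \<delta> x = map (\<lambda>i. ((fst x, fst i),
     (if fst i < K \<or> fst (snd x) = fst x then (fst x, fst i + 1) else (fst (snd x), 0)),
     max (real s * snd (snd (snd x))) (real s * fst (snd (snd x)) - snd i)))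
     (map (\<lambda>i. (i, real i * \<delta>)) [0..<Suc K])"

definition subdivide :: "nat \<Rightarrow> nat \<Rightarrow> real \<Rightarrow> node list \<Rightarrow> link list" where
  "subdivide K s \<delta> ns = concat (map (chain K s \<delta>) ns)"

text \<open>An index cannot be multiplied by \<open>\<delta>\<close> at run time; as
  \<open>k\<close> is fixed, the table is unrolled entry by entry.\<close>

lemma polytime_levels: "polytime (\<lambda>\<delta>. map (\<lambda>i. (i, real i * \<delta>)) [0..<k])"
proof (induction k)
  case (Suc k)
  have "polytime (\<lambda>\<delta>. map (\<lambda>i. (i, real i * \<delta>)) [0..<k] @ [(k, real k * \<delta>)])"
    by (intro polytime_intros Suc.IH polytime_const_nat polytime_const_mult)
  then show ?case by simp
qed (simp add: polytime_Nil)

lemma polytime_subdivide [polytime_intros]: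
  "polytime a \<Longrightarrow> polytime b \<Longrightarrow> polytime (\<lambda>x. subdivide K s (a x) (b x))"
  by (rule polytime2, unfold subdivide_def chain_def max_def)
    (intro polytime_intros polytime_comp[OF polytime_levels] polytime_const_nat polytime_const_mult)

text \<open>\<open>up\<close> and \<open>ordered\<close> consume the list from the front, so the
  claims are proved for all suffixes of the chain, by induction downwards from
  \<open>K\<close>.\<close>

lemma chain_suffix:
  fixes lev :: "nat \<Rightarrow> real" and K v :: nat
  defines "nx \<equiv> \<lambda>q i. if i < K then (v, Suc i) else q"
  assumes "i \<le> K"
  shows "up (map (\<lambda>i. ((v, i), nx q i, lev i)) [i..<Suc K] @ ns) (v, i) = (\<lambda>j. ((v, j), lev j)) ` {i..K} \<union> up ns q"
    and "fst p \<noteq> v \<Longrightarrow> up (map (\<lambda>i. ((v, i), nx q i, lev i)) [i..<Suc K] @ ns) p = up ns p"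
    and "ordered ns \<Longrightarrow> (\<And>j. (v, j) \<notin> fst ` set ns) \<Longrightarrow> (ns \<noteq> [] \<Longrightarrow> q \<in> fst ` set ns) \<Longrightarrow>
      (\<And>i j. i \<le> j \<Longrightarrow> lev j \<le> lev i) \<Longrightarrow> (\<And>z. z \<in> up ns q \<Longrightarrow> snd z \<le> lev K) \<Longrightarrow>
      ordered (map (\<lambda>i. ((v, i), nx q i, lev i)) [i..<Suc K] @ ns)"
proof -
  let ?L = "\<lambda>i. map (\<lambda>i. ((v, i), nx q i, lev i)) [i..<Suc K] @ ns"
  have Cons: "?L i = ((v, i), nx q i, lev i) # ?L (Suc i)" if "i \<le> K" for i
  proof -
    have "[i..<Suc K] = i # [Suc i..<Suc K]" by (rule upt_conv_Cons) (use that in simp)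
    then show ?thesis by (simp only: list.map append_Cons)
  qed
  have end_: "?L (Suc K) = ns" by simp
  have 1: "up (?L i) (v, i) = (\<lambda>j. ((v, j), lev j)) ` {i..K} \<union> up ns q" if "i \<le> K" for i
    using that
  proof (induction rule: inc_induct)
    case base
    show ?case unfolding Cons[OF order_refl] end_ by (simp add: nx_def)
  next
    case (step i)
    have "{i..K} = insert i {Suc i..K}" using step.hyps by auto
    moreover have "nx q i = (v, Suc i)" using step.hyps by (simp add: nx_def)
    ultimately show ?case unfolding Cons[OF less_imp_le[OF step.hyps(2)]] up.simps using step.IH
      by (simp only: simp_thms if_True image_insert Un_insert_left)
  qed
  then show "up (?L i) (v, i) = (\<lambda>j. ((v, j), lev j)) ` {i..K} \<union> up ns q" using \<open>i \<le> K\<close> .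
  show "up (?L i) p = up ns p" if "fst p \<noteq> v"
    using \<open>i \<le> K\<close>
  proof (induction rule: inc_induct)
    case base
    have "p \<noteq> (v, K)" using that by auto
    then show ?case unfolding Cons[OF order_refl] end_ up.simps by (simp only: if_False)
  next
    case (step i)
    have "p \<noteq> (v, i)" using that by auto
    then show ?case unfolding Cons[OF less_imp_le[OF step.hyps(2)]] up.simps
      using step.IH by (simp only: if_False)
  qed
  show "ordered (?L i)" if ord: "ordered ns" and v: "\<And>j. (v, j) \<notin> fst ` set ns"
    and q: "ns \<noteq> [] \<Longrightarrow> q \<in> fst ` set ns" and mono: "\<And>i j. i \<le> j \<Longrightarrow> lev j \<le> lev i"
    and le: "\<And>z. z \<in> up ns q \<Longrightarrow> snd z \<le> lev K"
    using \<open>i \<le> K\<close>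
  proof (induction rule: inc_induct)
    case base
    show ?case unfolding Cons[OF order_refl] end_ ordered.simps using ord v q le by (simp add: nx_def)
  next
    case (step i)
    have iK: "i \<le> K" "Suc i \<le> K" using step.hyps by simp_all
    have nx: "nx q i = (v, Suc i)" using step.hyps by (simp add: nx_def)
    have "(v, i) \<notin> fst ` set (?L (Suc i))"
    proof -
      have "(v, i) \<notin> fst ` set (map (\<lambda>i. ((v, i), nx q i, lev i)) [Suc i..<Suc K])" by auto
      then show ?thesis using v[of i] unfolding set_append image_Un by blast
    qed
    moreover have "nx q i \<in> fst ` set (?L (Suc i))"
      unfolding nx Cons[OF iK(2)] by simp
    moreover have "snd z \<le> lev i" if "z \<in> up (?L (Suc i)) (nx q i)" for z
    proof -
      have "z \<in> (\<lambda>j. ((v, j), lev j)) ` {Suc i..K} \<union> up ns q"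
        using that unfolding nx 1[OF iK(2)] .
      then show ?thesis
      proof
        assume "z \<in> (\<lambda>j. ((v, j), lev j)) ` {Suc i..K}"
        then obtain j where "z = ((v, j), lev j)" "Suc i \<le> j" by auto
        then show ?thesis using mono[of i j] by simp
      next
        assume "z \<in> up ns q"
        then show ?thesis using le[of z] mono[OF iK(1)] by linarith
      qed
    qed
    ultimately show ?case unfolding Cons[OF iK(1)] ordered.simps using step.IH by blast
  qed
qed

definition level :: "nat \<Rightarrow> real \<Rightarrow> real \<Rightarrow> real \<Rightarrow> nat \<Rightarrow> real" where
  "level s \<delta> d e i = max (real s * e) (real s * d - real i * \<delta>)"

lemma subdivide_Cons:
  "subdivide K s \<delta> ((v, u, d, e) # ns) = map (\<lambda>i. ((v, i),
     if i < K then (v, Suc i) else if u = v then (v, Suc K) else (u, 0), level s \<delta> d e i)) [0..<Suc K] @ subdivide K s \<delta> ns"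
proof -
  have "(if i < K \<or> u = v then (v, i + 1) else (u, 0)) =
      (if i < K then (v, Suc i) else if u = v then (v, Suc K) else (u, 0))" if "i \<le> K" for i
    using that by auto
  then show ?thesis
    unfolding subdivide_def chain_def level_def by (simp del: upt_Suc)
qed

lemma subdivide_names: "fst ` set (subdivide K s \<delta> ns) = names ns \<times> {0..K}"
proof (induction ns)
  case (Cons a ns)
  obtain v u d e where a: "a = (v, u, d, e)" by (cases a) auto
  have "fst ` set (map (\<lambda>i. ((v, i), if i < K then (v, Suc i) else if u = v then (v, Suc K) else (u, 0),
      level s \<delta> d e i)) [0..<Suc K]) = {v} \<times> {0..K}"
    by (auto simp del: upt_Suc simp: image_image)
  then show ?case unfolding a subdivide_Cons set_append image_Un Cons.IH by auto
qed (simp add: subdivide_def)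

lemma level_le: "0 \<le> \<delta> \<Longrightarrow> e \<le> d \<Longrightarrow> level s \<delta> d e i \<le> real s * d"
  unfolding level_def by (simp add: mult_left_mono)

lemma up_subdivide:
  assumes "v \<notin> names ns"
  shows "u \<in> names ns \<Longrightarrow> up (subdivide K s \<delta> ((v, u, d, e) # ns)) (v, 0) =
      (\<lambda>j. ((v, j), level s \<delta> d e j)) ` {0..K} \<union> up (subdivide K s \<delta> ns) (u, 0)"
    and "x \<noteq> v \<Longrightarrow> up (subdivide K s \<delta> ((v, u, d, e) # ns)) (x, i) = up (subdivide K s \<delta> ns) (x, i)"
proof -
  show "up (subdivide K s \<delta> ((v, u, d, e) # ns)) (v, 0) =
      (\<lambda>j. ((v, j), level s \<delta> d e j)) ` {0..K} \<union> up (subdivide K s \<delta> ns) (u, 0)" if "u \<in> names ns"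
  proof -
    have "u \<noteq> v" using that assms by blast
    then show ?thesis unfolding subdivide_Cons by (simp only: chain_suffix(1)[OF le0] if_False)
  qed
  show "up (subdivide K s \<delta> ((v, u, d, e) # ns)) (x, i) = up (subdivide K s \<delta> ns) (x, i)" if "x \<noteq> v"
    unfolding subdivide_Cons by (rule chain_suffix(2)[OF le0]) (simp add: that)
qed

lemma up_subdivide_root:
  "up (subdivide K s \<delta> [(v, v, 0, 0)]) (v, 0) = (\<lambda>j. ((v, j), level s \<delta> 0 0 j)) ` {0..K}"
proof -
  have "up (subdivide K s \<delta> []) p = {}" for p by (simp add: subdivide_def)
  then show ?thesis unfolding subdivide_Cons chain_suffix(1)[OF le0] by simp
qed

lemma level_mono: "0 \<le> \<delta> \<Longrightarrow> i \<le> j \<Longrightarrow> level s \<delta> d e j \<le> level s \<delta> d e i"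
  unfolding level_def by (rule max.mono[OF order_refl diff_left_mono[OF mult_right_mono]]) simp_all

text \<open>The second and third claims preserve distances between vertices; the fourth puts a node
  at most \<open>\<delta>\<close> below any point of the tree up to height
  \<open>K * \<delta>\<close> above \<open>v\<close>. Orderedness of the extended list uses the
  second claim for the smaller one, so all share one induction.\<close>

lemma subdivide_rooted:
  assumes T: "weighted_tree T" and ns: "rooted T ns" and \<delta>: "0 \<le> \<delta>"
    and D: "\<And>x u d e. (x, u, d, e) \<in> set ns \<Longrightarrow> d = D x"
  shows "ordered (subdivide K s \<delta> ns)"
    and "v \<in> names ns \<Longrightarrow> z \<in> up (subdivide K s \<delta> ns) (v, 0) \<Longrightarrow>
      (fst (fst z), D (fst (fst z))) \<in> up (parents ns) v \<and> snd z \<le> real s * D (fst (fst z))"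
    and "v \<in> names ns \<Longrightarrow> y \<in> up (parents ns) v \<Longrightarrow> ((fst y, 0), real s * snd y) \<in> up (subdivide K s \<delta> ns) (v, 0)"
    and "v \<in> names ns \<Longrightarrow> 0 \<le> t \<Longrightarrow> real s * D v - real K * \<delta> \<le> t \<Longrightarrow> t \<le> real s * D v \<Longrightarrow>
      \<exists>z\<in>up (subdivide K s \<delta> ns) (v, 0). t \<le> snd z \<and> snd z \<le> t + \<delta>"
proof -
  have zero: "level s \<delta> d e 0 = real s * d" if "e \<le> d" for d e
    using that unfolding level_def by (simp add: max_absorb2 mult_left_mono)
  have find: "\<exists>j\<le>K. t \<le> level s \<delta> d e j \<and> level s \<delta> d e j \<le> t + \<delta>"
    if t: "real s * e \<le> t" "real s * d - real K * \<delta> \<le> t" "t \<le> real s * d" for t d e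
  proof -
    let ?P = "\<lambda>j. real s * d - real j * \<delta> \<le> t + \<delta>"
    \<comment> \<open>Going up from the vertex, this is the first point of depth at most
      \<open>t + \<delta>\<close>. Its predecessor is deeper than that, so its own depth is at least
      \<open>t\<close>.\<close>
    define j where "j = (LEAST j. ?P j)"
    have K: "?P K" using t(2) \<delta> by linarith
    then have Pj: "?P j" unfolding j_def by (rule LeastI)
    have jK: "j \<le> K" unfolding j_def by (rule Least_le[of ?P, OF K])
    have "t \<le> real s * d - real j * \<delta>"
    proof (cases j)
      case 0
      then show ?thesis using t(3) by simp
    next
      case (Suc i)
      then have "\<not> ?P i" using not_less_Least[of i ?P] unfolding j_def by simp
      then show ?thesis using Suc by (simp add: algebra_simps)
    qed
    with Pj t(1) \<delta> jK show ?thesis unfolding level_def by (intro exI[of _ j]) auto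
  qed
  have claim: "ordered (subdivide K s \<delta> ns) \<and>
    (\<forall>v\<in>names ns. \<forall>z\<in>up (subdivide K s \<delta> ns) (v, 0).
      (fst (fst z), D (fst (fst z))) \<in> up (parents ns) v \<and> snd z \<le> real s * D (fst (fst z))) \<and>
    (\<forall>v\<in>names ns. \<forall>y\<in>up (parents ns) v. ((fst y, 0), real s * snd y) \<in> up (subdivide K s \<delta> ns) (v, 0)) \<and>
    (\<forall>v\<in>names ns. \<forall>t. 0 \<le> t \<longrightarrow> real s * D v - real K * \<delta> \<le> t \<longrightarrow> t \<le> real s * D v \<longrightarrow>
      (\<exists>z\<in>up (subdivide K s \<delta> ns) (v, 0). t \<le> snd z \<and> snd z \<le> t + \<delta>))"
    (is "?A ns \<and> ?B ns \<and> ?C ns \<and> ?E ns")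
    using ns D
  proof (induction rule: rooted.induct)
    case (root v)
    have D0: "D v = 0" using root.prems[of v v 0 0] by simp
    have A: "?A [(v, v, 0, 0)]"
      unfolding subdivide_Cons by (rule chain_suffix(3)) (simp_all add: subdivide_def level_mono[OF \<delta>])
    have B: "?B [(v, v, 0, 0)]"
      using level_le[OF \<delta>, of 0 0 s] by (simp add: up_subdivide_root D0 parents_def)
    have C: "?C [(v, v, 0, 0)]"
      using zero[of 0 0] by (simp add: up_subdivide_root D0 parents_def image_iff)
    have E: "?E [(v, v, 0, 0)]"
    proof (intro ballI allI impI)
      fix x t assume x: "x \<in> names [(v, v, 0 :: real, 0 :: real)]"
        and t: "0 \<le> t" "real s * D x - real K * \<delta> \<le> t" "t \<le> real s * D x"
      have xv: "x = v" using x by simp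
      obtain j where "j \<le> K" "t \<le> level s \<delta> 0 0 j" "level s \<delta> 0 0 j \<le> t + \<delta>"
        using find[of 0 t 0] t D0 unfolding xv by auto
      then show "\<exists>z\<in>up (subdivide K s \<delta> [(v, v, 0, 0)]) (x, 0). t \<le> snd z \<and> snd z \<le> t + \<delta>"
        unfolding xv up_subdivide_root by (intro bexI[of _ "((v, j), level s \<delta> 0 0 j)"]) auto
    qed
    show ?case by (intro conjI A B C E)
  next
    case (child ns u p d e v)
    let ?d = "d + len T {u, v}"
    let ?new = "(v, u, ?d, d) # ns"
    have Dns: "d' = D x" if "(x, u', d', e') \<in> set ns" for x u' d' e'
      using child.prems[of x u' d' e'] that by simp
    have all: "?A ns \<and> ?B ns \<and> ?C ns \<and> ?E ns" by (rule child.IH) (rule Dns)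
    note IH = conjunct1[OF all] conjunct1[OF conjunct2[OF all]] conjunct1[OF conjunct2[OF conjunct2[OF all]]]
      conjunct2[OF conjunct2[OF conjunct2[OF all]]]
    have u: "u \<in> names ns" using child.hyps(2) by force
    have Du: "D u = d" using child.prems[of u p d e] child.hyps(2) by simp
    have Dv: "D v = ?d" using child.prems[of v u ?d d] by simp
    have le: "d \<le> ?d" using len_nonneg[OF T child.hyps(3)] by simp
    have d0: "0 \<le> d" using rooted_basic(4)[OF T child.hyps(1,2)] by linarith
    note upv = up_subdivide(1)[OF child.hyps(4) u] and upx = up_subdivide(2)[OF child.hyps(4)]
    have pv: "up (parents ?new) v = insert (v, ?d) (up (parents ns) u)"
      and px: "\<And>x. x \<noteq> v \<Longrightarrow> up (parents ?new) x = up (parents ns) x"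
      by (simp_all add: parents_Cons)
    have ne: "x \<noteq> v" if "x \<in> names ns" for x using that child.hyps(4) by blast
    have A: "?A ?new"
      unfolding subdivide_Cons
    proof (rule chain_suffix(3)[OF le0])
      show "ordered (subdivide K s \<delta> ns)" by (rule IH(1))
      show "(v, j) \<notin> fst ` set (subdivide K s \<delta> ns)" for j
        unfolding subdivide_names using child.hyps(4) by simp
      show "(if u = v then (v, Suc K) else (u, 0)) \<in> fst ` set (subdivide K s \<delta> ns)"
        unfolding subdivide_names using u ne[OF u] by simp
      show "level s \<delta> ?d d j \<le> level s \<delta> ?d d i" if "i \<le> j" for i j by (rule level_mono[OF \<delta> that])
      fix z assume "z \<in> up (subdivide K s \<delta> ns) (if u = v then (v, Suc K) else (u, 0))"
      then have z: "z \<in> up (subdivide K s \<delta> ns) (u, 0)" using ne[OF u] by simp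
      let ?w = "fst (fst z)"
      have w: "(?w, D ?w) \<in> up (parents ns) u" "snd z \<le> real s * D ?w"
        using IH(2)[rule_format, OF u z] by simp_all
      have "D ?w \<le> d" using rooted_up_le[OF T child.hyps(1,2) w(1)] by simp
      then have "real s * D ?w \<le> real s * d" by (simp add: mult_left_mono)
      with w(2) show "snd z \<le> level s \<delta> ?d d K" unfolding level_def by linarith
    qed
    have B: "?B ?new"
    proof (intro ballI)
      fix x z assume x: "x \<in> names ?new" and z: "z \<in> up (subdivide K s \<delta> ?new) (x, 0)"
      show "(fst (fst z), D (fst (fst z))) \<in> up (parents ?new) x \<and> snd z \<le> real s * D (fst (fst z))"
      proof (cases "x = v")
        case True
        have "z \<in> (\<lambda>j. ((v, j), level s \<delta> ?d d j)) ` {0..K} \<union> up (subdivide K s \<delta> ns) (u, 0)"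
          using z unfolding True upv .
        then show ?thesis
        proof
          assume "z \<in> (\<lambda>j. ((v, j), level s \<delta> ?d d j)) ` {0..K}"
          then obtain j where "z = ((v, j), level s \<delta> ?d d j)" by blast
          then show ?thesis unfolding True pv using level_le[OF \<delta> le, of s j] Dv by simp
        next
          assume "z \<in> up (subdivide K s \<delta> ns) (u, 0)"
          then have "(fst (fst z), D (fst (fst z))) \<in> up (parents ns) u \<and> snd z \<le> real s * D (fst (fst z))"
            by (rule IH(2)[rule_format, OF u])
          then show ?thesis unfolding True pv by simp
        qed
      next
        case False
        then have "x \<in> names ns" using x by simp
        moreover have "z \<in> up (subdivide K s \<delta> ns) (x, 0)" using z unfolding upx[OF False] .
        ultimately show ?thesis unfolding px[OF False] by (rule IH(2)[rule_format])
      qed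
    qed
    have C: "?C ?new"
    proof (intro ballI)
      fix x y assume x: "x \<in> names ?new" and y: "y \<in> up (parents ?new) x"
      show "((fst y, 0), real s * snd y) \<in> up (subdivide K s \<delta> ?new) (x, 0)"
      proof (cases "x = v")
        case True
        have "y = (v, ?d) \<or> y \<in> up (parents ns) u" using y unfolding True pv by simp
        then show ?thesis
        proof
          assume "y = (v, ?d)"
          then have "((fst y, 0), real s * snd y) = ((v, 0), level s \<delta> ?d d 0)" using zero[OF le] by simp
          then show ?thesis unfolding True upv by (simp add: image_iff)
        next
          assume "y \<in> up (parents ns) u"
          then show ?thesis unfolding True upv by (intro UnI2 IH(3)[rule_format, OF u])
        qed
      next
        case False
        then have "x \<in> names ns" using x by simp
        from IH(3)[rule_format, OF this] y show ?thesis unfolding px[OF False] upx[OF False] .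
      qed
    qed
    have E: "?E ?new"
    proof (intro ballI allI impI)
      fix x t assume x: "x \<in> names ?new" and t: "0 \<le> t" "real s * D x - real K * \<delta> \<le> t" "t \<le> real s * D x"
      show "\<exists>z\<in>up (subdivide K s \<delta> ?new) (x, 0). t \<le> snd z \<and> snd z \<le> t + \<delta>"
      proof (cases "x = v")
        case True
        show ?thesis
        proof (cases "real s * d \<le> t")
          case True
          then obtain j where "j \<le> K" "t \<le> level s \<delta> ?d d j" "level s \<delta> ?d d j \<le> t + \<delta>"
            using find[of d t ?d] t Dv \<open>x = v\<close> by auto
          then show ?thesis unfolding \<open>x = v\<close> upv
            by (intro bexI[of _ "((v, j), level s \<delta> ?d d j)"]) auto
        next
          case False
          \<comment> \<open>A point beyond the edge is sought from the parent \<open>u\<close>. It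
            is no farther above \<open>u\<close> than above \<open>v\<close>, so the height bound is
            inherited.\<close>
          have "real s * d \<le> real s * ?d" using le by (simp add: mult_left_mono)
          then have "real s * D u - real K * \<delta> \<le> t" "t \<le> real s * D u"
            using t False Dv Du \<open>x = v\<close> by simp_all
          then have "\<exists>z\<in>up (subdivide K s \<delta> ns) (u, 0). t \<le> snd z \<and> snd z \<le> t + \<delta>"
            by (rule IH(4)[rule_format, OF u t(1)])
          then show ?thesis unfolding \<open>x = v\<close> upv by (meson UnI2)
        qed
      next
        case False
        then have "x \<in> names ns" using x by simp
        from IH(4)[rule_format, OF this t] show ?thesis unfolding upx[OF False] .
      qed
    qed
    show ?case by (intro conjI A B C E)
  qed
  note * = conjunct1[OF claim] conjunct1[OF conjunct2[OF claim]]
    conjunct1[OF conjunct2[OF conjunct2[OF claim]]] conjunct2[OF conjunct2[OF conjunct2[OF claim]]]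
  show "ordered (subdivide K s \<delta> ns)" by (rule *(1))
  show "(fst (fst z), D (fst (fst z))) \<in> up (parents ns) v \<and> snd z \<le> real s * D (fst (fst z))"
    if "v \<in> names ns" "z \<in> up (subdivide K s \<delta> ns) (v, 0)"
    by (rule *(2)[rule_format, OF that])
  show "((fst y, 0), real s * snd y) \<in> up (subdivide K s \<delta> ns) (v, 0)"
    if "v \<in> names ns" "y \<in> up (parents ns) v"
    by (rule *(3)[rule_format, OF that])
  show "\<exists>z\<in>up (subdivide K s \<delta> ns) (v, 0). t \<le> snd z \<and> snd z \<le> t + \<delta>"
    if "v \<in> names ns" "0 \<le> t" "real s * D v - real K * \<delta> \<le> t" "t \<le> real s * D v"
    by (rule *(4)[rule_format, OF that])
qed

section \<open>The approximation schemes\<close>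

definition points :: "nat \<Rightarrow> node list \<Rightarrow> nat list \<Rightarrow> point list" where
  "points s ns us = map (\<lambda>u. ((u, 0), real s * depth ns u)) us"

definition sites :: "link list \<Rightarrow> point list" where
  "sites nodes = map (\<lambda>z. (fst z, snd (snd z))) nodes"

text \<open>Distances between vertices have this form with \<open>z\<close> the lowest common
  ancestor, so every cost of a feasible solution occurs. Other triples do no harm, since each
  attempt is sound for its own bound.\<close>

definition thresholds :: "node list \<Rightarrow> real list" where
  "thresholds ns = filter (\<lambda>b. 0 \<le> b) (concat (map (\<lambda>x. concat (map (\<lambda>y. map (\<lambda>z.
     fst (snd (snd x)) + fst (snd (snd y)) - (fst (snd (snd z)) + fst (snd (snd z)))) ns) ns)) ns))"

text \<open>Solutions are compared by the bound for which they were found, not by their cost: the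
  least successful bound is at most the optimum, and that suffices.\<close>

definition best :: "(real \<times> (nat \<times> nat) list) list \<Rightarrow> (real \<times> (nat \<times> nat) list) list" where
  "best ss = filter (\<lambda>s. \<forall>s'\<in>set ss. fst s \<le> fst s') ss"

definition attempts :: "(real \<Rightarrow> (nat \<times> nat) list list) \<Rightarrow> node list \<Rightarrow> (real \<times> (nat \<times> nat) list) list" where
  "attempts S ns = concat (map (\<lambda>b. map (\<lambda>m. (b, m)) (S b)) (thresholds ns))"

text \<open>Depths are scaled by \<open>M\<close> and the rounding error is \<open>b\<close>, so the
  distance bound is \<open>M * b\<close>. With \<open>K = 0\<close> the subdivision adds no
  points.\<close>

definition gather_solve :: "nat \<Rightarrow> node list \<Rightarrow> nat list \<Rightarrow> nat list \<Rightarrow> nat \<Rightarrow> real \<Rightarrow> (nat \<times> nat) list list" where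
  "gather_solve M ns us fs r b = solve M r b (subdivide 0 M b ns) (points M ns us) (points M ns fs)"

definition gather :: "nat \<Rightarrow> node list \<Rightarrow> nat list \<Rightarrow> nat list \<Rightarrow> nat \<Rightarrow> nat list" where
  "gather M ns us fs r = (case best (attempts (gather_solve M ns us fs r) ns) of [] \<Rightarrow> []
     | s # _ \<Rightarrow> map (\<lambda>i. assigned (snd s) i) [0..<length us])"

definition cluster_sites :: "nat \<Rightarrow> node list \<Rightarrow> real \<Rightarrow> point list" where
  "cluster_sites M ns b = sites (subdivide M (2 * M) b ns)"

text \<open>Scaling by \<open>2 * M\<close> turns half the diameter bound into \<open>M * b\<close>,
  a height that \<open>M\<close> steps of length \<open>b\<close> reach.\<close>

definition cluster_solve :: "nat \<Rightarrow> node list \<Rightarrow> nat list \<Rightarrow> nat \<Rightarrow> real \<Rightarrow> (nat \<times> nat) list list" where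
  "cluster_solve M ns us r b =
     solve M r b (subdivide M (2 * M) b ns) (points (2 * M) ns us) (cluster_sites M ns b)"

definition cluster :: "nat \<Rightarrow> node list \<Rightarrow> nat list \<Rightarrow> nat \<Rightarrow> nat list list" where
  "cluster M ns us r = (case best (attempts (cluster_solve M ns us r) ns) of [] \<Rightarrow> []
     | s # _ \<Rightarrow> filter (\<lambda>c. c \<noteq> []) (map (\<lambda>j. filter (\<lambda>i. assigned (snd s) i = j) [0..<length us])
         [0..<length (cluster_sites M ns (fst s))]))"

lemma polytime_points [polytime_intros]:
  "polytime a \<Longrightarrow> polytime b \<Longrightarrow> polytime (\<lambda>x. points s (a x) (b x))"
  by (rule polytime2, unfold points_def) (intro polytime_intros polytime_const_mult)

lemma polytime_sites [polytime_intros]: "polytime a \<Longrightarrow> polytime (\<lambda>x. sites (a x))"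
  by (rule polytime_comp[of sites], unfold sites_def) (intro polytime_intros)

lemma polytime_thresholds [polytime_intros]: "polytime a \<Longrightarrow> polytime (\<lambda>x. thresholds (a x))"
  by (rule polytime_comp[of thresholds], unfold thresholds_def) (intro polytime_intros)

lemma polytime_best [polytime_intros]: "polytime a \<Longrightarrow> polytime (\<lambda>x. best (a x))"
  by (rule polytime_comp[of best], unfold best_def) (intro polytime_intros)

lemma polytime_gather:
  "polytime (\<lambda>x. gather M (root_tree (fst x)) (fst (snd x)) (fst (snd (snd x))) (snd (snd (snd x))))"
  by (rule polytime4[of "gather M"], unfold gather_def attempts_def gather_solve_def)
    (intro polytime_intros polytime_solve)+

lemma polytime_cluster:
  "polytime (\<lambda>x. cluster M (root_tree (fst x)) (fst (snd x)) (snd (snd x)))"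
  by (rule polytime3[of "cluster M"], unfold cluster_def attempts_def cluster_solve_def cluster_sites_def)
    (intro polytime_intros polytime_solve)+

section \<open>Choosing the least successful bound\<close>

lemma best_le:
  assumes "s0 \<in> set ss"
  obtains s ss' where "best ss = s # ss'" "s \<in> set ss" "fst s \<le> fst s0"
proof -
  define b where "b = Min (fst ` set ss)"
  have ne: "fst ` set ss \<noteq> {}" using assms by auto
  have "b \<in> fst ` set ss" unfolding b_def by (rule Min_in) (use ne in simp_all)
  then obtain s1 where s1: "s1 \<in> set ss" "fst s1 = b" by (auto simp: image_iff)
  have le: "b \<le> fst s'" if "s' \<in> set ss" for s'
    unfolding b_def by (rule Min_le) (use that in simp_all)
  have "s1 \<in> set (best ss)" unfolding best_def using s1 le by simp
  then obtain s ss' where s: "best ss = s # ss'" by (cases "best ss") simp_all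
  then have "s \<in> set (best ss)" by simp
  then have "s \<in> set ss" "fst s \<le> fst s0" unfolding best_def using assms by simp_all
  with s show ?thesis by (rule that)
qed

lemma best_attempt:
  assumes "b \<in> set (thresholds ns)" "S b \<noteq> []"
  obtains s ss where "best (attempts S ns) = s # ss" "0 \<le> fst s" "fst s \<le> b" "snd s \<in> set (S (fst s))"
proof -
  have "(b, hd (S b)) \<in> set (attempts S ns)" using assms unfolding attempts_def by (auto intro!: bexI[of _ b])
  then obtain s ss where "best (attempts S ns) = s # ss" "s \<in> set (attempts S ns)" "fst s \<le> b"
    by (rule best_le) simp
  then show ?thesis using that unfolding attempts_def thresholds_def by auto
qed

text \<open>Applied with the thresholds as \<open>V\<close>, this shows that the infimum defining
  the optimum is the cost of some solution and itself a threshold.\<close>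

lemma INF_attained:
  fixes f :: "'a \<Rightarrow> real"
  assumes "finite V" "\<And>s. s \<in> S \<Longrightarrow> f s \<in> V" "S \<noteq> {}"
  shows "\<exists>s\<in>S. f s = (INF s\<in>S. f s)"
proof -
  have fin: "finite (f ` S)" using assms(2) by (intro finite_subset[OF _ assms(1)]) blast
  then have "Inf (f ` S) = Min (f ` S)" using assms(3) by (intro cInf_eq_Min) simp_all
  also have "\<dots> \<in> f ` S" using fin assms(3) by (intro Min_in) simp_all
  finally show ?thesis by (simp add: image_iff eq_commute)
qed

section \<open>Tree distances and reachability in the subdivided tree\<close>

locale tree_instance =
  fixes T :: "nat wtree" and ns :: "node list"
  assumes T: "weighted_tree T" and ns: "rooted T ns" and cover: "names ns = verts T"
begin

abbreviation "D \<equiv> depth ns"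

lemma D: "(x, u, d, e) \<in> set ns \<Longrightarrow> d = D x"
  using depth_eq[OF rooted_basic(2)[OF T ns]] by simp

lemma entry:
  assumes "x \<in> verts T" obtains u e where "(x, u, D x, e) \<in> set ns"
proof -
  have "x \<in> names ns" using assms cover by simp
  then obtain a where "a \<in> set ns" "fst a = x" by (auto simp: image_iff)
  moreover obtain y u d e where "a = (y, u, d, e)" by (cases a)
  ultimately have "(x, u, d, e) \<in> set ns" by simp
  then show ?thesis using that D by metis
qed

lemma depth_nonneg: "x \<in> verts T \<Longrightarrow> 0 \<le> D x"
proof -
  assume "x \<in> verts T"
  then obtain u e where "(x, u, D x, e) \<in> set ns" by (rule entry)
  from rooted_basic(4)[OF T ns this] show ?thesis by linarith
qed

lemma up_depth:
  assumes "x \<in> verts T" "z \<in> up (parents ns) x"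
  shows "fst z \<in> verts T" "snd z = D (fst z)" "snd z \<le> D x"
proof -
  have "fst z \<in> names ns" by (rule rooted_up_names[OF T assms(2)])
  then show "fst z \<in> verts T" unfolding cover .
  obtain q where "(fst z, q, snd z) \<in> set (parents ns)" using up_node[OF assms(2)] by blast
  then obtain a where "a \<in> set ns" "fst z = fst a" "snd z = fst (snd (snd a))"
    unfolding parents_def by auto
  moreover obtain y u d e where "a = (y, u, d, e)" by (cases a)
  ultimately show "snd z = D (fst z)" using D[of y u d e] by simp
  obtain u e where "(x, u, D x, e) \<in> set ns" by (rule entry[OF assms(1)])
  from rooted_up_le[OF T ns this assms(2)] show "snd z \<le> D x" by simp
qed

lemma dist:
  assumes "x \<in> verts T" "y \<in> verts T"
  shows "z \<in> up (parents ns) x \<inter> up (parents ns) y \<Longrightarrow> tree_dist T x y \<le> D x + D y - 2 * snd z"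
    and "\<exists>z\<in>up (parents ns) x \<inter> up (parents ns) y. tree_dist T x y = D x + D y - 2 * snd z"
proof -
  obtain u e where x: "(x, u, D x, e) \<in> set ns" by (rule entry[OF assms(1)])
  obtain u' e' where y: "(y, u', D y, e') \<in> set ns" by (rule entry[OF assms(2)])
  show "z \<in> up (parents ns) x \<inter> up (parents ns) y \<Longrightarrow> tree_dist T x y \<le> D x + D y - 2 * snd z"
    by (rule tree_dist_up(1)[OF T ns cover x y])
  show "\<exists>z\<in>up (parents ns) x \<inter> up (parents ns) y. tree_dist T x y = D x + D y - 2 * snd z"
    by (rule tree_dist_up(2)[OF T ns cover x y])
qed

lemma threshold:
  assumes "x \<in> verts T" "y \<in> verts T"
  shows "tree_dist T x y \<in> set (thresholds ns)" "0 \<in> set (thresholds ns)"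
proof -
  have mem: "b \<in> set (thresholds ns)" if "x \<in> verts T" "y \<in> verts T" "w \<in> verts T"
    "b = D x + D y - 2 * D w" "0 \<le> b" for x y w b
  proof -
    obtain u e where 1: "(x, u, D x, e) \<in> set ns" by (rule entry[OF \<open>x \<in> verts T\<close>])
    obtain u' e' where 2: "(y, u', D y, e') \<in> set ns" by (rule entry[OF \<open>y \<in> verts T\<close>])
    obtain u'' e'' where 3: "(w, u'', D w, e'') \<in> set ns" by (rule entry[OF \<open>w \<in> verts T\<close>])
    let ?f = "\<lambda>x y z. fst (snd (snd x)) + fst (snd (snd y)) - (fst (snd (snd z)) + fst (snd (snd z)))"
    have "\<exists>x\<in>set ns. \<exists>y\<in>set ns. \<exists>z\<in>set ns. b = ?f x y z"
      using \<open>b = D x + D y - 2 * D w\<close>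
      by (intro bexI[OF _ 1] bexI[OF _ 2] bexI[OF _ 3]) simp
    then show ?thesis using \<open>0 \<le> b\<close> unfolding thresholds_def by (simp add: image_iff)
  qed
  obtain z where z: "z \<in> up (parents ns) x" "z \<in> up (parents ns) y"
    "tree_dist T x y = D x + D y - 2 * snd z" using dist(2)[OF assms] by blast
  note zx = up_depth[OF assms(1) z(1)] and zy = up_depth[OF assms(2) z(2)]
  have nn: "0 \<le> tree_dist T x y" using z(3) zx(3) zy(3) by linarith
  show "tree_dist T x y \<in> set (thresholds ns)"
    by (rule mem[OF assms zx(1) _ nn]) (simp add: z(3) zx(2))
  show "0 \<in> set (thresholds ns)" by (rule mem[OF assms(1) assms(1) assms(1)]) simp_all
qed

context
  fixes K s :: nat and \<delta> :: real
  assumes \<delta>: "0 \<le> \<delta>"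
begin

abbreviation "N \<equiv> subdivide K s \<delta> ns"

lemma N_rooted:
  shows "ordered N"
    and "v \<in> verts T \<Longrightarrow> z \<in> up N (v, 0) \<Longrightarrow>
      (fst (fst z), D (fst (fst z))) \<in> up (parents ns) v \<and> snd z \<le> real s * D (fst (fst z))"
    and "v \<in> verts T \<Longrightarrow> y \<in> up (parents ns) v \<Longrightarrow> ((fst y, 0), real s * snd y) \<in> up N (v, 0)"
    and "v \<in> verts T \<Longrightarrow> 0 \<le> t \<Longrightarrow> real s * D v - real K * \<delta> \<le> t \<Longrightarrow> t \<le> real s * D v \<Longrightarrow>
      \<exists>z\<in>up N (v, 0). t \<le> snd z \<and> snd z \<le> t + \<delta>"
proof -
  have "d = D x" if "(x, u, d, e) \<in> set ns" for x u d e by (rule D[OF that])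
  note * = subdivide_rooted[OF T ns \<delta>, where D = D, OF this, unfolded cover]
  show "ordered N" by (rule *(1))
  show "v \<in> verts T \<Longrightarrow> z \<in> up N (v, 0) \<Longrightarrow>
      (fst (fst z), D (fst (fst z))) \<in> up (parents ns) v \<and> snd z \<le> real s * D (fst (fst z))"
    by (rule *(2))
  show "v \<in> verts T \<Longrightarrow> y \<in> up (parents ns) v \<Longrightarrow> ((fst y, 0), real s * snd y) \<in> up N (v, 0)"
    by (rule *(3))
  show "v \<in> verts T \<Longrightarrow> 0 \<le> t \<Longrightarrow> real s * D v - real K * \<delta> \<le> t \<Longrightarrow> t \<le> real s * D v \<Longrightarrow>
      \<exists>z\<in>up N (v, 0). t \<le> snd z \<and> snd z \<le> t + \<delta>"
    by (rule *(4))
qed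

lemma N_le: "v \<in> verts T \<Longrightarrow> z \<in> up N (v, 0) \<Longrightarrow> snd z \<le> real s * D v"
proof -
  assume v: "v \<in> verts T" and z: "z \<in> up N (v, 0)"
  note w = N_rooted(2)[OF v z]
  have "D (fst (fst z)) \<le> D v" using up_depth(3)[OF v conjunct1[OF w]] by simp
  then have "real s * D (fst (fst z)) \<le> real s * D v" by (rule mult_left_mono) simp
  with conjunct2[OF w] show ?thesis by linarith
qed

text \<open>A common ancestor in the subdivision belongs to the chain of some vertex, a common
  ancestor at least as deep, so it offers no shortcut. Conversely, the common ancestor realising the
  tree distance is itself a node of the subdivision.\<close>

lemma reach_iff:
  assumes "x \<in> verts T" "y \<in> verts T"
  shows "(\<exists>z\<in>up N (x, 0) \<inter> up N (y, 0). real s * D x + real s * D y - 2 * snd z \<le> c) \<longleftrightarrow>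
    real s * tree_dist T x y \<le> c"
proof
  assume "\<exists>z\<in>up N (x, 0) \<inter> up N (y, 0). real s * D x + real s * D y - 2 * snd z \<le> c"
  then obtain z where z: "z \<in> up N (x, 0)" "z \<in> up N (y, 0)" "real s * D x + real s * D y - 2 * snd z \<le> c"
    by blast
  let ?w = "fst (fst z)"
  note wx = N_rooted(2)[OF assms(1) z(1)] and wy = N_rooted(2)[OF assms(2) z(2)]
  have "(?w, D ?w) \<in> up (parents ns) x \<inter> up (parents ns) y" using wx wy by simp
  from dist(1)[OF assms this] have "tree_dist T x y \<le> D x + D y - 2 * D ?w" by simp
  then have "real s * tree_dist T x y \<le> real s * (D x + D y - 2 * D ?w)" by (rule mult_left_mono) simp
  also have "\<dots> = real s * D x + real s * D y - 2 * (real s * D ?w)" by (simp add: algebra_simps)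
  finally show "real s * tree_dist T x y \<le> c" using z(3) conjunct2[OF wx] by linarith
next
  assume c: "real s * tree_dist T x y \<le> c"
  obtain z where z: "z \<in> up (parents ns) x" "z \<in> up (parents ns) y"
    "tree_dist T x y = D x + D y - 2 * snd z" using dist(2)[OF assms] by blast
  have "real s * D x + real s * D y - 2 * (real s * snd z) \<le> c"
    using c unfolding z(3) by (simp add: algebra_simps)
  then show "\<exists>z\<in>up N (x, 0) \<inter> up N (y, 0). real s * D x + real s * D y - 2 * snd z \<le> c"
    using N_rooted(3)[OF assms(1) z(1)] N_rooted(3)[OF assms(2) z(2)]
    by (intro bexI[of _ "((fst z, 0), real s * snd z)"]) simp_all
qed

lemma N_nonneg:
  assumes "z \<in> up (subdivide K s \<delta> ns) p" shows "0 \<le> snd z"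
proof -
  obtain q where "(fst z, q, snd z) \<in> set (subdivide K s \<delta> ns)" using up_node[OF assms] by blast
  then obtain a where a: "a \<in> set ns" "(fst z, q, snd z) \<in> set (chain K s \<delta> a)"
    unfolding subdivide_def by auto
  obtain v u d e where ve: "a = (v, u, d, e)" by (cases a)
  have "0 \<le> e" using rooted_basic(4)[OF T ns] a(1) unfolding ve by blast
  moreover obtain h where "snd z = max (real s * e) h" using a(2) unfolding chain_def ve by auto
  ultimately show ?thesis by (simp add: le_max_iff_disj)
qed

lemma N_nonempty: "N \<noteq> []"
proof
  assume "N = []"
  then have "names ns \<times> {0..K} = {}" using subdivide_names[of K s \<delta> ns] by simp
  moreover have "verts T \<noteq> {}" using T unfolding weighted_tree_def by (elim conjE)
  ultimately show False unfolding cover by auto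
qed

lemma points_ok:
  assumes "set us \<subseteq> verts T" "p \<in> set (points s ns us)"
  shows "fst p \<in> fst ` set N" "z \<in> up N (fst p) \<Longrightarrow> snd z \<le> snd p"
proof -
  obtain u where u: "u \<in> set us" "p = ((u, 0), real s * D u)" using assms(2) unfolding points_def by auto
  have "u \<in> verts T" using u(1) assms(1) by blast
  then show "fst p \<in> fst ` set N" unfolding subdivide_names cover u(2) by simp
  show "z \<in> up N (fst p) \<Longrightarrow> snd z \<le> snd p" using N_le[OF \<open>u \<in> verts T\<close>] unfolding u(2) by simp
qed

lemma sites_ok:
  assumes "p \<in> set (sites N)"
  shows "fst p \<in> fst ` set N" "z \<in> up N (fst p) \<Longrightarrow> snd z \<le> snd p"
proof -
  obtain a where a: "a \<in> set N" "p = (fst a, snd (snd a))" using assms unfolding sites_def by auto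
  then show "fst p \<in> fst ` set N" by simp
  have "(fst a, fst (snd a), snd (snd a)) \<in> set N" using a(1) by simp
  from up_self[OF N_rooted(1) this] show "z \<in> up N (fst p) \<Longrightarrow> snd z \<le> snd p" unfolding a(2) by simp
qed

end

lemma cluster_sites_ok:
  assumes "0 \<le> b" "p \<in> set (cluster_sites M ns b)"
  shows "fst p \<in> fst ` set (subdivide M (2 * M) b ns)"
    "z \<in> up (subdivide M (2 * M) b ns) (fst p) \<Longrightarrow> snd z \<le> snd p"
  using sites_ok[OF assms(1), of p M "2 * M"] assms(2) unfolding cluster_sites_def by simp_all

text \<open>Lengths are scaled by \<open>M\<close>, so the guarantee \<open>real (M + 5) * b\<close>
  becomes \<open>(1 + 5 / real M) * b\<close>.\<close>

lemma gather_solve_sound: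
  assumes us: "set us \<subseteq> verts T" "set fs \<subseteq> verts T" and b: "0 \<le> b" and M: "0 < M"
    and m: "m \<in> set (gather_solve M ns us fs r b)"
  shows "gathering_feasible {..<length us} {..<length fs} r (assigned m)"
    and "i < length us \<Longrightarrow> tree_dist T (us ! i) (fs ! assigned m i) \<le> (1 + 5 / real M) * b"
proof -
  let ?N = "subdivide 0 M b ns"
  interpret gi: gathering_instance M r b ?N "points M ns us" "points M ns fs"
    by (rule gathering_instance.intro[OF b N_rooted(1)[OF b] N_nonempty[OF b] points_ok[OF b us(1)] points_ok[OF b us(2)]])
  have len: "length (points M ns us) = length us" "length (points M ns fs) = length fs"
    by (simp_all add: points_def)
  note m' = m[unfolded gather_solve_def]
  show f: "gathering_feasible {..<length us} {..<length fs} r (assigned m)"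
    using gi.solve_sound(1)[OF m'] unfolding len .
  show "tree_dist T (us ! i) (fs ! assigned m i) \<le> (1 + 5 / real M) * b" if i: "i < length us"
  proof -
    let ?j = "assigned m i"
    have j: "?j < length fs" using f i unfolding gathering_feasible_def by simp
    have v: "us ! i \<in> verts T" "fs ! ?j \<in> verts T" using us i j nth_mem by blast+
    have nth: "points M ns us ! i = ((us ! i, 0), real M * D (us ! i))"
      "points M ns fs ! ?j = ((fs ! ?j, 0), real M * D (fs ! ?j))"
      using i j by (simp_all add: points_def)
    have "gi.reaches (real (M + 5) * b) i ?j" using gi.solve_sound(2)[OF m', of i] i len by simp
    then have "real M * tree_dist T (us ! i) (fs ! ?j) \<le> real (M + 5) * b"
      unfolding gi.reaches_def nth fst_conv snd_conv reach_iff[OF b v] .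
    then show ?thesis using M by (simp add: field_simps)
  qed
qed

lemma gather_solve_complete:
  assumes us: "set us \<subseteq> verts T" "set fs \<subseteq> verts T" and b: "0 \<le> b"
    and \<pi>: "gathering_feasible {..<length us} {..<length fs} r \<pi>"
    and d: "\<And>i. i < length us \<Longrightarrow> tree_dist T (us ! i) (fs ! \<pi> i) \<le> b"
  shows "gather_solve M ns us fs r b \<noteq> []"
proof -
  let ?N = "subdivide 0 M b ns"
  interpret gi: gathering_instance M r b ?N "points M ns us" "points M ns fs"
    by (rule gathering_instance.intro[OF b N_rooted(1)[OF b] N_nonempty[OF b] points_ok[OF b us(1)] points_ok[OF b us(2)]])
  have len: "length (points M ns us) = length us" "length (points M ns fs) = length fs"
    by (simp_all add: points_def)
  show ?thesis
    unfolding gather_solve_def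
  proof (rule gi.solve_complete[of \<pi>])
    show "gathering_feasible {..<length (points M ns us)} {..<length (points M ns fs)} r \<pi>"
      unfolding len by (rule \<pi>)
    fix i assume "i < length (points M ns us)"
    then have i: "i < length us" unfolding len .
    have j: "\<pi> i < length fs" using \<pi> i unfolding gathering_feasible_def by simp
    have v: "us ! i \<in> verts T" "fs ! \<pi> i \<in> verts T" using us i j nth_mem by blast+
    have "real M * tree_dist T (us ! i) (fs ! \<pi> i) \<le> real M * b" by (rule mult_left_mono[OF d[OF i]]) simp
    also have "\<dots> \<le> real (M + 1) * b" using b by (simp add: algebra_simps)
    finally show "gi.reaches (real (M + 1) * b) i (\<pi> i)"
      unfolding gi.reaches_def using i j by (simp add: points_def reach_iff[OF b v])
  qed
qed

text \<open>Two users of one class reach the site through ancestors \<open>z\<close> and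
  \<open>z'\<close> of the site. The higher of the two is a common ancestor of both users. As the
  site is at least as deep as \<open>z\<close> and \<open>z'\<close>, adding the two estimates
  bounds the distance by \<open>2 * ?R\<close> in lengths scaled by \<open>2 * M\<close>.\<close>

lemma cluster_solve_sound:
  assumes us: "set us \<subseteq> verts T" and b: "0 \<le> b" and M: "0 < M"
    and m: "m \<in> set (cluster_solve M ns us r b)"
  shows "gathering_feasible {..<length us} {..<length (cluster_sites M ns b)} r (assigned m)"
    and "i < length us \<Longrightarrow> k < length us \<Longrightarrow> assigned m i = assigned m k \<Longrightarrow>
      tree_dist T (us ! i) (us ! k) \<le> (1 + 5 / real M) * b"
proof -
  let ?N = "subdivide M (2 * M) b ns" and ?s = "2 * M"
  interpret gi: gathering_instance M r b ?N "points ?s ns us" "cluster_sites M ns b"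
    by (rule gathering_instance.intro[OF b N_rooted(1)[OF b] N_nonempty[OF b] points_ok[OF b us] cluster_sites_ok[OF b]])
  have len: "length (points ?s ns us) = length us"
    by (simp add: points_def)
  note m' = m[unfolded cluster_solve_def]
  show f: "gathering_feasible {..<length us} {..<length (cluster_sites M ns b)} r (assigned m)"
    using gi.solve_sound(1)[OF m'] unfolding len .
  show "tree_dist T (us ! i) (us ! k) \<le> (1 + 5 / real M) * b"
    if i: "i < length us" and k: "k < length us" and ik: "assigned m i = assigned m k"
  proof -
    let ?R = "real (M + 5) * b" and ?f = "cluster_sites M ns b ! assigned m i"
    have j: "assigned m i < length (cluster_sites M ns b)" using f i unfolding gathering_feasible_def by simp
    have v: "us ! i \<in> verts T" "us ! k \<in> verts T" using us i k nth_mem by blast+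
    have "gi.reaches ?R i (assigned m i)" "gi.reaches ?R k (assigned m i)"
      using gi.solve_sound(2)[OF m', of i] gi.solve_sound(2)[OF m', of k] i k ik len by simp_all
    then obtain z z' where
      z: "z \<in> up ?N (us ! i, 0)" "z \<in> up ?N (fst ?f)" "real ?s * D (us ! i) + snd ?f - 2 * snd z \<le> ?R" and
      z': "z' \<in> up ?N (us ! k, 0)" "z' \<in> up ?N (fst ?f)" "real ?s * D (us ! k) + snd ?f - 2 * snd z' \<le> ?R"
      unfolding gi.reaches_def using i k by (auto simp: points_def)
    have zf: "snd z \<le> snd ?f" "snd z' \<le> snd ?f"
      using cluster_sites_ok(2)[OF b nth_mem[OF j]] z(2) z'(2) by blast+
    have ord: "ordered ?N" by (rule N_rooted(1)[OF b])
    have "\<exists>y\<in>up ?N (us ! i, 0) \<inter> up ?N (us ! k, 0). y = z \<or> y = z'"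
      using up_linear[OF ord z(2) z'(2)]
    proof
      assume "z \<in> up ?N (fst z')"
      then have "z \<in> up ?N (us ! k, 0)" using up_trans[OF ord z'(1)] by blast
      with z(1) show ?thesis by blast
    next
      assume "z' \<in> up ?N (fst z)"
      then have "z' \<in> up ?N (us ! i, 0)" using up_trans[OF ord z(1)] by blast
      with z'(1) show ?thesis by blast
    qed
    then obtain y where y: "y \<in> up ?N (us ! i, 0) \<inter> up ?N (us ! k, 0)" "y = z \<or> y = z'" by blast
    have "real ?s * D (us ! i) + real ?s * D (us ! k) - 2 * snd y \<le> 2 * ?R"
      using y(2)
    proof
      assume y: "y = z"
      show ?thesis unfolding y using z(3) z'(3) zf by linarith
    next
      assume y: "y = z'"
      show ?thesis unfolding y using z(3) z'(3) zf by linarith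
    qed
    with y(1) have "\<exists>y\<in>up ?N (us ! i, 0) \<inter> up ?N (us ! k, 0).
        real ?s * D (us ! i) + real ?s * D (us ! k) - 2 * snd y \<le> 2 * ?R" by blast
    then have "real ?s * tree_dist T (us ! i) (us ! k) \<le> 2 * ?R"
      unfolding reach_iff[OF b v] .
    then show ?thesis using M by (simp add: field_simps)
  qed
qed

text \<open>A cluster of diameter at most \<open>b\<close> lies within distance \<open>b / 2\<close> of the point at height
  \<open>b / 2\<close> above its deepest user. With all lengths scaled by \<open>2 * M\<close> that radius is \<open>M * b\<close>, and
  the subdivision has a node at most \<open>b\<close> below that point.\<close>

lemma cluster_site:
  assumes us: "set us \<subseteq> verts T" and b: "0 \<le> b" and C: "C \<subseteq> {..<length us}" "C \<noteq> {}"
    and d: "\<And>i k. i \<in> C \<Longrightarrow> k \<in> C \<Longrightarrow> tree_dist T (us ! i) (us ! k) \<le> b"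
  shows "\<exists>j<length (cluster_sites M ns b). \<forall>i\<in>C.
    \<exists>z\<in>up (subdivide M (2 * M) b ns) (us ! i, 0) \<inter>
        up (subdivide M (2 * M) b ns) (fst (cluster_sites M ns b ! j)).
      real (2 * M) * D (us ! i) + snd (cluster_sites M ns b ! j) - 2 * snd z \<le> real (M + 1) * b"
proof -
  let ?N = "subdivide M (2 * M) b ns" and ?s = "2 * M"
  have finC: "finite C" using C(1) finite_subset by blast
  have V: "us ! i \<in> verts T" if "i \<in> C" for i
  proof -
    have "i < length us" using C(1) that by blast
    then show ?thesis using us nth_mem by blast
  qed
  have "Max ((\<lambda>i. D (us ! i)) ` C) \<in> (\<lambda>i. D (us ! i)) ` C"
    by (rule Max_in) (use finC C(2) in simp_all)
  then obtain p where p: "p \<in> C" "D (us ! p) = Max ((\<lambda>i. D (us ! i)) ` C)" by auto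
  have deep: "D (us ! i) \<le> D (us ! p)" if "i \<in> C" for i
    unfolding p(2) by (rule Max_ge) (use finC that in simp_all)
  \<comment> \<open>The maximum covers the case that the wanted height exceeds the depth of
    \<open>p\<close>; the root then takes the place of the centre.\<close>
  define t where "t = max 0 (real ?s * D (us ! p) - real M * b)"
  have Dp: "0 \<le> real ?s * D (us ! p)" using depth_nonneg[OF V[OF p(1)]] by simp
  have Mb: "0 \<le> real M * b" using b by simp
  have t: "0 \<le> t" "real ?s * D (us ! p) - real M * b \<le> t" "t \<le> real ?s * D (us ! p)"
    unfolding t_def using Dp Mb by simp_all
  obtain f where f: "f \<in> up ?N (us ! p, 0)" "t \<le> snd f" "snd f \<le> t + b"
    using N_rooted(4)[OF b V[OF p(1)] t] by blast
  obtain q where q: "(fst f, q, snd f) \<in> set ?N" using up_node[OF f(1)] by blast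
  then have "f \<in> set (cluster_sites M ns b)" unfolding cluster_sites_def sites_def by force
  then obtain j where j: "j < length (cluster_sites M ns b)" "cluster_sites M ns b ! j = f" by (auto simp: in_set_conv_nth)
  have ord: "ordered ?N" by (rule N_rooted(1)[OF b])
  have ff: "f \<in> up ?N (fst f)" using up_self[OF ord q] by simp
  have "\<exists>z\<in>up ?N (us ! i, 0) \<inter> up ?N (fst f). real ?s * D (us ! i) + snd f - 2 * snd z \<le> real (M + 1) * b"
    if i: "i \<in> C" for i
  proof -
    have "real ?s * tree_dist T (us ! p) (us ! i) \<le> real ?s * b"
      by (rule mult_left_mono[OF d[OF p(1) i]]) simp
    from iffD2[OF reach_iff[OF b V[OF p(1)] V[OF i]] this] obtain a where a: "a \<in> up ?N (us ! p, 0)" "a \<in> up ?N (us ! i, 0)"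
      "real ?s * D (us ! p) + real ?s * D (us ! i) - 2 * snd a \<le> real ?s * b"
      by blast
    have sD: "real ?s * D (us ! i) \<le> real ?s * D (us ! p)"
      by (rule mult_left_mono[OF deep[OF i]]) simp
    \<comment> \<open>If \<open>f\<close> lies above \<open>a\<close>, user \<open>i\<close> is no
      farther from \<open>f\<close> than \<open>p\<close> is, being no deeper. Otherwise
      \<open>a\<close> lies above \<open>f\<close>; the diameter bound gives the estimate when the
      centre is at depth \<open>t > 0\<close>, with \<open>b\<close> added for the offset of
      \<open>f\<close>, and for \<open>t = 0\<close> small depths do.\<close>
    show ?thesis
    proof (cases "f \<in> up ?N (fst a)")
      case True
      then have "f \<in> up ?N (us ! i, 0)" using up_trans[OF ord a(2)] by blast
      moreover have "real ?s * D (us ! i) + snd f - 2 * snd f \<le> real (M + 1) * b"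
        using sD f(2) t(2) b by (simp add: algebra_simps)
      ultimately show ?thesis using ff by blast
    next
      case False
      then have af: "a \<in> up ?N (fst f)" using up_linear[OF ord a(1) f(1)] by blast
      have a0: "0 \<le> snd a"
        by (rule N_nonneg[OF b a(1)])
      have "real ?s * D (us ! i) + snd f - 2 * snd a \<le> real (M + 1) * b"
      proof (cases "t = 0")
        case True
        then have "real ?s * D (us ! p) \<le> real M * b" using t(2) by simp
        with True f(3) a0 sD show ?thesis by (simp add: algebra_simps)
      next
        case False
        then have "t = real ?s * D (us ! p) - real M * b" unfolding t_def by (simp add: max_def split: if_splits)
        with f(3) a(3) show ?thesis by (simp add: algebra_simps)
      qed
      with a(2) af show ?thesis by blast
    qed
  qed
  with j show ?thesis by blast
qed

text \<open>Each cluster is sent to one site near all of its members. Clusters may share a site,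
  whose load is still at least the size of one of them and hence at least \<open>r\<close>.\<close>

lemma cluster_solve_complete:
  assumes us: "set us \<subseteq> verts T" and b: "0 \<le> b" and r: "0 < r"
    and P: "clustering_feasible {..<length us} r P"
    and d: "\<And>C i k. C \<in> P \<Longrightarrow> i \<in> C \<Longrightarrow> k \<in> C \<Longrightarrow> tree_dist T (us ! i) (us ! k) \<le> b"
  shows "cluster_solve M ns us r b \<noteq> []"
proof -
  let ?N = "subdivide M (2 * M) b ns" and ?s = "2 * M"
  interpret gi: gathering_instance M r b ?N "points ?s ns us" "cluster_sites M ns b"
    by (rule gathering_instance.intro[OF b N_rooted(1)[OF b] N_nonempty[OF b] points_ok[OF b us] cluster_sites_ok[OF b]])
  have len: "length (points ?s ns us) = length us"
    by (simp add: points_def)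
  have part: "partition_on {..<length us} P" and card: "\<And>C. C \<in> P \<Longrightarrow> r \<le> card C"
    using P unfolding clustering_feasible_def by blast+
  have sub: "C \<subseteq> {..<length us}" "C \<noteq> {}" if "C \<in> P" for C
    using partition_onD1[OF part] partition_onD3[OF part] that by blast+
  let ?good = "\<lambda>C j. j < length (cluster_sites M ns b) \<and> (\<forall>i\<in>C. \<exists>z\<in>up ?N (us ! i, 0) \<inter> up ?N (fst (cluster_sites M ns b ! j)).
      real ?s * D (us ! i) + snd (cluster_sites M ns b ! j) - 2 * snd z \<le> real (M + 1) * b)"
  have "\<exists>j. ?good C j" if "C \<in> P" for C
    using cluster_site[OF us b sub[OF that] d[OF that]] by blast
  then obtain h where h: "\<And>C. C \<in> P \<Longrightarrow> ?good C (h C)" by metis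
  have "\<exists>C\<in>P. i \<in> C" if "i < length us" for i
    using partition_onD1[OF part] that by blast
  then obtain c where c: "\<And>i. i < length us \<Longrightarrow> c i \<in> P \<and> i \<in> c i" by metis
  have ceq: "c i = C" if "C \<in> P" "i \<in> C" for C i
  proof -
    have "i < length us" using sub(1)[OF that(1)] that(2) by blast
    then have ci: "c i \<in> P" "i \<in> c i" using c by blast+
    show ?thesis
    proof (rule ccontr)
      assume "c i \<noteq> C"
      then have "c i \<inter> C = {}" using partition_onD2[OF part] ci(1) that(1) unfolding disjoint_def by blast
      then show False using ci(2) that(2) by blast
    qed
  qed
  let ?\<pi> = "\<lambda>i. h (c i)"
  show ?thesis
    unfolding cluster_solve_def
  proof (rule gi.solve_complete[of ?\<pi>])
    show "gathering_feasible {..<length (points ?s ns us)} {..<length (cluster_sites M ns b)} r ?\<pi>"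
      unfolding gathering_feasible_def len
    proof (intro conjI ballI)
      fix i assume "i \<in> {..<length us}"
      then show "?\<pi> i \<in> {..<length (cluster_sites M ns b)}" using h c by simp
    next
      fix j
      let ?A = "{i \<in> {..<length us}. ?\<pi> i = j}"
      show "card ?A = 0 \<or> r \<le> card ?A"
      proof (cases "?A = {}")
        case False
        then obtain i where i: "i < length us" "?\<pi> i = j" by blast
        have "c i \<subseteq> ?A"
        proof
          fix k assume k: "k \<in> c i"
          have "c k = c i" using ceq k c[OF i(1)] by blast
          moreover have "k < length us" using sub(1) c[OF i(1)] k by blast
          ultimately show "k \<in> ?A" using i(2) by simp
        qed
        then have "card (c i) \<le> card ?A" by (intro card_mono) simp_all
        then show ?thesis using card[of "c i"] c[OF i(1)] by simp
      qed (simp only: card.empty, simp)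
    qed
    fix i assume "i < length (points ?s ns us)"
    then have i: "i < length us" unfolding len .
    have "?good (c i) (?\<pi> i)" using h c[OF i] by blast
    then show "gi.reaches (real (M + 1) * b) i (?\<pi> i)"
      unfolding gi.reaches_def using c[OF i] i by (simp add: points_def)
  qed
qed

end

text \<open>The program may depend on \<open>\<epsilon>\<close>, so \<open>M\<close> is chosen above
  \<open>5 / \<epsilon>\<close>, and polynomial time is needed for each fixed \<open>M\<close>
  only.\<close>

lemma has_PTASI:
  fixes Q :: "('i, 's) min_problem" and f :: "nat \<Rightarrow> 'a::encodable \<Rightarrow> 'b::encodable"
  assumes f: "\<And>M. polytime (f M)"
    and approx: "\<And>\<epsilon> M I x. 0 < M \<Longrightarrow> 5 / real M \<le> \<epsilon> \<Longrightarrow> I \<in> instances Q \<Longrightarrow> encodes Q I x \<Longrightarrow>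
      \<exists>a. x = enc a \<and> ((\<exists>s. feasible Q I s) \<longrightarrow>
        (\<exists>s. sol_encodes Q I s (enc (f M a)) \<and> feasible Q I s \<and> cost Q I s \<le> (1 + \<epsilon>) * OPT Q I))"
  shows "has_PTAS Q"
  unfolding has_PTAS_def
proof (intro allI impI)
  fix \<epsilon> :: real assume \<epsilon>: "\<epsilon> > 0"
  obtain M :: nat where M: "5 / \<epsilon> < real M" using reals_Archimedean2 by blast
  moreover have "0 < 5 / \<epsilon>" using \<epsilon> by simp
  ultimately have M0: "0 < M" by (metis less_trans of_nat_0_less_iff)
  have M': "5 / real M \<le> \<epsilon>" using M M0 \<epsilon> by (simp add: field_simps)
  obtain P p where P: "computes P 0 (f M) p" using f unfolding polytime_def by blast
  have run: "\<exists>t. runs P (enc a) (enc (f M a)) t \<and> t \<le> poly p (vsize (enc a))" for a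
    using P unfolding computes_def runs_def by fastforce
  have "\<exists>y t. runs P x y t \<and> t \<le> poly p (vsize x) \<and> ((\<exists>s. feasible Q I s) \<longrightarrow>
      (\<exists>s. sol_encodes Q I s y \<and> feasible Q I s \<and> cost Q I s \<le> (1 + \<epsilon>) * OPT Q I))"
    if I: "I \<in> instances Q" and x: "encodes Q I x" for I x
  proof -
    obtain a where a: "x = enc a" "(\<exists>s. feasible Q I s) \<longrightarrow>
      (\<exists>s. sol_encodes Q I s (enc (f M a)) \<and> feasible Q I s \<and> cost Q I s \<le> (1 + \<epsilon>) * OPT Q I)"
      using approx[OF M0 M' I x] by blast
    obtain t where "runs P (enc a) (enc (f M a)) t" "t \<le> poly p (vsize (enc a))" using run by blast
    with a show ?thesis by blast
  qed
  then show "\<exists>P q. \<forall>I\<in>instances Q. \<forall>x. encodes Q I x \<longrightarrow> (\<exists>y t. runs P x y t \<and> t \<le> poly q (vsize x) \<and>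
      ((\<exists>s. feasible Q I s) \<longrightarrow>
      (\<exists>s. sol_encodes Q I s y \<and> feasible Q I s \<and> cost Q I s \<le> (1 + \<epsilon>) * OPT Q I)))"
    by blast
qed

lemma tree_encodes_enc:
  assumes "weighted_tree T" "tree_encodes T z"
  obtains t where "z = enc (t :: nat list \<times> (nat \<times> nat \<times> real) list)" "tree_instance T (root_tree t)"
proof -
  obtain vs es where vs: "distinct vs" "set vs = verts T"
    and es: "(\<lambda>(u, v). {u, v}) ` set es = edges T"
    and z: "z = VPair (val_of_list val_of_nat vs) (val_of_list
      (\<lambda>(u, v). VPair (val_of_nat u) (VPair (val_of_nat v) (VNum (len T {u, v})))) es)"
    using assms(2) unfolding tree_encodes_def by blast
  have 1: "val_of_list val_of_nat vs = enc vs"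
    by (simp add: enc_list_def enc_nat_def)
  have 2: "val_of_list (\<lambda>(u, v). VPair (val_of_nat u) (VPair (val_of_nat v) (VNum (len T {u, v})))) es =
      enc (edge_list T es)"
    by (induction es) (auto simp: edge_list_def val_of_list_def enc_nat_def val_of_nat_def)
  have "z = enc (vs, edge_list T es)" unfolding z 1 2 by simp
  moreover have "tree_instance T (root_tree (vs, edge_list T es))"
    using root_tree[OF assms(1) vs(2,1) es] assms(1) by (intro tree_instance.intro)
  ultimately show ?thesis by (rule that)
qed

section \<open>Comparison with the optimum\<close>

lemma gathering_cost_le_iff:
  "finite U \<Longrightarrow> gathering_cost d U \<pi> \<le> c \<longleftrightarrow> 0 \<le> c \<and> (\<forall>u\<in>U. d u (\<pi> u) \<le> c)"
  unfolding gathering_cost_def by simp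

lemma cluster_diam_le_iff:
  "finite C \<Longrightarrow> C \<noteq> {} \<Longrightarrow> cluster_diam d C \<le> c \<longleftrightarrow> (\<forall>u\<in>C. \<forall>v\<in>C. d u v \<le> c)"
  unfolding cluster_diam_def by (subst Max_le_iff) auto

lemma clustering_cost_le_iff:
  assumes "partition_on U P" "finite U"
  shows "clustering_cost d P \<le> c \<longleftrightarrow> 0 \<le> c \<and> (\<forall>C\<in>P. \<forall>u\<in>C. \<forall>v\<in>C. d u v \<le> c)"
proof -
  have P: "finite P" using finite_elements[OF assms(2,1)] .
  have C: "cluster_diam d C \<le> c \<longleftrightarrow> (\<forall>u\<in>C. \<forall>v\<in>C. d u v \<le> c)" if "C \<in> P" for C
  proof (rule cluster_diam_le_iff)
    show "finite C" using partition_onD1[OF assms(1)] assms(2) that by (metis Sup_upper finite_subset)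
    show "C \<noteq> {}" using partition_onD3[OF assms(1)] that by metis
  qed
  show ?thesis unfolding clustering_cost_def using P C by simp
qed

context tree_instance
begin

text \<open>The optimum is attained and is a threshold \<open>b\<close>, so the attempt with
  \<open>b\<close> succeeds. The selected attempt has a bound of at most \<open>b\<close>, and
  soundness for that bound gives the estimate.\<close>

lemma gather_correct:
  assumes us: "set us \<subseteq> verts T" "set fs \<subseteq> verts T" and M: "0 < M" "5 / real M \<le> \<epsilon>"
    and feas: "gathering_feasible {..<length us} {..<length fs} r \<pi>0"
  defines "c \<equiv> gathering_cost (\<lambda>u f. tree_dist T (us ! u) (fs ! f)) {..<length us}"
  shows "\<exists>\<pi>. gather M ns us fs r = map \<pi> [0..<length us] \<and>
    gathering_feasible {..<length us} {..<length fs} r \<pi> \<and>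
    c \<pi> \<le> (1 + \<epsilon>) * (INF \<pi>\<in>{\<pi>. gathering_feasible {..<length us} {..<length fs} r \<pi>}. c \<pi>)"
proof -
  let ?S = "{\<pi>. gathering_feasible {..<length us} {..<length fs} r \<pi>}"
  let ?d = "\<lambda>u f. tree_dist T (us ! u) (fs ! f)"
  have v: "us ! i \<in> verts T" if "i < length us" for i using us(1) that by (meson nth_mem subsetD)
  have v': "fs ! j \<in> verts T" if "j < length fs" for j using us(2) that by (meson nth_mem subsetD)
  obtain x where x: "x \<in> verts T" using T unfolding weighted_tree_def by blast
  have "c \<pi> \<in> set (thresholds ns)" if "\<pi> \<in> ?S" for \<pi>
  proof -
    have "c \<pi> \<in> insert 0 ((\<lambda>u. ?d u (\<pi> u)) ` {..<length us})"
      unfolding c_def gathering_cost_def by (rule Max_in) simp_all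
    moreover have "?d u (\<pi> u) \<in> set (thresholds ns)" if "u < length us" for u
    proof (rule threshold(1)[OF v v'])
      show "\<pi> u < length fs" using \<open>\<pi> \<in> ?S\<close> that unfolding gathering_feasible_def by simp
    qed (rule that)
    moreover have "0 \<in> set (thresholds ns)" by (rule threshold(2)[OF x x])
    ultimately show ?thesis by auto
  qed
  then obtain \<pi>1 where \<pi>1: "\<pi>1 \<in> ?S" "c \<pi>1 = (INF \<pi>\<in>?S. c \<pi>)" "c \<pi>1 \<in> set (thresholds ns)"
    using INF_attained[of "set (thresholds ns)" ?S c] feas by blast
  define b where "b = c \<pi>1"
  have b: "0 \<le> b" "\<And>i. i < length us \<Longrightarrow> ?d i (\<pi>1 i) \<le> b"
    using gathering_cost_le_iff[of "{..<length us}" ?d \<pi>1 b] unfolding b_def c_def by simp_all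
  have "gather_solve M ns us fs r b \<noteq> []"
    using gather_solve_complete[OF us b(1) _ b(2)] \<pi>1(1) by simp
  with \<pi>1(3) obtain s ss where s: "best (attempts (gather_solve M ns us fs r) ns) = s # ss"
    and s0: "0 \<le> fst s" and sb: "fst s \<le> b" and m: "snd s \<in> set (gather_solve M ns us fs r (fst s))"
    unfolding b_def by (rule best_attempt)
  note sound = gather_solve_sound[OF us s0 M(1) m]
  have "0 \<le> 5 / real M" by simp
  then have "0 \<le> 1 + \<epsilon>" using M(2) by linarith
  then have "(1 + 5 / real M) * fst s \<le> (1 + \<epsilon>) * b"
    using M(2) sb s0 by (intro mult_mono) simp_all
  moreover have "0 \<le> (1 + 5 / real M) * fst s" using s0 by simp
  ultimately have "c (assigned (snd s)) \<le> (1 + \<epsilon>) * b"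
    unfolding c_def using sound(2) by (subst gathering_cost_le_iff) (auto intro: order_trans)
  moreover have "gather M ns us fs r = map (assigned (snd s)) [0..<length us]"
    unfolding gather_def s by simp
  ultimately show ?thesis using sound(1) unfolding b_def \<pi>1(2) by blast
qed

lemma cluster_correct:
  assumes us: "set us \<subseteq> verts T" and r: "0 < r" and M: "0 < M" "5 / real M \<le> \<epsilon>"
    and feas: "clustering_feasible {..<length us} r P0"
  defines "c \<equiv> clustering_cost (\<lambda>u v. tree_dist T (us ! u) (us ! v))"
  shows "clustering_feasible {..<length us} r (set ` set (cluster M ns us r)) \<and>
    c (set ` set (cluster M ns us r)) \<le> (1 + \<epsilon>) * (INF P\<in>{P. clustering_feasible {..<length us} r P}. c P)"
proof -
  let ?U = "{..<length us}"
  let ?S = "{P. clustering_feasible ?U r P}"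
  let ?d = "\<lambda>u v. tree_dist T (us ! u) (us ! v)"
  have v: "us ! i \<in> verts T" if "i < length us" for i using us that by (meson nth_mem subsetD)
  obtain x where x: "x \<in> verts T" using T unfolding weighted_tree_def by blast
  have part: "partition_on ?U P" if "P \<in> ?S" for P using that unfolding clustering_feasible_def by blast
  have "c P \<in> set (thresholds ns)" if P: "P \<in> ?S" for P
  proof -
    have "finite P" using finite_elements[OF _ part[OF P]] by simp
    then have "c P \<in> insert 0 (cluster_diam ?d ` P)"
      unfolding c_def clustering_cost_def by (intro Max_in) simp_all
    moreover have "cluster_diam ?d C \<in> set (thresholds ns)" if C: "C \<in> P" for C
    proof -
      have sub: "C \<subseteq> ?U" "C \<noteq> {}"
        using partition_onD1[OF part[OF P]] partition_onD3[OF part[OF P]] C by blast+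
      have fin: "finite C" using sub(1) finite_subset by blast
      have "cluster_diam ?d C \<in> (\<lambda>(u, v). ?d u v) ` (C \<times> C)"
        unfolding cluster_diam_def by (rule Max_in) (use fin sub(2) in simp_all)
      then obtain u w where uw: "u \<in> C" "w \<in> C" "cluster_diam ?d C = ?d u w" by auto
      have "u < length us" "w < length us" using uw(1,2) sub(1) by blast+
      then show ?thesis unfolding uw(3) by (intro threshold(1) v)
    qed
    moreover have "0 \<in> set (thresholds ns)" by (rule threshold(2)[OF x x])
    ultimately show ?thesis by auto
  qed
  then obtain P1 where P1: "P1 \<in> ?S" "c P1 = (INF P\<in>?S. c P)" "c P1 \<in> set (thresholds ns)"
    using INF_attained[of "set (thresholds ns)" ?S c] feas by blast
  define b where "b = c P1"
  have "0 \<le> b \<and> (\<forall>C\<in>P1. \<forall>u\<in>C. \<forall>v\<in>C. ?d u v \<le> b)"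
    using clustering_cost_le_iff[OF part[OF P1(1)], of ?d b] unfolding b_def c_def by simp
  then have b: "0 \<le> b" "\<And>C i k. C \<in> P1 \<Longrightarrow> i \<in> C \<Longrightarrow> k \<in> C \<Longrightarrow> ?d i k \<le> b" by blast+
  have "cluster_solve M ns us r b \<noteq> []"
    using cluster_solve_complete[OF us b(1) r _ b(2)] P1(1) by simp
  with P1(3) obtain s ss where s: "best (attempts (cluster_solve M ns us r) ns) = s # ss"
    and s0: "0 \<le> fst s" and sb: "fst s \<le> b" and m: "snd s \<in> set (cluster_solve M ns us r (fst s))"
    unfolding b_def by (rule best_attempt)
  note sound = cluster_solve_sound[OF us s0 M(1) m]
  let ?a = "assigned (snd s)" and ?k = "length (cluster_sites M ns (fst s))"
  let ?class = "\<lambda>j. {i \<in> ?U. ?a i = j}"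
  \<comment> \<open>Sites without users are left out, since a partition has no empty block.\<close>
  define Q where "Q = {C. C \<noteq> {} \<and> (\<exists>j<?k. C = ?class j)}"
  have Q: "set ` set (cluster M ns us r) = Q"
  proof -
    let ?l = "\<lambda>j. filter (\<lambda>i. ?a i = j) [0..<length us]"
    have l: "set (?l j) = ?class j" for j by (simp add: lessThan_atLeast0)
    have css: "cluster M ns us r = filter (\<lambda>c. c \<noteq> []) (map ?l [0..<?k])"
      unfolding cluster_def s by simp
    show ?thesis
    proof (intro set_eqI iffI)
      fix C assume "C \<in> set ` set (cluster M ns us r)"
      then obtain j where j: "j < ?k" "?l j \<noteq> []" "C = set (?l j)"
        unfolding css set_filter set_map by (auto simp del: filter_empty_conv filter_False)
      then have "C \<noteq> {}" by (simp only: set_empty not_False_eq_True)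
      then show "C \<in> Q" using j(1,3) unfolding Q_def l by blast
    next
      fix C assume "C \<in> Q"
      then obtain j where j: "C \<noteq> {}" "j < ?k" "C = ?class j" unfolding Q_def by blast
      have "?l j \<noteq> []" using j(1) unfolding j(3) l[symmetric] by (simp only: set_empty not_False_eq_True)
      then have "?l j \<in> set (cluster M ns us r)" unfolding css set_filter set_map using j(2) by simp
      then show "C \<in> set ` set (cluster M ns us r)" unfolding j(3) l[symmetric] by (rule imageI)
    qed
  qed
  have a: "?a i < ?k" if "i < length us" for i
    using sound(1) that unfolding gathering_feasible_def by simp
  have pQ: "partition_on ?U Q"
    unfolding partition_on_def
  proof (intro conjI)
    show "\<Union> Q = ?U"
    proof
      show "?U \<subseteq> \<Union> Q"
      proof
        fix i assume i: "i \<in> ?U"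
        then have "i \<in> ?class (?a i)" by simp
        moreover have "?class (?a i) \<in> Q"
          unfolding Q_def using a[of i] i calculation by (intro CollectI conjI exI[of _ "?a i"]) auto
        ultimately show "i \<in> \<Union> Q" by (rule UnionI[rotated])
      qed
      show "\<Union> Q \<subseteq> ?U" unfolding Q_def by blast
    qed
    show "disjoint Q"
      unfolding disjoint_def
    proof (intro ballI impI)
      fix C C' assume C: "C \<in> Q" "C' \<in> Q" "C \<noteq> C'"
      obtain j where j: "C = ?class j" using C(1) unfolding Q_def by blast
      obtain j' where j': "C' = ?class j'" using C(2) unfolding Q_def by blast
      have "j \<noteq> j'" using C(3) unfolding j j' by (rule contrapos_nn) simp
      then show "C \<inter> C' = {}" unfolding j j' by (simp add: disjoint_iff)
    qed
    show "{} \<notin> Q" unfolding Q_def by simp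
  qed
  have "r \<le> card C" if "C \<in> Q" for C
  proof -
    obtain j where j: "C \<noteq> {}" "j < ?k" "C = ?class j" using \<open>C \<in> Q\<close> unfolding Q_def by blast
    have "card C = 0 \<or> r \<le> card C"
      using sound(1) j(2) unfolding gathering_feasible_def j(3) by simp
    moreover have "finite C" unfolding j(3) by simp
    ultimately show ?thesis using j(1) by simp
  qed
  with pQ have fQ: "clustering_feasible ?U r Q" unfolding clustering_feasible_def by blast
  have "0 \<le> 5 / real M" by simp
  then have "0 \<le> 1 + \<epsilon>" using M(2) by linarith
  then have le: "(1 + 5 / real M) * fst s \<le> (1 + \<epsilon>) * b"
    using M(2) sb s0 by (intro mult_mono) simp_all
  have "?d i k \<le> (1 + \<epsilon>) * b" if "C \<in> Q" "i \<in> C" "k \<in> C" for C i k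
  proof -
    obtain j where "C = ?class j" using \<open>C \<in> Q\<close> unfolding Q_def by blast
    then have "i < length us" "k < length us" "?a i = ?a k" using \<open>i \<in> C\<close> \<open>k \<in> C\<close> by simp_all
    from sound(2)[OF this] le show ?thesis by linarith
  qed
  moreover have "0 \<le> (1 + \<epsilon>) * b" using b(1) \<open>0 \<le> 1 + \<epsilon>\<close> by simp
  ultimately have "c Q \<le> (1 + \<epsilon>) * b"
    unfolding c_def using clustering_cost_le_iff[OF pQ, of ?d] by simp
  with fQ show ?thesis unfolding Q b_def P1(2) by blast
qed

end

lemma ptas_clustering: "has_PTAS tree_clustering_problem"
proof (rule has_PTASI[where f = "\<lambda>M x. cluster M (root_tree (fst x)) (fst (snd x)) (snd (snd x))"])
  let ?f = "\<lambda>M x. cluster M (root_tree (fst x)) (fst (snd x)) (snd (snd x))"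
  show "polytime (?f M)" for M by (rule polytime_cluster)
  fix \<epsilon> M I x
  assume M0: "0 < M" and M': "5 / real M \<le> \<epsilon>"
    and inst: "I \<in> instances tree_clustering_problem" "encodes tree_clustering_problem I x"
  obtain T us r where I: "I = (T, us, r)" by (cases I)
  with inst have wt: "weighted_tree T" "set us \<subseteq> verts T" "0 < r"
    and x: "\<exists>z. tree_encodes T z \<and> x = VPair z (VPair (val_of_list val_of_nat us) (val_of_nat r))"
    unfolding tree_clustering_problem_def by simp_all
  obtain z where z: "tree_encodes T z" "x = VPair z (VPair (val_of_list val_of_nat us) (val_of_nat r))"
    using x by blast
  obtain t where t: "z = enc (t :: nat list \<times> (nat \<times> nat \<times> real) list)" "tree_instance T (root_tree t)"
    by (rule tree_encodes_enc[OF wt(1) z(1)])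
  interpret tree_instance T "root_tree t" by (rule t(2))
  have e: "val_of_list val_of_nat l = enc l" for l by (simp add: enc_list_def enc_nat_def)
  have e': "val_of_list (val_of_list val_of_nat) l = enc l" for l
  proof -
    have "val_of_list val_of_nat = enc" by (rule ext) (rule e)
    then show ?thesis by (simp add: enc_list_def)
  qed
  have a: "x = enc (t, us, r)" unfolding z(2) t(1) e by (simp add: val_of_nat_def)
  show "\<exists>a. x = enc a \<and> ((\<exists>s. feasible tree_clustering_problem I s) \<longrightarrow>
    (\<exists>s. sol_encodes tree_clustering_problem I s (enc (?f M a)) \<and> feasible tree_clustering_problem I s \<and>
      cost tree_clustering_problem I s \<le> (1 + \<epsilon>) * OPT tree_clustering_problem I))"
  proof (intro exI[of _ "(t, us, r)"] conjI impI a)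
    assume "\<exists>s. feasible tree_clustering_problem I s"
    then obtain P0 where "clustering_feasible {..<length us} r P0"
      unfolding I tree_clustering_problem_def by auto
    note correct = cluster_correct[OF wt(2,3) M0 M' this]
    let ?css = "cluster M (root_tree t) us r"
    have "\<exists>css. set ` set ?css = set ` set css \<and> enc ?css = enc css" by blast
    with correct show "\<exists>s. sol_encodes tree_clustering_problem I s (enc (?f M (t, us, r))) \<and>
        feasible tree_clustering_problem I s \<and>
        cost tree_clustering_problem I s \<le> (1 + \<epsilon>) * OPT tree_clustering_problem I"
      unfolding OPT_def I tree_clustering_problem_def by (intro exI[of _ "set ` set ?css"]) (simp add: e')
  qed
qed

lemma ptas_gathering: "has_PTAS tree_gathering_problem"
proof (rule has_PTASI[where f = "\<lambda>M x. gather M (root_tree (fst x)) (fst (snd x)) (fst (snd (snd x))) (snd (snd (snd x)))"])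
  let ?f = "\<lambda>M x. gather M (root_tree (fst x)) (fst (snd x)) (fst (snd (snd x))) (snd (snd (snd x)))"
  show "polytime (?f M)" for M by (rule polytime_gather)
  fix \<epsilon> M I x
  assume M0: "0 < M" and M': "5 / real M \<le> \<epsilon>"
    and inst: "I \<in> instances tree_gathering_problem" "encodes tree_gathering_problem I x"
  obtain T us fs r where I: "I = (T, us, fs, r)" by (cases I)
  with inst have wt: "weighted_tree T" "set us \<subseteq> verts T" "set fs \<subseteq> verts T"
    and x: "\<exists>z. tree_encodes T z \<and> x = VPair z (VPair (val_of_list val_of_nat us)
             (VPair (val_of_list val_of_nat fs) (val_of_nat r)))"
    unfolding tree_gathering_problem_def by simp_all
  obtain z where z: "tree_encodes T z" "x = VPair z (VPair (val_of_list val_of_nat us)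
             (VPair (val_of_list val_of_nat fs) (val_of_nat r)))" using x by blast
  obtain t where t: "z = enc (t :: nat list \<times> (nat \<times> nat \<times> real) list)" "tree_instance T (root_tree t)"
    by (rule tree_encodes_enc[OF wt(1) z(1)])
  interpret tree_instance T "root_tree t" by (rule t(2))
  have e: "val_of_list val_of_nat l = enc l" for l by (simp add: enc_list_def enc_nat_def)
  have a: "x = enc (t, us, fs, r)" unfolding z(2) t(1) e by (simp add: val_of_nat_def)
  show "\<exists>a. x = enc a \<and> ((\<exists>s. feasible tree_gathering_problem I s) \<longrightarrow>
    (\<exists>s. sol_encodes tree_gathering_problem I s (enc (?f M a)) \<and> feasible tree_gathering_problem I s \<and>
      cost tree_gathering_problem I s \<le> (1 + \<epsilon>) * OPT tree_gathering_problem I))"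
  proof (intro exI[of _ "(t, us, fs, r)"] conjI impI a)
    assume "\<exists>s. feasible tree_gathering_problem I s"
    then obtain \<pi>0 where "gathering_feasible {..<length us} {..<length fs} r \<pi>0"
      unfolding I tree_gathering_problem_def by auto
    from gather_correct[OF wt(2,3) M0 M' this] obtain \<pi> where
      \<pi>: "gather M (root_tree t) us fs r = map \<pi> [0..<length us]"
      "gathering_feasible {..<length us} {..<length fs} r \<pi>"
      "gathering_cost (\<lambda>u f. tree_dist T (us ! u) (fs ! f)) {..<length us} \<pi> \<le> (1 + \<epsilon>) *
        (INF \<pi>\<in>{\<pi>. gathering_feasible {..<length us} {..<length fs} r \<pi>}.
           gathering_cost (\<lambda>u f. tree_dist T (us ! u) (fs ! f)) {..<length us} \<pi>)"
      by blast
    then show "\<exists>s. sol_encodes tree_gathering_problem I s (enc (?f M (t, us, fs, r))) \<and>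
        feasible tree_gathering_problem I s \<and>
        cost tree_gathering_problem I s \<le> (1 + \<epsilon>) * OPT tree_gathering_problem I"
      unfolding OPT_def I tree_gathering_problem_def by (intro exI[of _ \<pi>]) (simp add: e)
  qed
qed

theorem theorem4:
  shows "has_PTAS tree_clustering_problem \<and> has_PTAS tree_gathering_problem"
  by (rule conjI[OF ptas_clustering ptas_gathering])

end
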